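(* Consider the operators $\mathcal{C},\mathcal{T}$ on the Hardy spaces $H^p(\mathbb{U})$ of the upper half-plane and the operators $\mathtt{C},\mathtt{T}$ on the spaces $L^p(\mathbb{R})$. Then: (i) For $1<p<\infty$ and $f\in H^p(\mathbb{U})$, $\ \mathcal{C}(f)^{*}=\mathtt{C}(f^{*})$ (almost everywhere on $\mathbb{R}$). (ii) For $1\le p<\infty$ and $f\in H^p(\mathbb{U})$, $\ \mathcal{T}(f)^{*}=\mathtt{T}(f^{*})$ (almost everywhere on $\mathbb{R}$).
   Context: $\mathbb{U}=\{z\in\mathbb{C}:\mathrm{Im}(z)>0\}$ is the upper half-plane. For $0<p<\infty$, the Hardy space $H^p(\mathbb{U})$ is the space of analytic functions $f:\mathbb{U}\to\mathbb{C}$ with $$\Vert f\Vert_p=\sup_{y>0}\Bigl(\int_{-\infty}^{\infty}|f(x+iy)|^p\,dx\Bigr)^{1/p}<\infty .$$ For $1\le p<\infty$ and $f\in H^p(\mathbb{U})$, the boundary function is $f^*(x)=\lim_{y\to0^+}f(x+iy)$, which exists for almost every $x\in\mathbb{R}$ and belongs to $L^p(\mathbb{R})$ with $\Vert f^*\Vert_{L^p(\mathbb{R})}=\Vert f\Vert_p$. For $1<p<\infty$ and $f\in H^p(\mathbb{U})$, $\mathcal{C}(f)(z)=\frac1z\int_0^z f(\zeta)\,d\zeta$, $z\in\mathbb{U}$, with the integral taken along the segment $[0,z]$ (improper at $0$); $\mathcal{C}$ is a bounded operator on $H^p(\mathbb{U})$. For $1\le p<\infty$ and $f\in H^p(\mathbb{U})$,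 $\mathcal{T}(f)(z)=\int_z^\infty\frac{f(\zeta)}{\zeta}\,d\zeta$, $z\in\mathbb{U}$, meaning $\lim_{w\to\infty,\ w\in\mathbb{U}}\int_z^w\frac{f(\zeta)}{\zeta}\,d\zeta$ (integral along any path in $\mathbb{U}$ from $z$ to $w$); $\mathcal{T}$ is a bounded operator on $H^p(\mathbb{U})$. For $g\in L^p(\mathbb{R})$, $1<p<\infty$, $\mathtt{C}(g)(x)=\frac1x\int_0^x g(u)\,du$ for $x\neq0$. For $g\in L^p(\mathbb{R})$, $1\le p<\infty$, $\mathtt{T}(g)(x)=\int_x^\infty\frac{g(u)}{u}\,du$ if $x>0$ and $\mathtt{T}(g)(x)=-\int_{-\infty}^x\frac{g(u)}{u}\,du$ if $x<0$. The values at $x=0$ are arbitrary. These operators are bounded on $L^p(\mathbb{R})$ for the stated ranges of $p$. *)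

theory Defs
  imports "HOL-Complex_Analysis.Complex_Analysis"
begin

definition upper_half_plane :: "complex set" where
  "upper_half_plane = {z. Im z > 0}"

definition hardy_mean :: "real \<Rightarrow> (complex \<Rightarrow> complex) \<Rightarrow> real \<Rightarrow> real" where
  "hardy_mean p f y = (LINT x|lborel. norm (f (Complex x y)) powr p) powr (1 / p)"

(* The supremum over y > 0 of the (extended real valued) means is finite iff every integral
   is finite and the means are bounded.  Integrability has to be required separately, since
   the Bochner integral of a non-integrable function is 0. *)
definition hardy_space :: "real \<Rightarrow> (complex \<Rightarrow> complex) set" where
  "hardy_space p = {f. f holomorphic_on upper_half_plane \<and>
     (\<forall>y>0. integrable lborel (\<lambda>x. norm (f (Complex x y)) powr p)) \<and>
     bdd_above (hardy_mean p f ` {0<..})}"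

definition has_boundary_limit :: "(complex \<Rightarrow> complex) \<Rightarrow> real \<Rightarrow> bool" where
  "has_boundary_limit f x \<longleftrightarrow> (\<exists>l. ((\<lambda>y. f (Complex x y)) \<longlongrightarrow> l) (at_right 0))"

(* Meaningful at the points x with has_boundary_limit f x. *)
definition boundary_fun :: "(complex \<Rightarrow> complex) \<Rightarrow> real \<Rightarrow> complex" where
  "boundary_fun f x = Lim (at_right 0) (\<lambda>y. f (Complex x y))"

(* The integral over the segment [0,z] is improper at 0: it is the limit, as t tends to 0
   from the right, of the integrals over the segments [t z, z]. *)
definition cesaro_hardy :: "(complex \<Rightarrow> complex) \<Rightarrow> complex \<Rightarrow> complex" where
  "cesaro_hardy f z =
     1 / z * Lim (at_right (0::real)) (\<lambda>t. contour_integral (linepath (of_real t * z) z) f)"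

(* For z, w in the half-plane (which is convex) and f holomorphic there, the integral of
   f \<zeta> / \<zeta> from z to w does not depend on the path by Cauchy's theorem; the segment is used
   as its representative.  The filter expresses w tending to infinity inside the half-plane. *)
definition tail_hardy :: "(complex \<Rightarrow> complex) \<Rightarrow> complex \<Rightarrow> complex" where
  "tail_hardy f z =
     Lim (inf at_infinity (principal upper_half_plane))
       (\<lambda>w. contour_integral (linepath z w) (\<lambda>\<zeta>. f \<zeta> / \<zeta>))"

(* Oriented integral: for x < 0 it is minus the integral over (x,0).  The value at 0 is
   irrelevant, here and in the next definition. *)
definition cesaro_real :: "(real \<Rightarrow> complex) \<Rightarrow> real \<Rightarrow> complex" where
  "cesaro_real g x = 1 / of_real x * (LINT u=0..ereal x|lebesgue. g u)"

definition tail_real :: "(real \<Rightarrow> complex) \<Rightarrow> real \<Rightarrow> complex" where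
  "tail_real g x =
     (if x > 0 then (LINT u:{x..}|lebesgue. g u / of_real u)
      else if x < 0 then - (LINT u:{..x}|lebesgue. g u / of_real u)
      else 0)"

end

theory Submission
  imports Defs
begin

text \<open>
  Write \<open>f\<^sub>y x = f (x + iy)\<close>. For \<open>f\<close> in \<open>H\<^sup>p\<close> the function \<open>h = f / (z + i)\<close> lies in \<open>H\<^sup>1\<close>, and the heart of the
  matter is that \<open>h\<^sub>y\<close> is Cauchy in \<open>L\<^sup>1\<close> as \<open>y\<close> tends to 0. Both \<open>sqrt \<bar>h\<bar>\<close> and \<open>Re (c h)\<close> are dominated by the
  Poisson integrals of their values on a lower horizontal line. Together these two inequalities bound
  the mean oscillation of \<open>h\<^sub>\<epsilon>\<close> around \<open>h\<^sub>y\<close>, averaged with the Poisson kernel, by the difference of the \<open>L\<^sup>1\<close>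
  norms of \<open>h\<^sub>\<epsilon>\<close> and \<open>h\<^sub>y\<close>, which is small once the norm of \<open>h\<^sub>y\<close> is close to the supremum over all heights.

  Consequently primitives of \<open>f\<close> and of \<open>f / z\<close> extend continuously to the real line (to \<open>x \<noteq> 0\<close> for
  \<open>f / z\<close>), where they are indefinite integrals of the \<open>L\<^sup>1\<close> limits. A Fatou theorem at points of
  differentiability identifies the \<open>L\<^sup>1\<close> limit with \<open>f\<^sup>*\<close>. The two operators are differences of values of
  such primitives; for the second one, the primitive of \<open>f / z\<close> has a limit at infinity since its
  horizontal increments far from the origin are uniformly small.
\<close>

section \<open>Holomorphic functions on the upper half-plane\<close>

text \<open>The operators integrate \<open>f\<close> along paths that end on the real line, where
  \<open>f\<close> may be unbounded, so pointwise limits of \<open>f\<close> do not pass to the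
  integrals, whereas convergence in mean does. Dividing by z + \<i> buys integrability at infinity
  without a zero of the denominator in the closed half-plane, and brings every exponent p \<ge> 1 to
  \<open>L^1\<close>. There a norm bound alone does not provide a limit function; this obstacle
  shapes the proof. That the Poisson average of |a| on a lower line exceeds the value |b| above says
  nothing about how far single values a are from b. Taking square roots repairs this for the
  modulus: the average of (sqrt |a| - sqrt |b|)^2 is at most the average of |a| minus |b|. The phase
  is handled by Re (c a), with c the conjugate phase of b. Both errors are bounded by the same
  excess, whose integral over the line is a difference of norms. The factor 1 / z is singular at 0,
  so \<open>f / z\<close> is followed to the boundary only on intervals that avoid this
  point.\<close>

lemma open_upper_half_plane [simp]: "open upper_half_plane"
  by (simp add: upper_half_plane_def open_halfspace_Im_gt)

lemma convex_upper_half_plane [simp]: "convex upper_half_plane"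
  by (simp add: upper_half_plane_def convex_halfspace_Im_gt)

lemma in_upper_half_plane [simp]: "z \<in> upper_half_plane \<longleftrightarrow> Im z > 0"
  by (simp add: upper_half_plane_def)

lemma upper_half_plane_primitive:
  assumes "f holomorphic_on upper_half_plane"
  obtains F where "\<And>z. Im z > 0 \<Longrightarrow> (F has_field_derivative f z) (at z)"
proof -
  obtain F where "\<And>z. z \<in> upper_half_plane \<Longrightarrow> (F has_field_derivative f z) (at z within upper_half_plane)"
    using holomorphic_convex_primitive'[OF convex_upper_half_plane open_upper_half_plane assms] by blast
  then show ?thesis using that[of F] at_within_open[OF _ open_upper_half_plane] by simp
qed

lemma continuous_on_horizontal:
  assumes "f holomorphic_on upper_half_plane" "y > 0"
  shows "continuous_on S (\<lambda>x. f (Complex x y))"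
proof -
  have "continuous_on S (\<lambda>x. Complex x y)"
    by (auto simp: Complex_eq intro!: continuous_intros)
  moreover have "continuous_on upper_half_plane f"
    using assms holomorphic_on_imp_continuous_on by blast
  ultimately show ?thesis
    using assms(2) by (elim continuous_on_compose2) auto
qed

lemma vector_derivative_horizontal:
  assumes "(F has_field_derivative f') (at (Complex x y))"
  shows "((\<lambda>x. F (Complex x y)) has_vector_derivative f') (at x within S)"
proof -
  have "((\<lambda>x. Complex x y) has_vector_derivative 1) (at x within S)"
    unfolding Complex_eq by (auto intro!: derivative_eq_intros)
  from field_vector_diff_chain_within[OF this, of F f'] assms show ?thesis
    by (simp add: o_def has_field_derivative_at_within)
qed

lemma vector_derivative_vertical:
  assumes "(F has_field_derivative f') (at (Complex x y))"
  shows "((\<lambda>y. F (Complex x y)) has_vector_derivative (\<i> * f')) (at y within S)"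
proof -
  have "((\<lambda>y. Complex x y) has_vector_derivative \<i>) (at y within S)"
    unfolding Complex_eq by (auto intro!: derivative_eq_intros)
  from field_vector_diff_chain_within[OF this, of F f'] assms show ?thesis
    by (simp add: o_def has_field_derivative_at_within)
qed

lemma horizontal_increment:
  assumes f: "f holomorphic_on upper_half_plane"
    and F: "\<And>z. Im z > 0 \<Longrightarrow> (F has_field_derivative f z) (at z)"
    and "a \<le> b" "y > 0"
  shows "F (Complex b y) - F (Complex a y) = (LINT x:{a..b}|lborel. f (Complex x y))"
proof -
  have "((\<lambda>x. f (Complex x y)) has_integral (F (Complex b y) - F (Complex a y))) {a..b}"
    using assms by (intro fundamental_theorem_of_calculus vector_derivative_horizontal F) auto
  moreover have "set_integrable lborel {a..b} (\<lambda>x. f (Complex x y))"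
    by (intro borel_integrable_atLeastAtMost' continuous_on_horizontal assms)
  ultimately show ?thesis
    by (metis set_borel_integral_eq_integral(2) integral_unique)
qed

lemma norm_horizontal_increment_le:
  assumes f: "f holomorphic_on upper_half_plane"
    and F: "\<And>z. Im z > 0 \<Longrightarrow> (F has_field_derivative f z) (at z)"
    and "a \<le> b" "y > 0"
  shows "norm (F (Complex b y) - F (Complex a y)) \<le> (LINT x:{a..b}|lborel. norm (f (Complex x y)))"
proof -
  have "F (Complex b y) - F (Complex a y) = (LINT x:{a..b}|lborel. f (Complex x y))"
    using f F assms(3,4) by (rule horizontal_increment)
  then show ?thesis
    unfolding set_lebesgue_integral_def
    using integral_norm_bound[of lborel "\<lambda>x. indicat_real {a..b} x *\<^sub>R f (Complex x y)"] by simp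
qed

lemma set_integrable_horizontal:
  assumes f: "f holomorphic_on upper_half_plane" and "y > 0"
  shows "set_integrable lborel {a..b} (\<lambda>x. f (Complex x y))"
  by (intro borel_integrable_atLeastAtMost' continuous_on_horizontal assms)

lemma onorm_scaleR_left_le:
  fixes v :: "'a::real_normed_vector"
  assumes "norm v \<le> B"
  shows "onorm (\<lambda>t::real. t *\<^sub>R v) \<le> B"
  using mult_right_mono[OF assms abs_ge_zero] by (intro onorm_le) (simp add: mult.commute)

lemma primitive_holomorphic_on:
  assumes "\<And>z. Im z > 0 \<Longrightarrow> (K has_field_derivative k z) (at z)"
  shows "K holomorphic_on upper_half_plane"
  unfolding holomorphic_on_open[OF open_upper_half_plane] using assms in_upper_half_plane by blast

text \<open>Turns bounds for horizontal integrals into a pointwise bound. Cauchy's inequality on the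
  disc of radius Im z / 2, applied to F (w + s) - F w, shows that \<open>f\<close> varies by at most
  2 B / Im z on [z, z + 1], and its mean there, F (z + 1) - F z, has norm at most B.\<close>

lemma upper_half_plane_bound_by_increments:
  assumes f: "f holomorphic_on upper_half_plane"
    and F: "\<And>z. Im z > 0 \<Longrightarrow> (F has_field_derivative f z) (at z)"
    and B: "\<And>z s. Im z > 0 \<Longrightarrow> 0 \<le> s \<Longrightarrow> s \<le> 1 \<Longrightarrow> norm (F (z + of_real s) - F z) \<le> B"
    and z: "Im z > 0"
  shows "norm (f z) \<le> B + 2 * B / Im z"
proof -
  define r where "r = Im z / 2"
  have r: "r > 0" using z by (simp add: r_def)
  have sub: "Im w > 0" if "w \<in> cball z r" for w
    using that abs_Im_le_cmod[of "z - w"] z by (simp add: r_def dist_norm)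
  have dif: "norm (f (z + of_real s) - f z) \<le> 2 * B / Im z" if s: "0 \<le> s" "s \<le> 1" for s
  proof -
    define D where "D = (\<lambda>w. F (w + of_real s) - F w)"
    have D: "(D has_field_derivative (f (w + of_real s) - f w)) (at w)" if "Im w > 0" for w
    proof -
      have "((\<lambda>w. F (w + of_real s)) has_field_derivative f (w + of_real s)) (at w)"
        using F[of "w + of_real s"] that by (simp add: DERIV_shift)
      then show ?thesis unfolding D_def using F[OF that] by (rule DERIV_diff)
    qed
    have hol: "D holomorphic_on cball z r"
      unfolding holomorphic_on_def field_differentiable_def
      using D sub by (blast intro: has_field_derivative_at_within)
    have "norm ((deriv ^^ 1) D z) \<le> fact 1 * B / r ^ 1"
    proof (rule Cauchy_inequality)
      show "D holomorphic_on ball z r" using hol ball_subset_cball holomorphic_on_subset by blast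
      show "continuous_on (cball z r) D" using hol holomorphic_on_imp_continuous_on by blast
      show "norm (D w) \<le> B" if "norm (z - w) = r" for w
        using B[of w s] s sub[of w] that by (simp add: D_def dist_norm)
    qed (use r in auto)
    moreover have "deriv D z = f (z + of_real s) - f z"
      using D[OF z] by (rule DERIV_imp_deriv)
    ultimately show ?thesis by (simp add: r_def field_simps)
  qed
  define h where "h = (\<lambda>s. F (z + of_real s) - of_real s * f z)"
  have der: "(h has_vector_derivative (f (z + of_real s) - f z)) (at s within {0..1})" for s
  proof -
    have "((\<lambda>s. z + of_real s) has_vector_derivative 1) (at s within {0..1})"
      by (auto intro!: derivative_eq_intros)
    from field_vector_diff_chain_within[OF this, of F "f (z + of_real s)"] F[of "z + of_real s"] z
    have "((\<lambda>s. F (z + of_real s)) has_vector_derivative f (z + of_real s)) (at s within {0..1})"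
      by (simp add: o_def has_field_derivative_at_within)
    moreover have "((\<lambda>s. of_real s * f z) has_vector_derivative f z) (at s within {0..1})"
      by (auto intro!: derivative_eq_intros)
    ultimately show ?thesis unfolding h_def by (rule has_vector_derivative_diff)
  qed
  have "norm (h 1 - h 0) \<le> 2 * B / Im z * norm (1 - 0 :: real)"
  proof (rule differentiable_bound[of "{0..1}" h "\<lambda>s t. t *\<^sub>R (f (z + of_real s) - f z)"])
    fix s :: real assume "s \<in> {0..1}"
    then show "onorm (\<lambda>t. t *\<^sub>R (f (z + of_real s) - f z)) \<le> 2 * B / Im z"
      by (intro onorm_scaleR_left_le dif) auto
  qed (use der in \<open>auto simp: has_vector_derivative_def\<close>)
  then have "norm (F (z + 1) - F z - f z) \<le> 2 * B / Im z" by (simp add: h_def algebra_simps)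
  moreover have "norm (F (z + 1) - F z) \<le> B" using B[of z 1] z by simp
  ultimately show ?thesis
    using norm_triangle_ineq4[of "F (z + 1) - F z" "F (z + 1) - F z - f z"] by simp
qed

text \<open>A Phragmen-Lindelof argument in the half disc. The quotient G z / z should be bounded,
  but 0 lies on the boundary; z + \<i> \<delta> in place of z removes the singularity and only
  enlarges the denominator on Im z \<ge> 0. The arc, where just a crude bound for G is at hand, is
  damped by an exponential that is at most 1 on the diameter; undoing it costs a factor that tends
  to 1 at the origin.\<close>

lemma norm_less_local_bound:
  fixes G :: "complex \<Rightarrow> complex"
  assumes hol: "G holomorphic_on {z. Im z > 0 \<and> norm z < r}"
    and cont: "continuous_on {z. Im z \<ge> 0 \<and> norm z \<le> r} G"
    and r: "r > 0" and \<epsilon>: "\<epsilon> > 0"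
    and bot: "\<And>t. \<bar>t\<bar> \<le> r \<Longrightarrow> norm (G (of_real t)) \<le> \<epsilon> * \<bar>t\<bar>"
  obtains M where "M \<ge> 0" "\<And>z. Im z > 0 \<Longrightarrow> norm z < r \<Longrightarrow> norm (G z) \<le> \<epsilon> * exp (M * norm z) * norm z"
proof -
  let ?S = "{z. Im z > 0 \<and> norm z < r}" and ?T = "{z. Im z \<ge> 0 \<and> norm z \<le> r}"
  have S: "?S = {z. Im z > 0} \<inter> ball 0 r" and T: "?T = {z. Im z \<ge> 0} \<inter> cball 0 r" by auto
  have opS: "open ?S" unfolding S by (intro open_Int open_halfspace_Im_gt open_ball)
  have clT: "closed ?T" unfolding T by (intro closed_Int closed_halfspace_Im_ge closed_cball)
  have compT: "compact ?T"
    unfolding T by (intro closed_Int_compact closed_halfspace_Im_ge compact_cball)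
  have clS: "closure ?S \<subseteq> ?T" by (intro closure_minimal clT) auto
  obtain B where B: "B > 0" "\<And>z. z \<in> ?T \<Longrightarrow> norm (G z) \<le> B"
    using compact_imp_bounded[OF compact_continuous_image[OF cont compT]]
    by (auto simp: bounded_pos)
  \<comment> \<open>This makes B * exp (- M) at most r * \<epsilon>, the bound required on the arc;
    the maximum with 1 keeps M nonnegative.\<close>
  define M where "M = ln (max 1 (B / (r * \<epsilon>)))"
  have M: "M \<ge> 0" "exp M \<ge> B / (r * \<epsilon>)" by (auto simp: M_def)
  \<comment> \<open>The harmonic function Re E vanishes at 0, is nonnegative on the diameter and at
    least 1 on the arc: for |z| = r the numerator of Re E is r^2 + 2 Im z (r - Im z).\<close>
  define E where "E = (\<lambda>z. (z\<^sup>2 - 2 * \<i> * of_real r * z) / of_real (r\<^sup>2))"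
  have ReE: "Re (E z) = ((Re z)\<^sup>2 - (Im z)\<^sup>2 + 2 * r * Im z) / r\<^sup>2" for z
    by (simp add: E_def power2_eq_square del: of_real_mult of_real_power)
  have main: "norm (G z) \<le> \<epsilon> * exp (M * Re (E z)) * norm (z + \<i> * of_real \<delta>)"
    if z: "z \<in> ?S" and \<delta>: "\<delta> > 0" for z \<delta>
  proof -
    define Q where "Q = (\<lambda>z. G z * exp (- of_real M * E z) / (z + \<i> * of_real \<delta>))"
    have nz: "z + \<i> * of_real \<delta> \<noteq> 0" if "Im z \<ge> 0" for z
      using that \<delta> by (auto simp: complex_eq_iff)
    have "norm (Q z) \<le> \<epsilon>"
    proof (rule maximum_modulus_frontier[of Q ?S])
      show "Q holomorphic_on interior ?S"
        unfolding interior_open[OF opS] Q_def E_def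
        by (intro holomorphic_intros hol) (use nz r in auto)
      show "continuous_on (closure ?S) Q"
        by (rule continuous_on_subset[OF _ clS])
           (unfold Q_def E_def, intro continuous_intros cont, use nz r in auto)
      show "bounded ?S" unfolding S using bounded_ball by blast
      show "z \<in> ?S" by fact
      fix w assume "w \<in> frontier ?S"
      then have w: "w \<in> ?T" "w \<notin> ?S" using clS interior_open[OF opS] by (auto simp: frontier_def)
      have nQ: "norm (Q w) = norm (G w) * exp (- M * Re (E w)) / norm (w + \<i> * of_real \<delta>)"
        by (simp add: Q_def norm_mult norm_divide norm_exp_eq_Re)
      have le: "norm w \<le> norm (w + \<i> * of_real \<delta>)"
        using w(1) \<delta> by (auto simp: cmod_def power_mono)
      have pos: "norm (w + \<i> * of_real \<delta>) > 0" using nz[of w] w by auto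
      show "norm (Q w) \<le> \<epsilon>"
      proof (cases "Im w = 0")
        case True
        then have wr: "of_real (Re w) = w" by (simp add: complex_eq_iff)
        then have nw: "norm w = \<bar>Re w\<bar>" by (metis norm_of_real)
        have "norm (G w) \<le> \<epsilon> * norm w"
          using bot[of "Re w"] w(1) unfolding wr by (simp add: nw)
        moreover have "exp (- M * Re (E w)) \<le> 1" using M True by (simp add: ReE)
        ultimately have "norm (G w) * exp (- M * Re (E w)) \<le> (\<epsilon> * norm w) * 1"
          using \<epsilon> by (intro mult_mono) auto
        also have "\<dots> \<le> \<epsilon> * norm (w + \<i> * of_real \<delta>)" using le \<epsilon> by simp
        finally show ?thesis unfolding nQ using pos by (simp add: divide_le_eq)
      next
        case False
        then have nw: "norm w = r" "Im w > 0" "Im w \<le> r" using w abs_Im_le_cmod[of w] by auto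
        have sq: "(Re w)\<^sup>2 + (Im w)\<^sup>2 = r\<^sup>2" using nw cmod_power2[of w] by simp
        have "(Re w)\<^sup>2 - (Im w)\<^sup>2 + 2 * r * Im w = r\<^sup>2 + 2 * Im w * (r - Im w)"
          using sq by (simp add: power2_eq_square algebra_simps)
        then have "Re (E w) \<ge> 1" unfolding ReE using nw r by (simp add: le_divide_eq)
        then have "exp (- M * Re (E w)) \<le> exp (- M)" using M mult_left_mono[of 1 "Re (E w)" M] by simp
        also have "\<dots> \<le> r * \<epsilon> / B"
          using M(2) B(1) r \<epsilon> by (simp add: exp_minus field_simps)
        finally have "norm (G w) * exp (- M * Re (E w)) \<le> B * (r * \<epsilon> / B)"
          using B(2)[OF w(1)] B(1) by (intro mult_mono) auto
        also have "\<dots> = \<epsilon> * norm w" using B nw by simp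
        also have "\<dots> \<le> \<epsilon> * norm (w + \<i> * of_real \<delta>)" using le \<epsilon> by simp
        finally show ?thesis unfolding nQ using pos by (simp add: divide_le_eq)
      qed
    qed
    moreover have "norm (Q z) = norm (G z) / exp (M * Re (E z)) / norm (z + \<i> * of_real \<delta>)"
      by (simp add: Q_def norm_mult norm_divide norm_exp_eq_Re exp_minus divide_inverse norm_inverse)
    moreover have "norm (z + \<i> * of_real \<delta>) > 0" using nz[of z] z by auto
    ultimately show ?thesis by (simp add: divide_le_eq mult_ac)
  qed
  show ?thesis
  proof (rule that[of "3 * M / r"])
    show "3 * M / r \<ge> 0" using M r by simp
    fix z :: complex assume z: "Im z > 0" "norm z < r"
    have lim: "((\<lambda>\<delta>. \<epsilon> * exp (M * Re (E z)) * norm (z + \<i> * of_real \<delta>)) \<longlongrightarrow> \<epsilon> * exp (M * Re (E z)) * norm (z + \<i> * of_real 0)) (at_right 0)"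
      by (intro tendsto_intros)
    have 1: "norm (G z) \<le> \<epsilon> * exp (M * Re (E z)) * norm (z + \<i> * of_real 0)"
    proof (rule tendsto_le[OF _ lim tendsto_const])
      show "\<forall>\<^sub>F \<delta> in at_right 0. norm (G z) \<le> \<epsilon> * exp (M * Re (E z)) * norm (z + \<i> * of_real \<delta>)"
        using main[of z] z by (auto simp: eventually_at_filter)
    qed simp
    have "(Re z)\<^sup>2 - (Im z)\<^sup>2 \<le> norm z * norm z"
      using cmod_power2[of z] zero_le_power2[of "Im z"] by (simp add: power2_eq_square)
    also have "\<dots> \<le> r * norm z" using z by (intro mult_right_mono) auto
    finally have "Re (E z) \<le> (r * norm z + 2 * r * norm z) / r\<^sup>2"
      unfolding ReE using abs_Im_le_cmod[of z] z r by (intro divide_right_mono add_mono) auto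
    also have "\<dots> = 3 / r * norm z" using r by (simp add: power2_eq_square)
    finally have "M * Re (E z) \<le> 3 * M / r * norm z" using mult_left_mono[OF _ M(1), of "Re (E z)" "3 / r * norm z"] by (simp add: mult_ac)
    then show "norm (G z) \<le> \<epsilon> * exp (3 * M / r * norm z) * norm z"
      using 1 \<epsilon> by (elim order_trans) (auto intro!: mult_right_mono)
  qed
qed

section \<open>Boundary values of primitives\<close>

lemma Cauchy_at_right_convergent:
  fixes f :: "real \<Rightarrow> 'a::complete_space"
  assumes "\<And>e. e > 0 \<Longrightarrow> \<exists>d>0. \<forall>y s. 0 < y \<longrightarrow> y < d \<longrightarrow> 0 < s \<longrightarrow> s < d \<longrightarrow> dist (f y) (f s) < e"
  obtains l where "(f \<longlongrightarrow> l) (at_right 0)"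
proof -
  let ?y = "\<lambda>n. inverse (real (Suc n))"
  have ev: "\<exists>N. \<forall>n\<ge>N. ?y n < d" if "d > 0" for d
    using order_tendstoD(2)[OF LIMSEQ_inverse_real_of_nat that] by (simp add: eventually_sequentially)
  have "Cauchy (\<lambda>n. f (?y n))"
  proof (rule metric_CauchyI)
    fix e :: real assume "e > 0"
    then obtain d where d: "d > 0"
      "\<And>y s. 0 < y \<Longrightarrow> y < d \<Longrightarrow> 0 < s \<Longrightarrow> s < d \<Longrightarrow> dist (f y) (f s) < e"
      using assms by metis
    then obtain N where "\<forall>n\<ge>N. ?y n < d" using ev by blast
    then show "\<exists>M. \<forall>m\<ge>M. \<forall>n\<ge>M. dist (f (?y m)) (f (?y n)) < e"
      using d(2) by (intro exI[of _ N]) auto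
  qed
  then obtain l where l: "(\<lambda>n. f (?y n)) \<longlonglongrightarrow> l"
    using convergent_eq_Cauchy by (auto simp: convergent_def)
  have "(f \<longlongrightarrow> l) (at_right 0)"
  proof (rule tendstoI)
    fix e :: real assume "e > 0"
    then obtain d where d: "d > 0"
      "\<And>y s. 0 < y \<Longrightarrow> y < d \<Longrightarrow> 0 < s \<Longrightarrow> s < d \<Longrightarrow> dist (f y) (f s) < e / 2"
      using assms by (metis half_gt_zero)
    obtain N where N: "\<forall>n\<ge>N. ?y n < d" using ev d(1) by blast
    obtain N' where N': "\<forall>n\<ge>N'. dist (f (?y n)) l < e / 2"
      using metric_LIMSEQ_D[OF l, of "e/2"] \<open>e > 0\<close> by auto
    define s where "s = ?y (max N N')"
    have s: "0 < s" "s < d" "dist (f s) l < e / 2" using N N' by (auto simp: s_def)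
    have "dist (f y) l < e" if "0 < y" "y < d" for y
      using d(2)[OF that s(1,2)] s(3) dist_triangle[of "f y" l "f s"] by simp
    then show "\<forall>\<^sub>F y in at_right 0. dist (f y) l < e"
      using d(1) by (auto simp: eventually_at_right_field)
  qed
  then show ?thesis by (rule that)
qed

text \<open>Horizontal increments of K converge uniformly because the slices of k converge in mean.
  One vertical limit is still missing, and no bound for k along vertical lines is given. It comes
  from a second primitive L: J y = L (b + \<i> y) - L (a + \<i> y) is the integral of K over the
  segment at height y, and its derivative in y is \<i> times a horizontal increment of K. This is
  bounded for small y, so J is Lipschitz there.\<close>

lemma boundary_extension_of_primitive:
  assumes k: "k holomorphic_on upper_half_plane"
    and K: "\<And>z. Im z > 0 \<Longrightarrow> (K has_field_derivative k z) (at z)"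
    and ab: "a < b" and g: "set_integrable lborel {a..b} g"
    and lim: "((\<lambda>y. LINT x:{a..b}|lborel. norm (k (Complex x y) - g x)) \<longlongrightarrow> 0) (at_right 0)"
  obtains Kb where
    "continuous_on {z. Im z \<ge> 0 \<and> Re z \<in> {a..b}} (\<lambda>z. if Im z > 0 then K z else Kb (Re z))"
    "\<And>c d. a \<le> c \<Longrightarrow> c \<le> d \<Longrightarrow> d \<le> b \<Longrightarrow> Kb d - Kb c = (LINT x:{c..d}|lborel. g x)"
proof -
  define e where "e = (\<lambda>y. LINT x:{a..b}|lborel. norm (k (Complex x y) - g x))"
  define Ig where "Ig = (\<lambda>c. LINT x:{a..c}|lborel. g x)"
  have gsub: "set_integrable lborel {c..d} g" if "a \<le> c" "d \<le> b" for c d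
    using set_integrable_subset[OF g, of "{c..d}"] that by auto
  have Kerr: "norm (K (Complex d y) - K (Complex c y) - (LINT x:{c..d}|lborel. g x)) \<le> e y"
    if "a \<le> c" "c \<le> d" "d \<le> b" "y > 0" for c d y
  proof -
    have ik: "set_integrable lborel S (\<lambda>x. k (Complex x y) - g x)"
      if "S = {c..d} \<or> S = {a..b}" for S
      using that gsub[of c d] g \<open>a \<le> c\<close> \<open>d \<le> b\<close> set_integrable_horizontal[OF k \<open>y > 0\<close>]
      by (auto intro!: set_integral_diff(1))
    have "K (Complex d y) - K (Complex c y) - (LINT x:{c..d}|lborel. g x)
        = (LINT x:{c..d}|lborel. k (Complex x y) - g x)"
      using horizontal_increment[OF k K \<open>c \<le> d\<close> \<open>y > 0\<close>]
        set_integral_diff(2)[OF set_integrable_horizontal[OF k \<open>y > 0\<close>] gsub[of c d]] that by simp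
    also have "norm \<dots> \<le> (LINT x:{c..d}|lborel. norm (k (Complex x y) - g x))"
      using integral_norm_bound[of lborel "\<lambda>x. indicat_real {c..d} x *\<^sub>R (k (Complex x y) - g x)"]
      by (simp add: set_lebesgue_integral_def)
    also have "\<dots> \<le> e y"
      unfolding e_def set_lebesgue_integral_def
      using that set_integrable_norm[OF ik, of "{c..d}"] set_integrable_norm[OF ik, of "{a..b}"]
      by (intro integral_mono) (auto simp: set_integrable_def indicator_def)
    finally show ?thesis .
  qed
  obtain L where L: "\<And>z. Im z > 0 \<Longrightarrow> (L has_field_derivative K z) (at z)"
    using upper_half_plane_primitive[OF primitive_holomorphic_on[OF K]] by blast
  define J where "J = (\<lambda>y. L (Complex b y) - L (Complex a y))"
  \<comment> \<open>Horizontal increments at heights y and s nearly agree, so K (x + \<i> y) - K (x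
    + \<i> s) is nearly the constant \<open>\<kappa>\<close> in x. Its integral over [a, b] is J y -
    J s on the one hand and close to (b - a) \<open>\<kappa>\<close> on the other.\<close>
  have Kdiff: "norm (K (Complex a y) - K (Complex a s)) \<le> e y + e s + norm (J y - J s) / (b - a)"
    if "y > 0" "s > 0" for y s
  proof -
    define \<kappa> where "\<kappa> = K (Complex a y) - K (Complex a s)"
    define h where "h = (\<lambda>c. L (Complex c y) - L (Complex c s) - of_real c * \<kappa>)"
    define h' where "h' = (\<lambda>c. K (Complex c y) - K (Complex c s) - \<kappa>)"
    have der: "(h has_vector_derivative h' c) (at c within {a..b})" for c
      unfolding h_def h'_def using that L
      by (auto intro!: derivative_eq_intros vector_derivative_horizontal)
    have bd: "norm (h' c) \<le> e y + e s" if "c \<in> {a..b}" for c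
    proof -
      have "h' c = (K (Complex c y) - K (Complex a y) - Ig c) - (K (Complex c s) - K (Complex a s) - Ig c)"
        by (simp add: h'_def \<kappa>_def)
      also have "norm \<dots> \<le> e y + e s"
        using Kerr[of a c y] Kerr[of a c s] that \<open>y > 0\<close> \<open>s > 0\<close> unfolding Ig_def
        by (intro order_trans[OF norm_triangle_ineq4 add_mono]) auto
      finally show ?thesis .
    qed
    have "norm (h b - h a) \<le> (e y + e s) * norm (b - a)"
    proof (rule differentiable_bound[of "{a..b}" h "\<lambda>c t. t *\<^sub>R h' c"])
      fix c assume "c \<in> {a..b}"
      then show "onorm (\<lambda>t. t *\<^sub>R h' c) \<le> e y + e s"
        by (intro onorm_scaleR_left_le bd)
    qed (use der ab in \<open>auto simp: has_vector_derivative_def\<close>)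
    moreover have "h b - h a = (J y - J s) - of_real (b - a) * \<kappa>"
      by (simp add: h_def J_def algebra_simps)
    ultimately have "norm ((J y - J s) - of_real (b - a) * \<kappa>) \<le> (e y + e s) * (b - a)"
      using ab by simp
    moreover have "norm (of_real (b - a) * \<kappa>) = (b - a) * norm \<kappa>"
      using ab by (simp add: norm_mult del: of_real_diff)
    ultimately have "(b - a) * norm \<kappa> \<le> norm (J y - J s) + (e y + e s) * (b - a)"
      using norm_triangle_ineq4[of "J y - J s" "J y - J s - of_real (b - a) * \<kappa>"] by simp
    then show ?thesis using ab by (simp add: \<kappa>_def field_simps)
  qed
  have e_small: "\<exists>d>0. \<forall>y. 0 < y \<longrightarrow> y < d \<longrightarrow> e y < \<epsilon>" if "\<epsilon> > 0" for \<epsilon>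
    using order_tendstoD(2)[OF lim that] unfolding e_def eventually_at_right_field by blast
  obtain y0 where y0: "y0 > 0" "\<And>y. 0 < y \<Longrightarrow> y < y0 \<Longrightarrow> e y < 1"
    using e_small[of 1] by auto
  define M where "M = norm (Ig b) + 1"
  have M: "M > 0" unfolding M_def by (simp add: add_nonneg_pos)
  have J: "norm (J y - J s) \<le> M * \<bar>y - s\<bar>" if "0 < y" "y < y0" "0 < s" "s < y0" for y s
  proof -
    let ?J' = "\<lambda>y. \<i> * (K (Complex b y) - K (Complex a y))"
    have "norm (J y - J s) \<le> M * norm (y - s)"
    proof (rule differentiable_bound[of "{0<..<y0}" J "\<lambda>c t. t *\<^sub>R ?J' c"])
      fix c assume c: "c \<in> {0<..<y0}"
      have "(J has_vector_derivative (\<i> * K (Complex b c) - \<i> * K (Complex a c))) (at c within {0<..<y0})"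
        unfolding J_def using c L by (intro has_vector_derivative_diff vector_derivative_vertical) auto
      then show "(J has_derivative (\<lambda>t. t *\<^sub>R ?J' c)) (at c within {0<..<y0})"
        by (simp add: has_vector_derivative_def algebra_simps)
      have "norm (?J' c) \<le> M"
        using Kerr[of a b c] y0(2)[of c] c ab norm_triangle_sub[of "K (Complex b c) - K (Complex a c)" "Ig b"]
        by (simp add: norm_mult M_def Ig_def)
      then show "onorm (\<lambda>t. t *\<^sub>R ?J' c) \<le> M"
        by (rule onorm_scaleR_left_le)
    qed (use that in auto)
    then show ?thesis by simp
  qed
  obtain l where l: "((\<lambda>y. K (Complex a y)) \<longlongrightarrow> l) (at_right 0)"
  proof (rule Cauchy_at_right_convergent)
    fix \<epsilon> :: real assume \<epsilon>: "\<epsilon> > 0"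
    obtain d where d: "d > 0" "\<And>y. 0 < y \<Longrightarrow> y < d \<Longrightarrow> e y < \<epsilon> / 3"
      using e_small[of "\<epsilon> / 3"] \<epsilon> by auto
    \<comment> \<open>Below y0 the Lipschitz constant M is valid; the last entry makes the
      contribution of J, after division by b - a, at most \<epsilon> / 3.\<close>
    define d' where "d' = min (min d y0) (\<epsilon> * (b - a) / (3 * M))"
    have "d' > 0" using d y0 \<epsilon> ab M by (simp add: d'_def)
    moreover have "dist (K (Complex a y)) (K (Complex a s)) < \<epsilon>" if "0 < y" "y < d'" "0 < s" "s < d'" for y s
    proof -
      have "\<bar>y - s\<bar> \<le> \<epsilon> * (b - a) / (3 * M)" using that by (auto simp: d'_def)
      then have "M * \<bar>y - s\<bar> \<le> M * (\<epsilon> * (b - a) / (3 * M))"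
        using M by (intro mult_left_mono) auto
      moreover have "norm (J y - J s) \<le> M * \<bar>y - s\<bar>" using that by (intro J) (auto simp: d'_def)
      ultimately have "norm (J y - J s) \<le> M * (\<epsilon> * (b - a) / (3 * M))" by (rule order_trans[rotated])
      also have "M * (\<epsilon> * (b - a) / (3 * M)) = \<epsilon> / 3 * (b - a)" using M by simp
      finally have "norm (J y - J s) / (b - a) \<le> \<epsilon> / 3" using ab by (simp only: pos_divide_le_eq diff_gt_0_iff_gt)
      moreover have "e y < \<epsilon> / 3" "e s < \<epsilon> / 3" using d that by (auto simp: d'_def)
      ultimately show ?thesis using Kdiff[of y s] that unfolding dist_norm by linarith
    qed
    ultimately show "\<exists>d>0. \<forall>y s. 0 < y \<longrightarrow> y < d \<longrightarrow> 0 < s \<longrightarrow> s < d \<longrightarrow> dist (K (Complex a y)) (K (Complex a s)) < \<epsilon>"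
      by blast
  qed
  define Kb where "Kb = (\<lambda>c. l + Ig c)"
  \<comment> \<open>An error bound uniform in x, which gives continuity at the points of the real
    line in all directions and not only vertically.\<close>
  define r where "r = (\<lambda>y. e y + norm (K (Complex a y) - l))"
  have r: "(r \<longlongrightarrow> 0) (at_right 0)"
    unfolding r_def using tendsto_add[OF lim[folded e_def] tendsto_norm_zero[OF LIM_zero[OF l]]] by simp
  have Kr: "norm (K (Complex x y) - Kb x) \<le> r y" if "x \<in> {a..b}" "y > 0" for x y
    using Kerr[of a x y] that
      norm_triangle_ineq[of "K (Complex x y) - K (Complex a y) - Ig x" "K (Complex a y) - l"]
    by (simp add: r_def Kb_def Ig_def algebra_simps)
  have inc: "Kb d - Kb c = (LINT x:{c..d}|lborel. g x)" if "a \<le> c" "c \<le> d" "d \<le> b" for c d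
  proof -
    have "g integrable_on {a..d}" using set_borel_integral_eq_integral(1)[OF gsub] that by simp
    then have "integral {a..c} g + integral {c..d} g = integral {a..d} g"
      using that by (intro Henstock_Kurzweil_Integration.integral_combine) auto
    moreover have "(LINT x:{u..v}|lborel. g x) = integral {u..v} g" if "a \<le> u" "v \<le> b" for u v
      using set_borel_integral_eq_integral(2)[OF gsub] that by simp
    ultimately show ?thesis using that by (simp add: Kb_def Ig_def algebra_simps)
  qed
  have contKb: "continuous_on {a..b} Kb"
  proof -
    have "continuous_on {a..b} (\<lambda>x. l + integral {a..x} g)"
      using set_borel_integral_eq_integral(1)[OF g]
      by (intro continuous_intros indefinite_integral_continuous_1)
    moreover have "Kb x = l + integral {a..x} g" if "x \<in> {a..b}" for x
      using set_borel_integral_eq_integral(2)[OF gsub] that by (simp add: Kb_def Ig_def)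
    ultimately show ?thesis by (metis (no_types, lifting) continuous_on_cong)
  qed
  let ?S = "{z. Im z \<ge> 0 \<and> Re z \<in> {a..b}}" and ?H = "\<lambda>z. if Im z > 0 then K z else Kb (Re z)"
  have "continuous_on ?S ?H"
  proof (rule continuous_onI)
    fix z0 \<epsilon> assume z0: "z0 \<in> ?S" and \<epsilon>: "(\<epsilon>::real) > 0"
    show "\<exists>d>0. \<forall>z\<in>?S. dist z z0 < d \<longrightarrow> dist (?H z) (?H z0) \<le> \<epsilon>"
    proof (cases "Im z0 > 0")
      case True
      then have "continuous (at z0) K" using K DERIV_isCont by blast
      then obtain d where d: "d > 0" "\<And>z. dist z z0 < d \<Longrightarrow> dist (K z) (K z0) < \<epsilon>"
        using \<epsilon> unfolding continuous_at_eps_delta by (auto simp: dist_commute)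
      have "Im z > 0" if "dist z z0 < Im z0" for z
        using that abs_Im_le_cmod[of "z0 - z"] by (simp add: dist_norm norm_minus_commute)
      then show ?thesis using d True by (intro exI[of _ "min d (Im z0)"]) (auto intro: less_imp_le)
    next
      case False
      then have [simp]: "Im z0 = 0" using z0 by simp
      obtain d1 where d1: "d1 > 0" "\<And>y. 0 < y \<Longrightarrow> y < d1 \<Longrightarrow> r y < \<epsilon> / 2"
        using order_tendstoD(2)[OF r, of "\<epsilon>/2"] \<epsilon> unfolding eventually_at_right_field by auto
      obtain d2 where d2: "d2 > 0" "\<And>x. x \<in> {a..b} \<Longrightarrow> dist x (Re z0) < d2 \<Longrightarrow> dist (Kb x) (Kb (Re z0)) < \<epsilon> / 2"
        using contKb z0 \<epsilon> unfolding continuous_on_iff by (metis (no_types, lifting) half_gt_zero mem_Collect_eq)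
      have "dist (?H z) (?H z0) \<le> \<epsilon>" if z: "z \<in> ?S" "dist z z0 < min d1 d2" for z
      proof -
        have "dist (Re z) (Re z0) < d2" "\<bar>Im z\<bar> < d1"
          using z(2) abs_Re_le_cmod[of "z - z0"] abs_Im_le_cmod[of "z - z0"] by (auto simp: dist_norm)
        then have 1: "dist (Kb (Re z)) (Kb (Re z0)) < \<epsilon> / 2" and 2: "\<bar>Im z\<bar> < d1"
          using d2 z(1) by auto
        have "dist (?H z) (Kb (Re z)) \<le> \<epsilon> / 2"
          using Kr[of "Re z" "Im z"] d1(2)[of "Im z"] 2 z(1) \<epsilon> by (auto simp: dist_norm)
        then show ?thesis using 1 dist_triangle[of "?H z" "Kb (Re z0)" "Kb (Re z)"] by simp
      qed
      then show ?thesis using d1 d2 by (intro exI[of _ "min d1 d2"]) auto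
    qed
  qed
  then show ?thesis using inc by (rule that)
qed

lemma boundary_limit_of_continuous_extension:
  assumes "continuous_on {z. Im z \<ge> 0 \<and> Re z \<in> {a..b}} (\<lambda>z. if Im z > 0 then K z else Kb (Re z))"
    and "x \<in> {a..b}"
  shows "((\<lambda>y. K (Complex x y)) \<longlongrightarrow> Kb x) (at_right 0)"
proof -
  let ?H = "\<lambda>z. if Im z > 0 then K z else Kb (Re z)"
  have "((\<lambda>y. ?H (Complex x y)) \<longlongrightarrow> ?H (Complex x 0)) (at_right 0)"
    unfolding Complex_eq
    by (rule continuous_on_tendsto_compose[OF assms(1)])
       (use assms(2) in \<open>auto simp: eventually_at_filter intro!: tendsto_eq_intros\<close>)
  then have "((\<lambda>y. ?H (Complex x y)) \<longlongrightarrow> Kb x) (at_right 0)" by simp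
  then show ?thesis
    by (rule Lim_transform_eventually) (auto simp: eventually_at_filter)
qed

text \<open>A Fatou-type theorem: the error of the linear approximation is of size \<open>\<epsilon> \<bar>t\<bar>\<close> on the real line,
  hence of size \<open>2 \<epsilon> \<bar>z\<bar>\<close> inside near the point, and Cauchy's inequality bounds its derivative.\<close>

lemma vertical_limit_of_derivative:
  assumes k: "k holomorphic_on upper_half_plane"
    and K: "\<And>z. Im z > 0 \<Longrightarrow> (K has_field_derivative k z) (at z)"
    and cont: "continuous_on {z. Im z \<ge> 0 \<and> Re z \<in> {a..b}} (\<lambda>z. if Im z > 0 then K z else Kb (Re z))"
    and x0: "a < x0" "x0 < b"
    and D: "(Kb has_vector_derivative D) (at x0)"
  shows "((\<lambda>y. k (Complex x0 y)) \<longlongrightarrow> D) (at_right 0)"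
proof -
  have main: "\<exists>d>0. \<forall>y. 0 < y \<longrightarrow> y < d \<longrightarrow> norm (k (Complex x0 y) - D) \<le> 6 * \<epsilon>" if \<epsilon>: "\<epsilon> > 0" for \<epsilon>
  proof -
    obtain \<delta> where \<delta>: "\<delta> > 0"
      "\<And>x. norm (x - x0) < \<delta> \<Longrightarrow> norm (Kb x - Kb x0 - (x - x0) *\<^sub>R D) \<le> \<epsilon> * norm (x - x0)"
      using D \<epsilon> unfolding has_vector_derivative_def has_derivative_at_alt by blast
    define r where "r = min (\<delta> / 2) (min (x0 - a) (b - x0))"
    have r: "r > 0" "r < \<delta>" "r \<le> x0 - a" "r \<le> b - x0" using \<delta> x0 by (auto simp: r_def)
    let ?H = "\<lambda>z. if Im z > 0 then K z else Kb (Re z)"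
    define G where "G = (\<lambda>z. ?H (z + of_real x0) - Kb x0 - z * D)"
    have derG: "(G has_field_derivative (k (z + of_real x0) - D)) (at z)" if z: "Im z > 0" for z
    proof -
      have "((\<lambda>z. K (z + of_real x0)) has_field_derivative k (z + of_real x0)) (at z)"
        using K[of "z + of_real x0"] z by (simp add: DERIV_shift)
      then have "((\<lambda>z. K (z + of_real x0) - Kb x0 - z * D) has_field_derivative (k (z + of_real x0) - D)) (at z)"
        by (auto intro!: derivative_eq_intros)
      then show ?thesis
        by (rule has_field_derivative_transform_within_open[where S = upper_half_plane])
           (use z in \<open>auto simp: G_def\<close>)
    qed
    have holG: "G holomorphic_on S" if "S \<subseteq> {z. Im z > 0}" for S
      unfolding holomorphic_on_def field_differentiable_def using derG that
      by (blast intro: has_field_derivative_at_within)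
    obtain M where M: "M \<ge> 0" "\<And>z. Im z > 0 \<Longrightarrow> norm z < r \<Longrightarrow> norm (G z) \<le> \<epsilon> * exp (M * norm z) * norm z"
    proof (rule norm_less_local_bound)
      show "G holomorphic_on {z. Im z > 0 \<and> norm z < r}" by (rule holG) auto
      have "continuous_on {z. Im z \<ge> 0 \<and> norm z \<le> r} (\<lambda>z. ?H (z + of_real x0))"
      proof (rule continuous_on_compose2[OF cont])
        show "(\<lambda>z. z + of_real x0) ` {z. 0 \<le> Im z \<and> norm z \<le> r} \<subseteq> {z. 0 \<le> Im z \<and> Re z \<in> {a..b}}"
        proof clarsimp
          fix z :: complex assume "norm z \<le> r"
          then show "a \<le> Re z + x0 \<and> Re z + x0 \<le> b" using abs_Re_le_cmod[of z] r by linarith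
        qed
      qed (intro continuous_intros)
      then show "continuous_on {z. Im z \<ge> 0 \<and> norm z \<le> r} G"
        unfolding G_def by (intro continuous_intros)
      show "norm (G (of_real t)) \<le> \<epsilon> * \<bar>t\<bar>" if "\<bar>t\<bar> \<le> r" for t
        using \<delta>(2)[of "t + x0"] r that by (simp add: G_def scaleR_conv_of_real)
    qed (use r \<epsilon> in auto)
    \<comment> \<open>Points of the disc of radius y / 2 about \<i> y have modulus at most 3 y / 2.
      They lie in the half disc by the first entry, and the second makes the exponential factor at
      most 2. Hence |G| \<le> 3 \<epsilon> y there, and Cauchy's inequality gives 6
      \<epsilon>.\<close>
    define d where "d = min (r / 2) (ln 2 / (2 * (M + 1)))"
    have "d > 0" using r M by (simp add: d_def)
    moreover have "norm (k (Complex x0 y) - D) \<le> 6 * \<epsilon>" if y: "0 < y" "y < d" for y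
    proof -
      let ?z = "\<i> * of_real y"
      have Im: "Im w > 0" "norm w \<le> 3 / 2 * y" if "w \<in> cball ?z (y/2)" for w
        using that abs_Im_le_cmod[of "?z - w"] norm_triangle_sub[of w ?z] y
        by (auto simp: dist_norm norm_minus_commute norm_mult)
      have "norm ((deriv ^^ 1) G ?z) \<le> fact 1 * (3 * \<epsilon> * y) / (y/2) ^ 1"
      proof (rule Cauchy_inequality)
        show "G holomorphic_on ball ?z (y/2)"
          using Im ball_subset_cball by (intro holG) blast
        show "continuous_on (cball ?z (y/2)) G"
          using Im by (intro holomorphic_on_imp_continuous_on holG) blast
        fix w assume "norm (?z - w) = y/2"
        then have w: "Im w > 0" "norm w \<le> 3 / 2 * y" using Im[of w] by (auto simp: dist_norm)
        have yM: "y * (2 * (M + 1)) \<le> ln 2" using y M by (simp add: d_def field_simps)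
        have "M * norm w \<le> M * (3 / 2 * y)" using w M by (intro mult_left_mono)
        also have "\<dots> \<le> y * (2 * (M + 1))"
        proof -
          have "0 \<le> M * y" using M y by simp
          then show ?thesis using y by (simp add: algebra_simps)
        qed
        also have "\<dots> \<le> ln 2" by (fact yM)
        finally have "exp (M * norm w) \<le> 2" using exp_le_cancel_iff[of "M * norm w" "ln 2"] by simp
        then have "\<epsilon> * exp (M * norm w) * norm w \<le> \<epsilon> * 2 * (3 / 2 * y)"
          using \<epsilon> w y by (intro mult_mono) auto
        moreover have "norm w < r" using w(2) y by (auto simp: d_def)
        ultimately show "norm (G w) \<le> 3 * \<epsilon> * y" using M(2)[OF w(1)] by simp
      qed (use y in auto)
      moreover have "deriv G ?z = k (Complex x0 y) - D"
        using DERIV_imp_deriv[OF derG[of ?z]] y by (simp add: Complex_eq add.commute)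
      ultimately show ?thesis using y by simp
    qed
    ultimately show ?thesis by blast
  qed
  show ?thesis
  proof (rule tendstoI)
    fix e :: real assume "e > 0"
    then obtain d where "d > 0" "\<And>y. 0 < y \<Longrightarrow> y < d \<Longrightarrow> norm (k (Complex x0 y) - D) \<le> 6 * (e / 12)"
      using main[of "e / 12"] by auto
    then show "\<forall>\<^sub>F y in at_right 0. dist (k (Complex x0 y)) D < e"
      unfolding eventually_at_right_field dist_norm using \<open>e > 0\<close> by (intro exI[of _ d]) force
  qed
qed

section \<open>Poisson integrals as majorants\<close>

definition poisson_kernel :: "real \<Rightarrow> real \<Rightarrow> real" where
  "poisson_kernel h s = h / (pi * (s\<^sup>2 + h\<^sup>2))"

lemma poisson_kernel_nonneg: "h \<ge> 0 \<Longrightarrow> poisson_kernel h s \<ge> 0"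
  by (simp add: poisson_kernel_def)

lemma continuous_on_poisson_kernel: "h > 0 \<Longrightarrow> continuous_on S (poisson_kernel h)"
  unfolding poisson_kernel_def
  by (intro continuous_intros) (auto simp: add_nonneg_eq_0_iff)

lemma borel_measurable_poisson_kernel [measurable]: "poisson_kernel h \<in> borel_measurable borel"
  unfolding poisson_kernel_def by measurable

lemma poisson_kernel_1: "poisson_kernel 1 s = 1 / (1 + s\<^sup>2) / pi"
  by (simp add: poisson_kernel_def divide_simps add.commute)

lemma shows integrable_poisson_kernel_1: "integrable lborel (poisson_kernel 1)"
  and integral_poisson_kernel_1: "(LINT s|lborel. poisson_kernel 1 s) = 1"
proof -
  have "-\<infinity> < (\<infinity>::ereal)" by simp
  note FTC = interval_integral_FTC_nonneg[OF this, of "\<lambda>s. arctan s / pi" "poisson_kernel 1" "-1/2" "1/2"]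
  have d: "DERIV (\<lambda>s. arctan s / pi) x :> poisson_kernel 1 x" for x
    unfolding poisson_kernel_1 by (rule DERIV_cdivide) (auto intro!: derivative_eq_intros simp: field_simps)
  have c: "isCont (poisson_kernel 1) x" for x
    using continuous_on_poisson_kernel[of 1 UNIV] by (simp add: continuous_on_eq_continuous_at)
  have l: "(((\<lambda>s. arctan s / pi) \<circ> real_of_ereal) \<longlongrightarrow> -1/2) (at_right (-\<infinity>))"
    unfolding ereal_tendsto_simps using tendsto_divide[OF tendsto_arctan_at_bot tendsto_const[of pi]] by simp
  have r: "(((\<lambda>s. arctan s / pi) \<circ> real_of_ereal) \<longlongrightarrow> 1/2) (at_left \<infinity>)"
    unfolding ereal_tendsto_simps using tendsto_divide[OF tendsto_arctan_at_top tendsto_const[of pi]] by simp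
  show "integrable lborel (poisson_kernel 1)"
    using FTC(1)[OF d c _ l r] by (simp add: poisson_kernel_nonneg set_integrable_def)
  show "(LINT s|lborel. poisson_kernel 1 s) = 1"
    using FTC(2)[OF d c _ l r] by (simp add: poisson_kernel_nonneg interval_lebesgue_integral_def set_lebesgue_integral_def)
qed

lemma poisson_kernel_scale: "h > 0 \<Longrightarrow> h * poisson_kernel h (h * s) = poisson_kernel 1 s"
proof -
  assume h: "h > 0"
  have "(h * s)\<^sup>2 + h\<^sup>2 = h\<^sup>2 * (1 + s\<^sup>2)" by (simp add: power2_eq_square algebra_simps)
  then show ?thesis using h by (simp add: poisson_kernel_def power2_eq_square add.commute)
qed

text \<open>In the form on the right the weight does not depend on the height: dominated convergence
  and Fubini apply directly, and at h = 0 the expression still makes sense and equals \<phi> x,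
  since the kernel has mass 1.\<close>

lemma poisson_integral_substitution:
  fixes \<phi> :: "real \<Rightarrow> real"
  assumes "h > 0"
  shows "(LINT t|lborel. poisson_kernel h (t - x) * \<phi> t) = (LINT s|lborel. poisson_kernel 1 s * \<phi> (x + h * s))"
proof -
  have "(LINT t|lborel. poisson_kernel h (t - x) * \<phi> t)
      = h * (LINT s|lborel. poisson_kernel h (h * s) * \<phi> (x + h * s))"
    using lborel_integral_real_affine[of h "\<lambda>t. poisson_kernel h (t - x) * \<phi> t" x] assms by simp
  also have "\<dots> = (LINT s|lborel. (h * poisson_kernel h (h * s)) * \<phi> (x + h * s))"
    by (simp add: mult.assoc)
  finally show ?thesis using poisson_kernel_scale[OF assms] by simp
qed

lemma integrable_poisson_kernel_mult:
  fixes \<phi> :: "real \<Rightarrow> real"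
  assumes [measurable]: "\<phi> \<in> borel_measurable borel" and b: "\<And>t. \<bar>\<phi> t\<bar> \<le> A"
  shows "integrable lborel (\<lambda>s. poisson_kernel 1 s * \<phi> (x + h * s))"
proof (rule Bochner_Integration.integrable_bound)
  show "integrable lborel (\<lambda>s. A * poisson_kernel 1 s)"
    using integrable_poisson_kernel_1 by simp
  show "AE s in lborel. norm (poisson_kernel 1 s * \<phi> (x + h * s)) \<le> norm (A * poisson_kernel 1 s)"
  proof (rule AE_I2)
    fix s
    have "\<bar>\<phi> (x + h * s)\<bar> \<le> \<bar>A\<bar>" using b[of "x + h * s"] by simp
    then show "norm (poisson_kernel 1 s * \<phi> (x + h * s)) \<le> norm (A * poisson_kernel 1 s)"
      using mult_right_mono[of "\<bar>\<phi> (x + h * s)\<bar>" "\<bar>A\<bar>" "\<bar>poisson_kernel 1 s\<bar>"]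
      by (simp add: abs_mult mult.commute)
  qed
qed simp

lemma continuous_on_poisson_integral:
  fixes \<phi> :: "real \<Rightarrow> real"
  assumes c: "continuous_on UNIV \<phi>" and b: "\<And>t. \<bar>\<phi> t\<bar> \<le> A"
  shows "continuous_on S (\<lambda>z. LINT s|lborel. poisson_kernel 1 s * \<phi> (Re z + Im z * s))"
proof (rule continuous_at_imp_continuous_on, rule ballI, rule continuous_at_sequentiallyI)
  fix a and u :: "nat \<Rightarrow> complex" assume u: "u \<longlonglongrightarrow> a"
  have [measurable]: "\<phi> \<in> borel_measurable borel" using c by (rule borel_measurable_continuous_onI)
  show "(\<lambda>n. LINT s|lborel. poisson_kernel 1 s * \<phi> (Re (u n) + Im (u n) * s))
     \<longlonglongrightarrow> (LINT s|lborel. poisson_kernel 1 s * \<phi> (Re a + Im a * s))"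
  proof (rule integral_dominated_convergence)
    show "integrable lborel (\<lambda>s. A * poisson_kernel 1 s)"
      using integrable_poisson_kernel_1 by simp
    show "AE s in lborel. (\<lambda>n. poisson_kernel 1 s * \<phi> (Re (u n) + Im (u n) * s))
            \<longlonglongrightarrow> poisson_kernel 1 s * \<phi> (Re a + Im a * s)"
      using c u by (intro AE_I2 tendsto_intros continuous_on_tendsto_compose[OF c]) auto
    show "AE s in lborel. norm (poisson_kernel 1 s * \<phi> (Re (u n) + Im (u n) * s)) \<le> A * poisson_kernel 1 s" for n
      using mult_left_mono[OF b poisson_kernel_nonneg[of 1]] poisson_kernel_nonneg[of 1]
      by (intro AE_I2) (simp add: abs_mult mult.commute[of A])
  qed auto
qed

text \<open>A substitute for subharmonicity that is easy to verify for \<open>\<bar>f\<bar>\<^sup>1\<^sup>/\<^sup>2\<close> with \<open>f\<close> holomorphic, zeros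
  of \<open>f\<close> included.\<close>

definition harmonic_support :: "(complex \<Rightarrow> real) \<Rightarrow> complex \<Rightarrow> bool" where
  "harmonic_support w z0 \<longleftrightarrow>
     (\<exists>G r. r > 0 \<and> G holomorphic_on ball z0 r \<and> (\<forall>z\<in>ball z0 r. Re (G z) \<le> w z) \<and> Re (G z0) = w z0)"

text \<open>Lets harmonic comparison functions be added or subtracted before the maximum principle
  is applied.\<close>

lemma harmonic_support_add:
  assumes w: "harmonic_support w z0" and z0: "Im z0 > 0" and H: "H holomorphic_on upper_half_plane"
    and eq: "\<And>z. Im z > 0 \<Longrightarrow> w' z = w z + Re (H z)"
  shows "harmonic_support w' z0"
proof -
  obtain G r where G: "r > 0" "G holomorphic_on ball z0 r" "\<And>z. z \<in> ball z0 r \<Longrightarrow> Re (G z) \<le> w z" "Re (G z0) = w z0"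
    using w by (auto simp: harmonic_support_def)
  obtain \<rho> where \<rho>: "\<rho> > 0" "ball z0 \<rho> \<subseteq> upper_half_plane"
    using z0 open_upper_half_plane open_contains_ball by (metis in_upper_half_plane)
  define r' where "r' = min r \<rho>"
  have sub: "ball z0 r' \<subseteq> ball z0 r" "ball z0 r' \<subseteq> upper_half_plane" using \<rho> by (auto simp: r'_def)
  have "(\<lambda>z. G z + H z) holomorphic_on ball z0 r'"
    using G(2) H sub by (intro holomorphic_intros) (auto intro: holomorphic_on_subset)
  moreover have "Re (G z + H z) \<le> w' z" if "z \<in> ball z0 r'" for z
  proof -
    have "z \<in> ball z0 r" "Im z > 0" using sub that by auto
    then show ?thesis using G(3)[of z] eq[of z] by simp
  qed
  moreover have "r' > 0" using G \<rho> by (simp add: r'_def)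
  ultimately show ?thesis unfolding harmonic_support_def using G(4) eq[OF z0]
    by (intro exI[of _ "\<lambda>z. G z + H z"] exI[of _ r']) auto
qed

text \<open>At an interior maximum of W the supporting function Re G touches W from below, so it has
  a maximum there as well and is constant nearby; squeezed between Re G and the maximum, W is
  constant too. The set where a positive maximum is attained is therefore open and closed in the
  half-plane, hence all of it, against the bound far away.\<close>

lemma half_plane_maximum_principle:
  assumes cont: "continuous_on {z. Im z \<ge> 0} W"
    and supp: "\<And>z. Im z > 0 \<Longrightarrow> harmonic_support W z"
    and bdry: "\<And>z. Im z = 0 \<Longrightarrow> W z \<le> 0"
    and far: "\<And>z. Im z \<ge> 0 \<Longrightarrow> norm z \<ge> R \<Longrightarrow> W z \<le> 0"
    and z1: "Im z1 > 0"
  shows "W z1 \<le> 0"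
proof (rule ccontr)
  assume neg: "\<not> W z1 \<le> 0"
  define R' where "R' = max R (norm z1)"
  let ?C = "{z. Im z \<ge> 0} \<inter> cball 0 R'"
  have "compact ?C" by (intro closed_Int_compact closed_halfspace_Im_ge compact_cball)
  moreover have "z1 \<in> ?C" using z1 by (simp add: R'_def)
  moreover have "continuous_on ?C W" using cont by (rule continuous_on_subset) auto
  ultimately obtain z0 where z0: "z0 \<in> ?C" "\<And>z. z \<in> ?C \<Longrightarrow> W z \<le> W z0"
    using continuous_attains_sup[of ?C W] by blast
  have pos: "W z0 > 0" using z0(2)[OF \<open>z1 \<in> ?C\<close>] neg by simp
  have glob: "W z \<le> W z0" if "Im z \<ge> 0" for z
  proof (cases "norm z \<le> R'")
    case True then show ?thesis using z0(2) that by auto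
  next
    case False
    then have "norm z \<ge> R" by (simp add: R'_def not_le)
    then show ?thesis using far[OF that] pos by simp
  qed
  let ?S = "{z\<in>upper_half_plane. W z = W z0}"
  have "z0 \<in> ?S" using z0 bdry[of z0] pos by force
  have "open ?S"
    unfolding open_contains_ball
  proof
    fix z assume z: "z \<in> ?S"
    obtain G r where G: "r > 0" "G holomorphic_on ball z r" "\<And>w. w \<in> ball z r \<Longrightarrow> Re (G w) \<le> W w" "Re (G z) = W z"
      using supp[of z] z by (auto simp: harmonic_support_def)
    obtain \<rho> where \<rho>: "\<rho> > 0" "ball z \<rho> \<subseteq> upper_half_plane"
      using z open_upper_half_plane open_contains_ball by (metis (no_types, lifting) mem_Collect_eq)
    define r' where "r' = min r \<rho>"
    have r': "r' > 0" "ball z r' \<subseteq> ball z r" "ball z r' \<subseteq> upper_half_plane" using G \<rho> by (auto simp: r'_def)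
    have le: "Re (G w) \<le> W w" "W w \<le> W z0" if "w \<in> ball z r'" for w
      using that r' G(3)[of w] glob[of w] in_upper_half_plane[of w] by (auto simp: less_imp_le subset_iff)
    \<comment> \<open>The modulus of exp G is exp (Re G), so a maximum of Re G is one of a
      modulus.\<close>
    have "(\<lambda>w. exp (G w)) constant_on ball z r'"
    proof (rule maximum_modulus_principle[where U = "ball z r'" and \<xi> = z])
      show "(\<lambda>w. exp (G w)) holomorphic_on ball z r'"
        using G(2) r' by (intro holomorphic_intros) (auto intro: holomorphic_on_subset)
      fix w assume "w \<in> ball z r'"
      then show "norm (exp (G w)) \<le> norm (exp (G z))"
        using le[of w] G(4) z by (simp add: norm_exp_eq_Re)
    qed (use r' in auto)
    then obtain c where c: "\<And>w. w \<in> ball z r' \<Longrightarrow> exp (G w) = c" by (auto simp: constant_on_def)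
    have "W w = W z0" if "w \<in> ball z r'" for w
    proof -
      have "norm (exp (G w)) = norm (exp (G z))" using c[OF that] c[of z] r' by simp
      then have "Re (G w) = W z0" using G(4) z by (simp add: norm_exp_eq_Re)
      then show ?thesis using le[OF that] by simp
    qed
    then show "\<exists>e>0. ball z e \<subseteq> ?S" using r' by (intro exI[of _ r']) auto
  qed
  moreover have "closedin (top_of_set upper_half_plane) ?S"
    by (intro continuous_closedin_preimage_constant continuous_on_subset[OF cont]) auto
  moreover have "connected upper_half_plane" by (simp add: convex_connected)
  ultimately have S: "?S = upper_half_plane"
    using \<open>z0 \<in> ?S\<close> connected_clopen[of upper_half_plane] openin_open_eq[of upper_half_plane ?S] by auto
  \<comment> \<open>A point of the half-plane in the far region, where W cannot be positive.\<close>
  define z2 where "z2 = \<i> * of_real (\<bar>R\<bar> + 1)"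
  have "Im z2 > 0" "norm z2 \<ge> R" unfolding z2_def norm_mult by auto
  then have "z2 \<in> ?S" unfolding S by simp
  then have "W z2 = W z0" by blast
  then show False using far[of z2] pos \<open>Im z2 > 0\<close> \<open>norm z2 \<ge> R\<close> by simp
qed

text \<open>The real part of - \<i> / (pi (t - z)) is the Poisson kernel, so \<open>\<Phi>\<close>
  is the integral of \<phi> t against this Cauchy type kernel. Compact support makes it an integral
  over an interval, which may be differentiated under the integral sign.\<close>

lemma poisson_integral_harmonic:
  fixes \<phi> :: "real \<Rightarrow> real"
  assumes c: "continuous_on UNIV \<phi>" and N: "\<And>t. \<bar>t\<bar> \<ge> N \<Longrightarrow> \<phi> t = 0"
  obtains \<Phi> where "\<Phi> holomorphic_on upper_half_plane"
    "\<And>z. Im z > 0 \<Longrightarrow> (LINT s|lborel. poisson_kernel 1 s * \<phi> (Re z + Im z * s)) = Re (\<Phi> z)"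
proof
  let ?K = "\<lambda>z t. of_real (\<phi> t) * (- \<i> / of_real pi) / (of_real t - z)"
  let ?\<Phi> = "\<lambda>z. integral (cbox (-N) N) (?K z)"
  have nz: "of_real t - z \<noteq> 0" if "Im z > 0" for t z using that by (auto simp: complex_eq_iff)
  have contK: "continuous_on (cbox (-N) N) (?K z)" if "Im z > 0" for z
    using nz[OF that] by (intro continuous_intros continuous_on_subset[OF c]) auto
  have quot: "((\<lambda>z. c / (a - z)) has_field_derivative c / (a - z)\<^sup>2) (at z within S)" if "a - z \<noteq> 0"
    for a c z :: complex and S
    using that by (auto intro!: derivative_eq_intros simp: power2_eq_square)
  show "?\<Phi> holomorphic_on upper_half_plane"
  proof (rule leibniz_rule_holomorphic)
    show "((\<lambda>z. ?K z t) has_field_derivative of_real (\<phi> t) * (- \<i> / of_real pi) / (of_real t - z)\<^sup>2) (at z within upper_half_plane)"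
      if "z \<in> upper_half_plane" for z t
      using nz[of z t] that by (intro quot) auto
    show "?K z integrable_on cbox (-N) N" if "z \<in> upper_half_plane" for z
      using contK that by (intro integrable_continuous) auto
    have c': "continuous_on (upper_half_plane \<times> cbox (-N) N) (\<lambda>p. \<phi> (snd p))"
      by (rule continuous_on_compose2[OF c]) (auto intro!: continuous_intros)
    show "continuous_on (upper_half_plane \<times> cbox (-N) N)
        (\<lambda>(z, t). of_real (\<phi> t) * (- \<i> / of_real pi) / (of_real t - z)\<^sup>2)"
      unfolding case_prod_unfold using nz by (intro continuous_intros c') auto
  qed simp
  fix z assume z: "Im z > 0"
  have ReK: "Re (?K z t) = poisson_kernel (Im z) (t - Re z) * \<phi> t" for t
  proof -
    have "?K z t = of_real (\<phi> t / pi) * (- \<i> / (of_real t - z))" by simp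
    also have "Re \<dots> = \<phi> t / pi * Re (- \<i> / (of_real t - z))" by (simp only: times_complex.sel Re_complex_of_real Im_complex_of_real)
    also have "Re (- \<i> / (of_real t - z)) = Im z / ((t - Re z)\<^sup>2 + (Im z)\<^sup>2)"
      by (simp add: Re_divide)
    finally show ?thesis by (simp add: poisson_kernel_def)
  qed
  have out: "\<phi> t = 0" if "t \<notin> {-N..N}" for t using N[of t] that by auto
  have "(LINT s|lborel. poisson_kernel 1 s * \<phi> (Re z + Im z * s))
      = (LINT t|lborel. poisson_kernel (Im z) (t - Re z) * \<phi> t)"
    using z by (simp add: poisson_integral_substitution)
  also have "\<dots> = (LINT t:{-N..N}|lborel. poisson_kernel (Im z) (t - Re z) * \<phi> t)"
    unfolding set_lebesgue_integral_def
    by (rule Bochner_Integration.integral_cong) (use out in \<open>auto simp: indicator_def\<close>)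
  also have "\<dots> = integral {-N..N} (\<lambda>t. Re (?K z t))"
    unfolding ReK[symmetric]
    using set_borel_integral_eq_integral(2)[OF borel_integrable_atLeastAtMost'[OF continuous_on_Re[OF contK[OF z, unfolded box_real]]]]
    by (simp only:)
  also have "\<dots> = Re (?\<Phi> z)"
    using integral_linear[OF integrable_continuous[OF contK[OF z]] bounded_linear_Re] by (simp add: o_def)
  finally show "(LINT s|lborel. poisson_kernel 1 s * \<phi> (Re z + Im z * s)) = Re (?\<Phi> z)" .
qed

text \<open>The half-plane is unbounded and \<open>w\<close> need not decay, so \<delta> ln |z +
  \<i>| is subtracted. This harmonic function is nonnegative on Im z \<ge> 0 and at least A once |z|
  \<ge> exp (A / \<delta>). Thus the positive part \<phi> of the corrected boundary values has
  compact support, and W is at most 0 on the real line and far away. In the end \<delta> tends to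
  0.\<close>

lemma poisson_majorant_nonneg:
  assumes cont: "continuous_on {z. Im z \<ge> 0} w"
    and supp: "\<And>z. Im z > 0 \<Longrightarrow> harmonic_support w z"
    and bd: "\<And>z. Im z \<ge> 0 \<Longrightarrow> 0 \<le> w z \<and> w z \<le> A"
    and h: "h > 0"
  shows "w (Complex x h) \<le> (LINT s|lborel. poisson_kernel 1 s * w (of_real (x + h * s)))"
proof -
  have cw: "continuous_on UNIV (\<lambda>t::real. w (of_real t))"
    by (rule continuous_on_compose2[OF cont]) (auto intro!: continuous_intros)
  have main: "w z \<le> \<delta> * ln (norm (z + \<i>)) + (LINT s|lborel. poisson_kernel 1 s * w (of_real (Re z + Im z * s)))"
    if z: "Im z > 0" and \<delta>: "\<delta> > 0" for z \<delta>
  proof -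
    have nz: "t + \<i> \<noteq> 0" if "Im t \<ge> 0" for t using that by (auto simp: complex_eq_iff)
    define \<phi> where "\<phi> = (\<lambda>t::real. max (w (of_real t) - \<delta> * ln (norm (of_real t + \<i>))) 0)"
    have ln_nonneg: "ln (norm (z + \<i>)) \<ge> 0" if "Im z \<ge> 0" for z
      using that abs_Im_le_cmod[of "z + \<i>"] by (intro ln_ge_zero) simp
    have ln_far: "A \<le> \<delta> * ln (norm (z + \<i>))" if "Im z \<ge> 0" "norm z \<ge> exp (A / \<delta>)" for z
    proof -
      have "norm z \<le> norm (z + \<i>)" using that by (auto simp: cmod_def power_mono)
      then have "exp (A / \<delta>) \<le> norm (z + \<i>)" using that by simp
      then have "A / \<delta> \<le> ln (norm (z + \<i>))" using nz[of z] that by (simp add: ln_ge_iff)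
      then show ?thesis using \<delta> by (simp add: field_simps)
    qed
    have \<phi>c: "continuous_on UNIV \<phi>"
      unfolding \<phi>_def using nz by (intro continuous_intros cw) auto
    have \<phi>_le: "0 \<le> \<phi> t" "\<phi> t \<le> w (of_real t)" for t
      using bd[of "of_real t"] ln_nonneg[of "of_real t"] \<delta> by (auto simp: \<phi>_def)
    have \<phi>b: "\<bar>\<phi> t\<bar> \<le> A" for t using \<phi>_le[of t] bd[of "of_real t"] by simp
    have \<phi>0: "\<phi> t = 0" if "\<bar>t\<bar> \<ge> exp (A / \<delta>)" for t
      using ln_far[of "of_real t"] bd[of "of_real t"] that by (simp add: \<phi>_def)
    obtain \<Phi> where \<Phi>: "\<Phi> holomorphic_on upper_half_plane"
      "\<And>z. Im z > 0 \<Longrightarrow> (LINT s|lborel. poisson_kernel 1 s * \<phi> (Re z + Im z * s)) = Re (\<Phi> z)"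
      using poisson_integral_harmonic[OF \<phi>c \<phi>0] by blast
    define v where "v = (\<lambda>z. LINT s|lborel. poisson_kernel 1 s * \<phi> (Re z + Im z * s))"
    define W where "W = (\<lambda>z. w z - \<delta> * ln (norm (z + \<i>)) - v z)"
    have v0: "v z \<ge> 0" for z
      unfolding v_def using \<phi>_le poisson_kernel_nonneg[of 1] by (intro integral_nonneg_AE AE_I2) auto
    have "W z \<le> 0"
    proof (rule half_plane_maximum_principle)
      show "continuous_on {z. Im z \<ge> 0} W"
        unfolding W_def v_def using nz
        by (intro continuous_intros cont continuous_on_poisson_integral[OF \<phi>c \<phi>b]) auto
      show "harmonic_support W z" if "Im z > 0" for z
      proof (rule harmonic_support_add[OF supp[OF that] that])
        show "(\<lambda>z. - of_real \<delta> * Ln (z + \<i>) - \<Phi> z) holomorphic_on upper_half_plane"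
          by (intro holomorphic_intros \<Phi>(1)) (auto simp: complex_nonpos_Reals_iff)
        show "W z = w z + Re (- of_real \<delta> * Ln (z + \<i>) - \<Phi> z)" if "Im z > 0" for z
          using \<Phi>(2)[OF that] nz[of z] that by (simp add: W_def v_def)
      qed
      show "W z \<le> 0" if "Im z = 0" for z
      proof -
        have z: "of_real (Re z) = z" using that by (simp add: complex_eq_iff)
        have "v z = \<phi> (Re z)" using that integral_poisson_kernel_1 by (simp add: v_def)
        then show ?thesis unfolding W_def \<phi>_def z by simp
      qed
      show "W z \<le> 0" if "Im z \<ge> 0" "norm z \<ge> exp (A / \<delta>)" for z
        using ln_far[OF that] v0[of z] bd[OF that(1)] by (simp add: W_def)
    qed (rule z)
    moreover have "v z \<le> (LINT s|lborel. poisson_kernel 1 s * w (of_real (Re z + Im z * s)))"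
      unfolding v_def
    proof (rule integral_mono)
      show "integrable lborel (\<lambda>s. poisson_kernel 1 s * \<phi> (Re z + Im z * s))"
        by (rule integrable_poisson_kernel_mult[OF _ \<phi>b]) (rule borel_measurable_continuous_onI[OF \<phi>c])
      show "integrable lborel (\<lambda>s. poisson_kernel 1 s * w (of_real (Re z + Im z * s)))"
        using bd by (intro integrable_poisson_kernel_mult[of "\<lambda>t. w (of_real t)" A]
          borel_measurable_continuous_onI[OF cw]) auto
      show "poisson_kernel 1 s * \<phi> (Re z + Im z * s) \<le> poisson_kernel 1 s * w (of_real (Re z + Im z * s))" for s
        using \<phi>_le(2) poisson_kernel_nonneg[of 1] by (intro mult_left_mono) (simp_all del: of_real_add of_real_mult)
    qed
    ultimately show ?thesis by (simp add: W_def)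
  qed
  let ?P = "LINT s|lborel. poisson_kernel 1 s * w (of_real (x + h * s))" and ?l = "ln (norm (Complex x h + \<i>))"
  have "((\<lambda>\<delta>. \<delta> * ?l + ?P) \<longlongrightarrow> 0 * ?l + ?P) (at_right 0)" by (intro tendsto_intros)
  moreover have "\<forall>\<^sub>F \<delta> in at_right 0. w (Complex x h) \<le> \<delta> * ?l + ?P"
    using main[of "Complex x h"] h by (auto simp: eventually_at_filter)
  ultimately show ?thesis
    using tendsto_lowerbound[of "\<lambda>\<delta>. \<delta> * ?l + ?P" "0 * ?l + ?P" "at_right 0" "w (Complex x h)"] by simp
qed

text \<open>Adding A reduces this to the nonnegative case; as the kernel has mass 1, the constant
  cancels again.\<close>

lemma poisson_majorant:
  assumes cont: "continuous_on {z. Im z \<ge> 0} w"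
    and supp: "\<And>z. Im z > 0 \<Longrightarrow> harmonic_support w z"
    and bd: "\<And>z. Im z \<ge> 0 \<Longrightarrow> \<bar>w z\<bar> \<le> A"
    and h: "h > 0"
  shows "w (Complex x h) \<le> (LINT s|lborel. poisson_kernel 1 s * w (of_real (x + h * s)))"
proof -
  have cw: "continuous_on UNIV (\<lambda>t::real. w (of_real t))"
    by (rule continuous_on_compose2[OF cont]) (auto intro!: continuous_intros)
  have "w (Complex x h) + A \<le> (LINT s|lborel. poisson_kernel 1 s * (w (of_real (x + h * s)) + A))"
  proof (rule poisson_majorant_nonneg[where A = "2 * A"])
    show "harmonic_support (\<lambda>z. w z + A) z" if "Im z > 0" for z
      by (rule harmonic_support_add[OF supp[OF that] that, of "\<lambda>_. of_real A"]) auto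
    show "0 \<le> w z + A \<and> w z + A \<le> 2 * A" if "Im z \<ge> 0" for z
      using bd[OF that] by auto
  qed (use cont h in \<open>auto intro!: continuous_intros\<close>)
  also have "\<dots> = (LINT s|lborel. poisson_kernel 1 s * w (of_real (x + h * s))) + A"
  proof -
    have i: "integrable lborel (\<lambda>s. poisson_kernel 1 s * w (of_real (x + h * s)))"
      using bd by (intro integrable_poisson_kernel_mult[of "\<lambda>t. w (of_real t)" A]
        borel_measurable_continuous_onI[OF cw]) auto
    show ?thesis
      using Bochner_Integration.integral_add[OF i, of "\<lambda>s. poisson_kernel 1 s * A"]
        integrable_poisson_kernel_1 integral_poisson_kernel_1 by (simp add: distrib_left)
  qed
  finally show ?thesis by simp
qed

lemma harmonic_support_Re:
  assumes "f holomorphic_on upper_half_plane" "Im z > 0"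
  shows "harmonic_support (\<lambda>z. Re (f z)) z"
  by (rule harmonic_support_add[OF _ assms(2,1), of "\<lambda>_. 0"])
     (auto simp: harmonic_support_def intro!: exI[of _ "\<lambda>_. 0"] exI[of _ 1])

text \<open>At a zero of \<open>f\<close> the constant 0 is a support. Elsewhere \<open>f\<close>
  has a local holomorphic square root g, and rotating g so that its value at z becomes positive
  gives Re (c g) \<le> |g| with equality at z.\<close>

lemma harmonic_support_sqrt_norm:
  assumes f: "f holomorphic_on upper_half_plane" and z: "Im z > 0"
  shows "harmonic_support (\<lambda>z. sqrt (norm (f z))) z"
proof (cases "f z = 0")
  case True
  then show ?thesis
    by (auto simp: harmonic_support_def intro!: exI[of _ "\<lambda>_. 0"] exI[of _ 1])
next
  case False
  have "isCont f z" using f z holomorphic_on_imp_continuous_on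
    by (metis continuous_on_eq_continuous_at in_upper_half_plane open_upper_half_plane)
  then obtain \<rho> where \<rho>: "\<rho> > 0" "\<And>w. dist z w < \<rho> \<Longrightarrow> f w \<noteq> 0"
    using continuous_at_avoid[of z f 0] False by blast
  obtain \<rho>' where \<rho>': "\<rho>' > 0" "ball z \<rho>' \<subseteq> upper_half_plane"
    using z open_upper_half_plane open_contains_ball by (metis in_upper_half_plane)
  define r where "r = min \<rho> \<rho>'"
  have r: "r > 0" "ball z r \<subseteq> upper_half_plane" using \<rho> \<rho>' by (auto simp: r_def)
  obtain g where g: "g holomorphic_on ball z r" "\<And>w. w \<in> ball z r \<Longrightarrow> f w = (g w)\<^sup>2"
  proof -
    obtain l where l: "l holomorphic_on ball z r" "\<And>w. w \<in> ball z r \<Longrightarrow> exp (l w) = f w"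
    proof (rule holomorphic_logarithm_exists[of "ball z r" f z])
      show "f holomorphic_on ball z r" using f r(2) holomorphic_on_subset by blast
      show "\<And>w. w \<in> ball z r \<Longrightarrow> f w \<noteq> 0" using \<rho> by (auto simp: r_def)
    qed (use r in auto)
    show ?thesis
    proof (rule that[of "\<lambda>w. exp (l w / 2)"])
      show "(\<lambda>w. exp (l w / 2)) holomorphic_on ball z r" by (intro holomorphic_intros l) auto
      show "f w = (exp (l w / 2))\<^sup>2" if "w \<in> ball z r" for w
        using l(2)[OF that] by (simp flip: exp_of_nat_mult exp_double)
    qed
  qed
  have ng: "norm (g w) = sqrt (norm (f w))" if "w \<in> ball z r" for w
    using g(2)[OF that] by (simp add: norm_power)
  define c where "c = cnj (g z) / of_real (norm (g z))"
  have gz: "g z \<noteq> 0" using g(2)[of z] False r by auto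
  have nc: "norm c = 1" using gz by (simp add: c_def norm_divide)
  have "c * g z = of_real (norm (g z))"
    using gz by (simp add: c_def mult.commute[of "cnj (g z)"] complex_norm_square[symmetric] power2_eq_square)
  then have "Re (c * g z) = sqrt (norm (f z))" using ng[of z] r by simp
  moreover have "Re (c * g w) \<le> sqrt (norm (f w))" if "w \<in> ball z r" for w
    using ng[OF that] complex_Re_le_cmod[of "c * g w"] nc by (simp add: norm_mult)
  moreover have "(\<lambda>w. c * g w) holomorphic_on ball z r" by (intro holomorphic_intros g)
  ultimately show ?thesis unfolding harmonic_support_def using r(1) by blast
qed

section \<open>Boundary convergence in \<open>L\<^sup>1\<close>\<close>

text \<open>Both defects on the right, the one of the phase and the one of the modulus, become
  differences of \<open>L\<^sup>1\<close> norms after integration against the Poisson kernel.\<close>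

lemma norm_diff_le_defects:
  fixes a b c :: complex
  assumes c: "c * b = of_real (norm b)" "norm c = 1" and l: "l > 0"
  shows "norm (a - b) \<le> 2 * l * (norm a + norm b)
    + (1 / (2 * l)) * ((norm a - Re (c * a)) + (sqrt (norm a) - sqrt (norm b))\<^sup>2)"
proof -
  \<comment> \<open>The weight l stays free: a small multiple of the sizes is traded for a large
    multiple of the defects.\<close>
  have amgm: "x \<le> l * p + 1 / (2 * l) * q" if "x\<^sup>2 \<le> 2 * p * q" "p \<ge> 0" "q \<ge> 0" for x p q :: real
  proof (rule power2_le_imp_le)
    have "(l * p + 1 / (2 * l) * q)\<^sup>2 = (l * p - 1 / (2 * l) * q)\<^sup>2 + 2 * p * q"
      using l by (simp add: power2_eq_square field_simps)
    then show "x\<^sup>2 \<le> (l * p + 1 / (2 * l) * q)\<^sup>2" using that(1) zero_le_power2[of "l * p - 1 / (2 * l) * q"] by linarith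
  qed (use l that in auto)
  have Re_le: "Re (c * a) \<le> norm a" using complex_Re_le_cmod[of "c * a"] c by (simp add: norm_mult)
  have "norm (a - b) = norm (c * (a - b))" using c by (simp add: norm_mult)
  also have "\<dots> = norm ((c * a - of_real (norm a)) + of_real (norm a - norm b))"
    by (simp add: right_diff_distrib c(1))
  also have "\<dots> \<le> norm (c * a - of_real (norm a)) + \<bar>norm a - norm b\<bar>"
    by (rule order_trans[OF norm_triangle_ineq]) (simp only: norm_of_real)
  finally have 1: "norm (a - b) \<le> norm (c * a - of_real (norm a)) + \<bar>norm a - norm b\<bar>" .
  \<comment> \<open>Since |c a| = |a|, expanding expresses the phase error through |a| - Re (c a),
    which is linear in a apart from the norm and so averages well.\<close>
  have "(norm (c * a - of_real (norm a)))\<^sup>2 = (Re (c * a) - norm a)\<^sup>2 + (Im (c * a))\<^sup>2"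
    by (simp only: cmod_power2 minus_complex.sel Re_complex_of_real Im_complex_of_real diff_0_right)
  also have "\<dots> = (norm (c * a))\<^sup>2 - 2 * norm a * Re (c * a) + (norm a)\<^sup>2"
    unfolding cmod_power2[of "c * a"] by (simp only: power2_diff ac_simps)
  also have "\<dots> = 2 * norm a * (norm a - Re (c * a))"
    using c by (simp add: norm_mult power2_eq_square algebra_simps)
  finally have 2: "norm (c * a - of_real (norm a)) \<le> l * norm a + 1 / (2 * l) * (norm a - Re (c * a))"
    using Re_le by (intro amgm) auto
  define p q where "p = sqrt (norm a)" and "q = sqrt (norm b)"
  have pq: "norm a = p\<^sup>2" "norm b = q\<^sup>2" by (auto simp: p_def q_def)
  \<comment> \<open>The factorisation of p^2 - q^2 reduces the modulus error to the difference of
    the square roots.\<close>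
  have "\<bar>norm a - norm b\<bar>\<^sup>2 = (p + q)\<^sup>2 * (p - q)\<^sup>2"
    unfolding pq by (simp add: power2_eq_square algebra_simps)
  also have "\<dots> \<le> (2 * (p\<^sup>2 + q\<^sup>2)) * (p - q)\<^sup>2"
    using sum_squares_bound[of p q] by (intro mult_right_mono) (auto simp: power2_eq_square algebra_simps)
  finally have 3: "\<bar>norm a - norm b\<bar> \<le> l * (norm a + norm b) + 1 / (2 * l) * (p - q)\<^sup>2"
    by (intro amgm) (auto simp: pq)
  have "norm (a - b) \<le> l * (norm a + (norm a + norm b)) + 1 / (2 * l) * ((norm a - Re (c * a)) + (p - q)\<^sup>2)"
    using 1 2 3 by (simp add: distrib_left)
  also have "\<dots> \<le> l * (2 * (norm a + norm b)) + 1 / (2 * l) * ((norm a - Re (c * a)) + (p - q)\<^sup>2)"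
    using l by (intro add_right_mono mult_left_mono) auto
  finally show ?thesis by (simp add: p_def q_def mult_ac)
qed

text \<open>By translation invariance the integral over x is the same for each s, and the kernel has
  mass 1. Applied to |f| on a line, this turns integrated Poisson averages into \<open>L^1\<close>
  norms.\<close>

lemma
  fixes \<phi> :: "real \<Rightarrow> real"
  assumes int: "integrable lborel \<phi>"
  shows integrable_poisson_integral: "integrable lborel (\<lambda>x. LINT s|lborel. poisson_kernel 1 s * \<phi> (x + h * s))"
    and integral_poisson_integral: "(LINT x|lborel. LINT s|lborel. poisson_kernel 1 s * \<phi> (x + h * s)) = (LINT x|lborel. \<phi> x)"
proof -
  have [measurable]: "\<phi> \<in> borel_measurable borel" using int by auto
  have sh: "integrable lborel (\<lambda>x. \<phi> (x + h * s))" for s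
    using lborel_integrable_real_affine_iff[of 1 \<phi> "h * s"] int by (simp add: add.commute)
  have shi: "(LINT x|lborel. f (x + h * s)) = (LINT x|lborel. f x)" for s and f :: "real \<Rightarrow> real"
    using lborel_integral_real_affine[of 1 f "h * s"] by (simp add: add.commute)
  have I: "integrable (lborel \<Otimes>\<^sub>M lborel) (case_prod (\<lambda>s x. poisson_kernel 1 s * \<phi> (x + h * s)))"
  proof (rule lborel_pair.Fubini_integrable)
    show "integrable lborel (\<lambda>s. LINT x|lborel. norm (case (s, x) of (s, x) \<Rightarrow> poisson_kernel 1 s * \<phi> (x + h * s)))"
      using integrable_poisson_kernel_1 shi[of "\<lambda>x. \<bar>\<phi> x\<bar>"]
      by (simp add: abs_mult poisson_kernel_nonneg)
    show "AE s in lborel. integrable lborel (\<lambda>x. case (s, x) of (s, x) \<Rightarrow> poisson_kernel 1 s * \<phi> (x + h * s))"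
      using sh by simp
  qed measurable
  show "integrable lborel (\<lambda>x. LINT s|lborel. poisson_kernel 1 s * \<phi> (x + h * s))"
    using lborel_pair.integrable_snd[OF I] .
  have "(LINT x|lborel. LINT s|lborel. poisson_kernel 1 s * \<phi> (x + h * s))
      = (LINT s|lborel. LINT x|lborel. poisson_kernel 1 s * \<phi> (x + h * s))"
    by (rule lborel_pair.Fubini_integral[OF I])
  also have "\<dots> = (LINT x|lborel. \<phi> x)"
    using integral_poisson_kernel_1 shi[of \<phi>] by simp
  finally show "(LINT x|lborel. LINT s|lborel. poisson_kernel 1 s * \<phi> (x + h * s)) = (LINT x|lborel. \<phi> x)" .
qed

lemma integrable_poisson_kernel_mult':
  fixes \<phi> :: "real \<Rightarrow> real"
  assumes "\<phi> \<in> borel_measurable borel" "\<And>t. \<bar>\<phi> t\<bar> \<le> A" and h: "h > 0"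
  shows "integrable lborel (\<lambda>t. poisson_kernel h (t - x) * \<phi> t)"
proof -
  have "poisson_kernel h (h * s) * \<phi> (x + h * s) = (1 / h) * (poisson_kernel 1 s * \<phi> (x + h * s))" for s
    using poisson_kernel_scale[OF h, of s] h by (simp add: field_simps)
  then have "integrable lborel (\<lambda>s. poisson_kernel h (h * s) * \<phi> (x + h * s))"
    using integrable_poisson_kernel_mult[OF assms(1,2), of x h] by simp
  then show ?thesis
    using lborel_integrable_real_affine_iff[of h "\<lambda>t. poisson_kernel h (t - x) * \<phi> t" x] h by simp
qed

text \<open>Numerators and denominators are compared separately. The estimate allows averages from
  two different lower lines, with kernels of heights y - e and y - d, to be compared with one
  average of height y.\<close>

lemma poisson_kernel_le:
  assumes "y / 2 \<le> h" "h \<le> y" "y > 0"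
  shows "poisson_kernel y u \<le> 2 * poisson_kernel h u"
proof -
  have h: "h > 0" using assms by linarith
  have "y / (pi * (u\<^sup>2 + y\<^sup>2)) \<le> 2 * h / (pi * (u\<^sup>2 + h\<^sup>2))"
    using assms h by (intro frac_le mult_left_mono add_left_mono power_mono mult_pos_pos add_nonneg_pos) auto
  then show ?thesis by (simp add: poisson_kernel_def)
qed

section \<open>Oscillation of an \<open>H^1\<close> function between horizontal lines\<close>

locale hardy_one =
  fixes f :: "complex \<Rightarrow> complex" and B :: real
  assumes hol: "f holomorphic_on upper_half_plane"
    and int: "\<And>y. y > 0 \<Longrightarrow> integrable lborel (\<lambda>x. f (Complex x y))"
    and bound: "\<And>y. y > 0 \<Longrightarrow> (LINT x|lborel. norm (f (Complex x y))) \<le> B"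
begin

definition M1 :: "real \<Rightarrow> real" where "M1 y = (LINT x|lborel. norm (f (Complex x y)))"

lemma B_nonneg: "0 \<le> B"
  using order_trans[OF integral_nonneg_AE bound[of 1]] by simp

text \<open>Increments of a primitive along a horizontal segment are at most the \<open>L^1\<close>
  norm of the slice, hence at most B.\<close>

lemma norm_le:
  assumes "Im z \<ge> \<epsilon>" "\<epsilon> > 0"
  shows "norm (f z) \<le> B + 2 * B / \<epsilon>"
proof -
  obtain F where F: "\<And>z. Im z > 0 \<Longrightarrow> (F has_field_derivative f z) (at z)"
    using upper_half_plane_primitive[OF hol] by blast
  have "norm (f z) \<le> B + 2 * B / Im z"
  proof (rule upper_half_plane_bound_by_increments[OF hol F])
    fix z s assume z: "Im z > 0" and s: "0 \<le> (s::real)" "s \<le> 1"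
    have "norm (F (Complex (Re z + s) (Im z)) - F (Complex (Re z) (Im z)))
        \<le> (LINT x:{Re z..Re z + s}|lborel. norm (f (Complex x (Im z))))"
      using s z by (intro norm_horizontal_increment_le[OF hol F]) auto
    also have "\<dots> \<le> (LINT x|lborel. norm (f (Complex x (Im z))))"
      unfolding set_lebesgue_integral_def using int[OF z]
      by (intro integral_mono integrable_mult_indicator) (auto simp: indicator_def)
    also have "\<dots> \<le> B" by (rule bound[OF z])
    also have "Complex (Re z + s) (Im z) = z + of_real s" by (simp add: complex_eq_iff)
    finally show "norm (F (z + of_real s) - F z) \<le> B" by simp
  qed (use assms in auto)
  also have "\<dots> \<le> B + 2 * B / \<epsilon>"
    using assms B_nonneg by (intro add_left_mono divide_left_mono) auto
  finally show ?thesis .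
qed

lemma horizontal_measurable:
  "y > 0 \<Longrightarrow> (\<lambda>x. f (Complex x y)) \<in> borel_measurable borel"
  by (rule borel_measurable_continuous_onI[OF continuous_on_horizontal[OF hol]])

text \<open>The function is shifted so that the line at height e becomes the real axis. It is then
  holomorphic beyond the axis, which gives continuity, and \<open>norm_le\<close> gives
  boundedness.\<close>

lemma poisson_bounds:
  assumes e: "e > 0" and h: "h > 0"
  shows "sqrt (norm (f (Complex x (e + h)))) \<le>
      (LINT s|lborel. poisson_kernel 1 s * sqrt (norm (f (Complex (x + h * s) e))))"
    and "Re (c * f (Complex x (e + h))) \<le>
      (LINT s|lborel. poisson_kernel 1 s * Re (c * f (Complex (x + h * s) e)))"
proof -
  let ?f = "\<lambda>z. f (z + \<i> * of_real e)"
  have eq: "?f (Complex x h) = f (Complex x (e + h))" "?f (of_real t) = f (Complex t e)" for t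
    by (simp_all add: Complex_eq algebra_simps)
  have holf: "?f holomorphic_on {z. Im z > - e}"
    by (rule holomorphic_on_compose_gen[unfolded o_def, OF _ hol]) (auto intro!: holomorphic_intros)
  then have hol': "?f holomorphic_on upper_half_plane"
    using e by (elim holomorphic_on_subset) auto
  have cont: "continuous_on {z. Im z \<ge> 0} ?f"
    using e by (intro continuous_on_subset[OF holomorphic_on_imp_continuous_on[OF holf]]) auto
  have bd: "norm (?f z) \<le> B + 2 * B / e" if "Im z \<ge> 0" for z
    using that e by (intro norm_le) auto
  show "sqrt (norm (f (Complex x (e + h)))) \<le>
      (LINT s|lborel. poisson_kernel 1 s * sqrt (norm (f (Complex (x + h * s) e))))"
    unfolding eq[symmetric]
    by (rule poisson_majorant[OF _ harmonic_support_sqrt_norm[OF hol'], where A = "sqrt (B + 2 * B / e)"])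
       (use cont bd h in \<open>auto intro!: continuous_intros\<close>)
  have "\<bar>Re (c * ?f z)\<bar> \<le> norm c * (B + 2 * B / e)" if "Im z \<ge> 0" for z
    using abs_Re_le_cmod[of "c * ?f z"] mult_left_mono[OF bd[OF that], of "norm c"] by (simp add: norm_mult)
  moreover have "(\<lambda>z. c * ?f z) holomorphic_on upper_half_plane" by (intro holomorphic_intros hol')
  ultimately show "Re (c * f (Complex x (e + h))) \<le>
      (LINT s|lborel. poisson_kernel 1 s * Re (c * f (Complex (x + h * s) e)))"
    unfolding eq[symmetric] using cont h
    by (intro poisson_majorant[OF _ harmonic_support_Re, where A = "norm c * (B + 2 * B / e)"])
       (auto intro!: continuous_intros)
qed

definition P1 :: "real \<Rightarrow> real \<Rightarrow> real \<Rightarrow> real" where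
  "P1 e h x = (LINT s|lborel. poisson_kernel 1 s * norm (f (Complex (x + h * s) e)))"

lemma integrable_P1: "e > 0 \<Longrightarrow> integrable lborel (P1 e h)"
  and integral_P1: "e > 0 \<Longrightarrow> (LINT x|lborel. P1 e h x) = M1 e"
  unfolding P1_def M1_def
  using integrable_poisson_integral[of "\<lambda>x. norm (f (Complex x e))" h]
    integral_poisson_integral[of "\<lambda>x. norm (f (Complex x e))" h] int[of e] by auto

lemma integrable_poisson_comp:
  assumes e: "e > 0" and g: "continuous_on UNIV g"
    and b: "\<And>z. Im z \<ge> e \<Longrightarrow> \<bar>g (f z)\<bar> \<le> A"
  shows "integrable lborel (\<lambda>s. poisson_kernel 1 s * g (f (Complex (x + h * s) e)))"
proof (rule integrable_poisson_kernel_mult[of "\<lambda>t. g (f (Complex t e))" A])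
  have [measurable]: "g \<in> borel_measurable borel" using g by (rule borel_measurable_continuous_onI)
  note [measurable] = horizontal_measurable[OF e]
  show "(\<lambda>t. g (f (Complex t e))) \<in> borel_measurable borel" by measurable
qed (use b in auto)

text \<open>Let b be the upper value and a the values on the lower line. The average of |a| - Re (c
  a) is at most P1 - |b| by the majorant for Re (c f). Expanding (sqrt |a| - sqrt |b|)^2 and using
  the majorant for sqrt |f| in the mixed term gives the same bound for the modulus defect. Each
  enters with weight 1 / (2 l), which adds up to 1 / l. Nonnegativity of the second average also
  proves |b| \<le> P1.\<close>

lemma poisson_oscillation:
  assumes e: "e > 0" and h: "h > 0" and l: "l > 0"
  shows "norm (f (Complex x (e + h))) \<le> P1 e h x"
    and "(LINT s|lborel. poisson_kernel 1 s * norm (f (Complex (x + h * s) e) - f (Complex x (e + h))))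
      \<le> 2 * l * (P1 e h x + norm (f (Complex x (e + h)))) + (1 / l) * (P1 e h x - norm (f (Complex x (e + h))))"
proof -
  define b where "b = f (Complex x (e + h))"
  define a where "a = (\<lambda>s. f (Complex (x + h * s) e))"
  \<comment> \<open>The conjugate phase of b; when b = 0 any number of modulus 1 would do.\<close>
  define c where "c = (if b = 0 then 1 else cnj b / of_real (norm b))"
  have c: "c * b = of_real (norm b)" "norm c = 1"
    by (auto simp: c_def norm_divide mult.commute[of "cnj b"] complex_norm_square[symmetric] power2_eq_square)
  let ?A = "B + 2 * B / e"
  let ?k = "poisson_kernel 1"
  have bd: "norm (f z) \<le> ?A" if "Im z \<ge> e" for z using norm_le[OF that e] .
  have i1: "integrable lborel (\<lambda>s. ?k s * norm (a s))"
    unfolding a_def using bd by (intro integrable_poisson_comp[where A = ?A] e continuous_intros) auto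
  have i2: "integrable lborel (\<lambda>s. ?k s * sqrt (norm (a s)))"
    unfolding a_def using bd
    by (intro integrable_poisson_comp[where A = "sqrt ?A"] e continuous_intros) auto
  have i3: "integrable lborel (\<lambda>s. ?k s * Re (c * a s))"
    unfolding a_def
  proof (intro integrable_poisson_comp[where A = ?A] e continuous_intros)
    show "\<bar>Re (c * f z)\<bar> \<le> ?A" if "Im z \<ge> e" for z
      using abs_Re_le_cmod[of "c * f z"] bd[OF that] c by (simp add: norm_mult)
  qed
  have i4: "integrable lborel (\<lambda>s. ?k s * norm (a s - b))"
    unfolding a_def
  proof (intro integrable_poisson_comp[where A = "?A + norm b"] e continuous_intros)
    show "\<bar>norm (f z - b)\<bar> \<le> ?A + norm b" if "Im z \<ge> e" for z
      using norm_triangle_ineq4[of "f z" b] bd[OF that] by simp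
  qed
  note i0 = integrable_poisson_kernel_1
  have q: "sqrt (norm b) \<le> (LINT s|lborel. ?k s * sqrt (norm (a s)))"
    unfolding a_def b_def by (rule poisson_bounds(1)[OF e h])
  have r: "norm b \<le> (LINT s|lborel. ?k s * Re (c * a s))"
    using poisson_bounds(2)[OF e h, of c x, folded b_def] unfolding c(1) a_def by (simp only: Re_complex_of_real)
  have P: "P1 e h x = (LINT s|lborel. ?k s * norm (a s))" by (simp add: P1_def a_def)
  have sq: "?k s * (sqrt (norm (a s)) - sqrt (norm b))\<^sup>2
      = ?k s * norm (a s) - 2 * sqrt (norm b) * (?k s * sqrt (norm (a s))) + norm b * ?k s" for s
    by (simp add: power2_diff algebra_simps)
  have i5: "integrable lborel (\<lambda>s. ?k s * (sqrt (norm (a s)) - sqrt (norm b))\<^sup>2)"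
    unfolding sq using i0 i1 i2 by simp
  have "(LINT s|lborel. ?k s * (sqrt (norm (a s)) - sqrt (norm b))\<^sup>2)
      = P1 e h x - 2 * sqrt (norm b) * (LINT s|lborel. ?k s * sqrt (norm (a s))) + norm b"
    unfolding sq P using i0 i1 i2 integral_poisson_kernel_1 by simp
  also have "\<dots> \<le> P1 e h x - 2 * sqrt (norm b) * sqrt (norm b) + norm b"
    using q by (intro add_right_mono diff_left_mono mult_left_mono) auto
  finally have sqi: "(LINT s|lborel. ?k s * (sqrt (norm (a s)) - sqrt (norm b))\<^sup>2) \<le> P1 e h x - norm b"
    by (simp add: mult.assoc)
  have "0 \<le> (LINT s|lborel. ?k s * (sqrt (norm (a s)) - sqrt (norm b))\<^sup>2)"
    by (intro integral_nonneg_AE AE_I2) (simp add: poisson_kernel_nonneg)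
  then show "norm (f (Complex x (e + h))) \<le> P1 e h x" using sqi by (simp add: b_def)
  let ?R = "\<lambda>s. 2 * l * (?k s * norm (a s)) + 2 * l * norm b * ?k s
      + (1 / (2 * l)) * (?k s * norm (a s) - ?k s * Re (c * a s))
      + (1 / (2 * l)) * (?k s * (sqrt (norm (a s)) - sqrt (norm b))\<^sup>2)"
  have "(LINT s|lborel. ?k s * norm (a s - b)) \<le> (LINT s|lborel. ?R s)"
  proof (rule integral_mono[OF i4])
    show "integrable lborel ?R" using i0 i1 i3 i5 by simp
    fix s
    have "?k s * norm (a s - b) \<le> ?k s * (2 * l * (norm (a s) + norm b)
      + (1 / (2 * l)) * ((norm (a s) - Re (c * a s)) + (sqrt (norm (a s)) - sqrt (norm b))\<^sup>2))"
      by (intro mult_left_mono norm_diff_le_defects c l poisson_kernel_nonneg) simp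
    also have "\<dots> = ?R s" by (simp only: algebra_simps)
    finally show "?k s * norm (a s - b) \<le> ?R s" .
  qed
  also have "\<dots> = 2 * l * P1 e h x + 2 * l * norm b
      + (1 / (2 * l)) * (P1 e h x - (LINT s|lborel. ?k s * Re (c * a s)))
      + (1 / (2 * l)) * (LINT s|lborel. ?k s * (sqrt (norm (a s)) - sqrt (norm b))\<^sup>2)"
    using i0 i1 i3 i5 integral_poisson_kernel_1 by (simp add: P)
  also have "\<dots> \<le> 2 * l * P1 e h x + 2 * l * norm b
      + (1 / (2 * l)) * (P1 e h x - norm b) + (1 / (2 * l)) * (P1 e h x - norm b)"
    using l r sqi by (intro add_mono mult_left_mono) auto
  also have "\<dots> = 2 * l * (P1 e h x + norm b) + (1 / l) * (P1 e h x - norm b)"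
    using l by (simp add: field_simps)
  finally show "(LINT s|lborel. poisson_kernel 1 s * norm (f (Complex (x + h * s) e) - f (Complex x (e + h))))
      \<le> 2 * l * (P1 e h x + norm (f (Complex x (e + h)))) + (1 / l) * (P1 e h x - norm (f (Complex x (e + h))))"
    by (simp add: a_def b_def)
qed

text \<open>The Poisson average of height y of |f(t + \<i> e) - f(t + \<i> d)| about x is split at
  the common value f(x + \<i> y). Replacing the kernel by those of heights y - e and y - d costs a
  factor 2 and leaves two oscillations. Integrating over x, the averages on the left become the
  \<open>L^1\<close> distance, and P1 on the right becomes M1.\<close>

lemma L1_dist_le:
  assumes y: "0 < y" and e: "0 < e" "e < y / 2" and d: "0 < d" "d < y / 2" and l: "l > 0"
  shows "(LINT x|lborel. norm (f (Complex x e) - f (Complex x d)))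
    \<le> 16 * l * B + 2 / l * (M1 e - M1 y) + 2 / l * (M1 d - M1 y)"
proof -
  define R where "R = (\<lambda>e x. 2 * l * (P1 e (y - e) x + norm (f (Complex x y))) + (1 / l) * (P1 e (y - e) x - norm (f (Complex x y))))"
  have iR: "integrable lborel (R e)" if "e > 0" for e
    unfolding R_def using integrable_P1[OF that] int[OF y] by simp
  have intR: "(LINT x|lborel. R e x) \<le> 4 * l * B + 1 / l * (M1 e - M1 y)" if "e > 0" for e
  proof -
    have "(LINT x|lborel. R e x) = 2 * l * (M1 e + M1 y) + (1 / l) * (M1 e - M1 y)"
      unfolding R_def using integrable_P1[OF that] int[OF y] integral_P1[OF that] by (simp add: M1_def)
    moreover have "2 * l * (M1 e + M1 y) \<le> 2 * l * (B + B)"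
      using bound[OF that] bound[OF y] l by (intro mult_left_mono add_mono) (auto simp: M1_def)
    ultimately show ?thesis by simp
  qed
  let ?\<phi> = "\<lambda>x. norm (f (Complex x e) - f (Complex x d))"
  note [measurable] = horizontal_measurable[OF e(1)] horizontal_measurable[OF d(1)]
  have i\<phi>: "integrable lborel ?\<phi>" using int[OF e(1)] int[OF d(1)] by simp
  have step: "(LINT s|lborel. poisson_kernel 1 s * ?\<phi> (x + y * s)) \<le> 2 * R e x + 2 * R d x" for x
  proof -
    let ?b = "f (Complex x y)"
    have one: "integrable lborel (\<lambda>t. poisson_kernel h (t - x) * norm (f (Complex t u) - ?b))" if "u > 0" "h > 0" for u h
    proof (rule integrable_poisson_kernel_mult'[where A = "B + 2 * B / u + norm ?b", OF _ _ that(2)])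
      show "(\<lambda>t. norm (f (Complex t u) - ?b)) \<in> borel_measurable borel"
        using horizontal_measurable[OF that(1)] by measurable
      show "\<bar>norm (f (Complex t u) - ?b)\<bar> \<le> B + 2 * B / u + norm ?b" for t
        using norm_triangle_ineq4[of "f (Complex t u)" ?b] norm_le[of u "Complex t u"] that by simp
    qed
    have two: "2 * (LINT t|lborel. poisson_kernel (y - u) (t - x) * norm (f (Complex t u) - ?b)) \<le> 2 * R u x"
      if "0 < u" "u < y" for u
    proof (rule mult_left_mono)
      show "(LINT t|lborel. poisson_kernel (y - u) (t - x) * norm (f (Complex t u) - ?b)) \<le> R u x"
        using poisson_oscillation(2)[of u "y - u" l x] that l
        by (subst poisson_integral_substitution) (auto simp: R_def)
    qed simp
    have "(LINT s|lborel. poisson_kernel 1 s * ?\<phi> (x + y * s)) = (LINT t|lborel. poisson_kernel y (t - x) * ?\<phi> t)"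
      using poisson_integral_substitution[OF y, of x ?\<phi>] by simp
    also have "\<dots> \<le> (LINT t|lborel. 2 * (poisson_kernel (y - e) (t - x) * norm (f (Complex t e) - ?b))
        + 2 * (poisson_kernel (y - d) (t - x) * norm (f (Complex t d) - ?b)))"
    proof (rule integral_mono)
      show "integrable lborel (\<lambda>t. poisson_kernel y (t - x) * ?\<phi> t)"
      proof (rule integrable_poisson_kernel_mult'[where A = "(B + 2 * B / e) + (B + 2 * B / d)", OF _ _ y])
        show "\<bar>?\<phi> t\<bar> \<le> (B + 2 * B / e) + (B + 2 * B / d)" for t
          using norm_triangle_ineq4[of "f (Complex t e)" "f (Complex t d)"]
            norm_le[of e "Complex t e"] norm_le[of d "Complex t d"] e d by simp
      qed measurable
      show "integrable lborel (\<lambda>t. 2 * (poisson_kernel (y - e) (t - x) * norm (f (Complex t e) - ?b))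
        + 2 * (poisson_kernel (y - d) (t - x) * norm (f (Complex t d) - ?b)))"
        using one[of e "y - e"] one[of d "y - d"] e d y by simp
      fix t
      let ?u = "t - x"
      have "poisson_kernel y ?u * ?\<phi> t \<le> poisson_kernel y ?u * (norm (f (Complex t e) - ?b) + norm (f (Complex t d) - ?b))"
        using y norm_triangle_ineq4[of "f (Complex t e) - ?b" "f (Complex t d) - ?b"]
        by (intro mult_left_mono poisson_kernel_nonneg) auto
      also have "\<dots> = poisson_kernel y ?u * norm (f (Complex t e) - ?b) + poisson_kernel y ?u * norm (f (Complex t d) - ?b)"
        by (rule distrib_left)
      also have "\<dots> \<le> (2 * poisson_kernel (y - e) ?u) * norm (f (Complex t e) - ?b)
          + (2 * poisson_kernel (y - d) ?u) * norm (f (Complex t d) - ?b)"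
        using e d y by (intro add_mono mult_right_mono poisson_kernel_le) auto
      finally show "poisson_kernel y ?u * ?\<phi> t \<le> 2 * (poisson_kernel (y - e) ?u * norm (f (Complex t e) - ?b))
        + 2 * (poisson_kernel (y - d) ?u * norm (f (Complex t d) - ?b))" by (simp add: mult.assoc)
    qed
    also have "\<dots> = 2 * (LINT t|lborel. poisson_kernel (y - e) (t - x) * norm (f (Complex t e) - ?b))
        + 2 * (LINT t|lborel. poisson_kernel (y - d) (t - x) * norm (f (Complex t d) - ?b))"
      using one[of e "y - e"] one[of d "y - d"] e d y by simp
    also have "\<dots> \<le> 2 * R e x + 2 * R d x" using e d y by (intro add_mono two) auto
    finally show ?thesis .
  qed
  have "(LINT x|lborel. ?\<phi> x) = (LINT x|lborel. LINT s|lborel. poisson_kernel 1 s * ?\<phi> (x + y * s))"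
    by (rule integral_poisson_integral[OF i\<phi>, symmetric])
  also have "\<dots> \<le> (LINT x|lborel. 2 * R e x + 2 * R d x)"
    using step iR[OF e(1)] iR[OF d(1)] by (intro integral_mono integrable_poisson_integral[OF i\<phi>]) auto
  also have "\<dots> = 2 * (LINT x|lborel. R e x) + 2 * (LINT x|lborel. R d x)"
    using iR[OF e(1)] iR[OF d(1)] by simp
  also have "\<dots> \<le> 2 * (4 * l * B + 1 / l * (M1 e - M1 y)) + 2 * (4 * l * B + 1 / l * (M1 d - M1 y))"
    by (intro add_mono mult_left_mono intR e d) auto
  also have "\<dots> = 16 * l * B + 2 / l * (M1 e - M1 y) + 2 / l * (M1 d - M1 y)" by simp
  finally show ?thesis .
qed

lemma L1_Cauchy:
  assumes "\<sigma> > 0"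
  shows "\<exists>\<delta>>0. \<forall>e d. 0 < e \<longrightarrow> e < \<delta> \<longrightarrow> 0 < d \<longrightarrow> d < \<delta> \<longrightarrow>
    (LINT x|lborel. norm (f (Complex x e) - f (Complex x d))) < \<sigma>"
proof -
  \<comment> \<open>The weight is fixed first, to make the size term at most \<sigma> / 4. Only then
    is y chosen, with M1 y so close to the supremum that the division by l is harmless: the two
    remaining terms are at most \<sigma> / 8 each.\<close>
  define l where "l = \<sigma> / (64 * (B + 1))"
  have l: "l > 0" using assms B_nonneg by (simp add: l_def)
  have lB: "16 * l * B \<le> \<sigma> / 4"
    using B_nonneg assms by (simp add: l_def field_simps)
  define S where "S = Sup (M1 ` {0<..})"
  have bdd: "bdd_above (M1 ` {0<..})" using bound by (auto simp: M1_def intro!: bdd_aboveI)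
  have "\<exists>u\<in>M1 ` {0<..}. S - l * \<sigma> / 16 < u"
    using less_cSup_iff[OF _ bdd, of "S - l * \<sigma> / 16"] l assms by (auto simp: S_def)
  then obtain y where y: "y > 0" "S - l * \<sigma> / 16 < M1 y" by auto
  have M: "2 / l * (M1 e - M1 y) \<le> \<sigma> / 8" if "e > 0" for e
  proof -
    have "M1 e \<le> S" unfolding S_def using that bdd by (intro cSup_upper) auto
    then have "2 / l * (M1 e - M1 y) \<le> 2 / l * (l * \<sigma> / 16)" using y l by (intro mult_left_mono) auto
    then show ?thesis using l by simp
  qed
  have "(LINT x|lborel. norm (f (Complex x e) - f (Complex x d))) < \<sigma>"
    if "0 < e" "e < y / 2" "0 < d" "d < y / 2" for e d
    using L1_dist_le[OF y(1) that l] lB M[OF that(1)] M[OF that(3)] assms by linarith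
  then show ?thesis using y(1) by (intro exI[of _ "y / 2"]) auto
qed

end

text \<open>The limit is found along a sequence of heights with a subsequence converging almost
  everywhere. Fatou's lemma, with u fixed and the subsequence running, then bounds the distance of
  \<open>s u\<close> from it for every small u, on and off the sequence.\<close>

lemma L1_Cauchy_at_right_limit:
  fixes s :: "real \<Rightarrow> 'a \<Rightarrow> 'b::{banach, second_countable_topology}"
  assumes int: "\<And>y. y > 0 \<Longrightarrow> integrable M (s y)"
    and C: "\<And>\<sigma>. \<sigma> > 0 \<Longrightarrow> \<exists>\<delta>>0. \<forall>e d. 0 < e \<longrightarrow> e < \<delta> \<longrightarrow> 0 < d \<longrightarrow> d < \<delta> \<longrightarrow>
      (LINT x|M. norm (s e x - s d x)) < \<sigma>"
  obtains g where "integrable M g" "((\<lambda>y. LINT x|M. norm (s y x - g x)) \<longlongrightarrow> 0) (at_right 0)"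
proof -
  define y where "y = (\<lambda>n. inverse (real (Suc n)))"
  have y: "y n > 0" for n by (simp add: y_def)
  have yd: "\<exists>N. \<forall>n\<ge>N. y n < d" if "d > 0" for d
    using order_tendstoD(2)[OF LIMSEQ_inverse_real_of_nat that] by (simp add: eventually_sequentially y_def)
  note [measurable] = borel_measurable_integrable[OF int[OF y]]
  obtain r where r: "strict_mono r" "AE x in M. Cauchy (\<lambda>i. s (y (r i)) x)"
  proof (rule cauchy_L1_AE_cauchy_subseq[of M "\<lambda>n. s (y n)"])
    show "integrable M (s (y n))" for n using int y by simp
    fix e :: real assume "e > 0"
    then obtain d where d: "d > 0" "\<And>u v. 0 < u \<Longrightarrow> u < d \<Longrightarrow> 0 < v \<Longrightarrow> v < d \<Longrightarrow> (LINT x|M. norm (s u x - s v x)) < e"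
      using C by metis
    obtain N where "\<forall>n\<ge>N. y n < d" using yd d(1) by blast
    then show "\<exists>N. \<forall>i\<ge>N. \<forall>j\<ge>N. (LINT x|M. norm (s (y i) x - s (y j) x)) < e"
      using d(2) y by (intro exI[of _ N]) auto
  qed
  define g where "g = (\<lambda>x. lim (\<lambda>i. s (y (r i)) x))"
  have [measurable]: "g \<in> borel_measurable M" unfolding g_def by (rule borel_measurable_lim_metric) simp
  have lim: "AE x in M. (\<lambda>i. s (y (r i)) x) \<longlonglongrightarrow> g x"
    using r(2) by eventually_elim (simp add: g_def Cauchy_convergent_iff convergent_LIMSEQ_iff)
  have bd: "\<exists>d>0. \<forall>u. 0 < u \<longrightarrow> u < d \<longrightarrow> (\<integral>\<^sup>+x. norm (s u x - g x) \<partial>M) \<le> ennreal \<sigma>" if \<sigma>: "\<sigma> > 0" for \<sigma>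
  proof -
    obtain d where d: "d > 0" "\<And>u v. 0 < u \<Longrightarrow> u < d \<Longrightarrow> 0 < v \<Longrightarrow> v < d \<Longrightarrow> (LINT x|M. norm (s u x - s v x)) < \<sigma>"
      using C[OF \<sigma>] by blast
    obtain N where N: "\<forall>n\<ge>N. y n < d" using yd d(1) by blast
    have "(\<integral>\<^sup>+x. norm (s u x - g x) \<partial>M) \<le> ennreal \<sigma>" if u: "0 < u" "u < d" for u
    proof -
      note [measurable] = borel_measurable_integrable[OF int[OF u(1)]]
      have "(\<integral>\<^sup>+x. norm (s u x - g x) \<partial>M) = (\<integral>\<^sup>+x. liminf (\<lambda>i. ennreal (norm (s u x - s (y (r i)) x))) \<partial>M)"
      proof (rule nn_integral_cong_AE)
        show "AE x in M. ennreal (norm (s u x - g x)) = liminf (\<lambda>i. ennreal (norm (s u x - s (y (r i)) x)))"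
          using lim
        proof eventually_elim
          case (elim x)
          then have "(\<lambda>i. ennreal (norm (s u x - s (y (r i)) x))) \<longlonglongrightarrow> ennreal (norm (s u x - g x))"
            by (intro tendsto_intros)
          then show ?case by (intro lim_imp_Liminf[symmetric]) simp
        qed
      qed
      also have "\<dots> \<le> liminf (\<lambda>i. \<integral>\<^sup>+x. ennreal (norm (s u x - s (y (r i)) x)) \<partial>M)"
        by (rule nn_integral_liminf) measurable
      also have "\<dots> \<le> ennreal \<sigma>"
      proof (rule Liminf_le)
        have "(\<integral>\<^sup>+x. ennreal (norm (s u x - s (y (r i)) x)) \<partial>M) \<le> ennreal \<sigma>" if "i \<ge> N" for i
        proof -
          have "y (r i) < d" using N strict_mono_imp_increasing[OF r(1), of i] that by auto
          then have "(LINT x|M. norm (s u x - s (y (r i)) x)) \<le> \<sigma>" using d(2)[OF u y] by (simp add: less_imp_le)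
          then show ?thesis
            using int[OF u(1)] int[OF y] by (subst nn_integral_eq_integral) (auto intro: ennreal_leI)
        qed
        then show "\<forall>\<^sub>F i in sequentially. (\<integral>\<^sup>+x. ennreal (norm (s u x - s (y (r i)) x)) \<partial>M) \<le> ennreal \<sigma>"
          by (auto simp: eventually_sequentially)
      qed simp
      finally show ?thesis .
    qed
    then show ?thesis using d(1) by blast
  qed
  have ig: "integrable M g"
  proof -
    obtain d where d: "d > 0" "\<And>u. 0 < u \<Longrightarrow> u < d \<Longrightarrow> (\<integral>\<^sup>+x. norm (s u x - g x) \<partial>M) \<le> ennreal 1"
      using bd[of 1] by auto
    define u where "u = d / 2"
    have u: "0 < u" "u < d" using d by (auto simp: u_def)
    note [measurable] = borel_measurable_integrable[OF int[OF u(1)]]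
    have "integrable M (\<lambda>x. s u x - g x)"
      using d(2)[OF u] by (intro integrableI_bounded) (auto intro: le_less_trans)
    from Bochner_Integration.integrable_diff[OF int[OF u(1)] this] show ?thesis by simp
  qed
  have "((\<lambda>y. LINT x|M. norm (s y x - g x)) \<longlongrightarrow> 0) (at_right 0)"
  proof (rule tendstoI)
    fix e :: real assume e: "e > 0"
    obtain d where d: "d > 0" "\<And>u. 0 < u \<Longrightarrow> u < d \<Longrightarrow> (\<integral>\<^sup>+x. norm (s u x - g x) \<partial>M) \<le> ennreal (e / 2)"
      using bd[of "e / 2"] e by auto
    have "(LINT x|M. norm (s u x - g x)) \<le> e / 2" if "0 < u" "u < d" for u
    proof -
      have "integrable M (\<lambda>x. norm (s u x - g x))" using int[OF that(1)] ig by simp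
      then have "ennreal (LINT x|M. norm (s u x - g x)) \<le> ennreal (e / 2)"
        using d(2)[OF that] by (subst nn_integral_eq_integral[symmetric]) auto
      then show ?thesis using e by simp
    qed
    then show "\<forall>\<^sub>F u in at_right 0. dist (LINT x|M. norm (s u x - g x)) 0 < e"
      using d(1) e by (auto simp: eventually_at_right_field dist_real_def intro!: exI[of _ d])
         (smt (verit) field_sum_of_halves)
  qed
  with ig show ?thesis by (rule that)
qed

section \<open>Differentiation of indefinite integrals and weighted estimates\<close>

text \<open>The differentiation theorem for cubes with lower corner x, which on the line are the
  intervals to the right of x.\<close>

lemma AE_indefinite_integral_right_derivative:
  fixes \<phi> :: "real \<Rightarrow> complex"
  assumes "integrable lborel \<phi>"
  shows "AE x in lborel. \<forall>e>0. \<exists>d>0. \<forall>h. 0 < h \<and> h < d \<longrightarrow>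
    norm ((LINT y:{x..x + h}|lborel. \<phi> y) - h *\<^sub>R \<phi> x) \<le> e * h"
proof -
  have si: "set_integrable lborel S \<phi>" if "S \<in> sets borel" for S
    unfolding set_integrable_def using assms that by (intro integrable_mult_indicator) auto
  have int: "\<phi> integrable_on cbox a b" for a b
    using set_borel_integral_eq_integral(1)[OF si] by simp
  obtain N where N: "negligible N"
    "\<And>x e. \<lbrakk>x \<notin> N; 0 < e\<rbrakk> \<Longrightarrow> \<exists>d>0. \<forall>h. 0 < h \<and> h < d \<longrightarrow>
       norm (integral (cbox x (x + h *\<^sub>R One)) \<phi> /\<^sub>R h ^ DIM(real) - \<phi> x) < e"
    using integrable_ccontinuous_explicit[OF int] by blast
  have "AE x in lebesgue. x \<notin> N"
    using N(1) by (intro AE_not_in) (simp add: negligible_iff_null_sets)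
  then have "AE x in lborel. x \<notin> N" by (simp add: AE_completion_iff)
  then show ?thesis
  proof eventually_elim
    case (elim x)
    show ?case
    proof (intro allI impI)
      fix e :: real assume "e > 0"
      then obtain d where d: "d > 0"
        "\<And>h. 0 < h \<Longrightarrow> h < d \<Longrightarrow> norm (integral {x..x + h} \<phi> /\<^sub>R h - \<phi> x) < e"
        using N(2)[OF elim] by force
      have "norm ((LINT y:{x..x + h}|lborel. \<phi> y) - h *\<^sub>R \<phi> x) \<le> e * h" if h: "0 < h" "h < d" for h
      proof -
        have "(LINT y:{x..x + h}|lborel. \<phi> y) - h *\<^sub>R \<phi> x = h *\<^sub>R (integral {x..x + h} \<phi> /\<^sub>R h - \<phi> x)"
          using set_borel_integral_eq_integral(2)[OF si, of "{x..x+h}"] h by (simp add: scaleR_diff_right)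
        then have "norm ((LINT y:{x..x + h}|lborel. \<phi> y) - h *\<^sub>R \<phi> x) = h * norm (integral {x..x + h} \<phi> /\<^sub>R h - \<phi> x)"
          using h by simp
        also have "\<dots> \<le> e * h"
          using mult_left_mono[OF less_imp_le[OF d(2)[OF h]], of h] h by (simp add: mult.commute)
        finally show ?thesis .
      qed
      then show "\<exists>d>0. \<forall>h. 0 < h \<and> h < d \<longrightarrow> norm ((LINT y:{x..x + h}|lborel. \<phi> y) - h *\<^sub>R \<phi> x) \<le> e * h"
        using d(1) by blast
    qed
  qed
qed

lemma set_integral_Icc_uminus:
  fixes \<phi> :: "real \<Rightarrow> complex"
  shows "(LINT y:{-b..-a}|lborel. \<phi> (- y)) = (LINT y:{a..b}|lborel. \<phi> y)"
proof -
  have "(LINT y:{a..b}|lborel. \<phi> y) = (LINT y|lborel. indicat_real {a..b} (- y) *\<^sub>R \<phi> (- y))"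
    unfolding set_lebesgue_integral_def
    using lborel_integral_real_affine[of "-1" "\<lambda>y. indicat_real {a..b} y *\<^sub>R \<phi> y" 0] by simp
  also have "\<dots> = (LINT y:{-b..-a}|lborel. \<phi> (- y))"
    unfolding set_lebesgue_integral_def
    by (rule Bochner_Integration.integral_cong) (auto simp: indicator_def)
  finally show ?thesis ..
qed

lemma AE_lborel_uminus:
  assumes "AE x in lborel. P (x::real)"
  shows "AE x in lborel. P (- x)"
  using AE_distrD[of uminus lborel borel P] assms unfolding lborel_distr_uminus by simp

text \<open>The left derivative is the right derivative for the reflected function. Since G, a and b
  are quantified inside, one null set serves all indefinite integrals of \<phi> on all
  intervals.\<close>

lemma AE_indefinite_integral_derivative:
  fixes \<phi> :: "real \<Rightarrow> complex"
  assumes "integrable lborel \<phi>"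
  shows "AE x in lborel. \<forall>G a b. a < x \<longrightarrow> x < b \<longrightarrow>
    (\<forall>c d. a \<le> c \<longrightarrow> c \<le> d \<longrightarrow> d \<le> b \<longrightarrow> G d - G c = (LINT y:{c..d}|lborel. \<phi> y)) \<longrightarrow>
    (G has_vector_derivative \<phi> x) (at x)"
proof -
  have "integrable lborel (\<lambda>x. \<phi> (- x))"
    using lborel_integrable_real_affine_iff[of "-1" \<phi> 0] assms by simp
  from AE_lborel_uminus[OF AE_indefinite_integral_right_derivative[OF this]]
    AE_indefinite_integral_right_derivative[OF assms]
  show ?thesis
  proof eventually_elim
    case (elim x)
    show ?case
    proof (intro allI impI)
      fix G a b assume ab: "a < x" "x < b"
        and G: "\<forall>c d. a \<le> c \<longrightarrow> c \<le> d \<longrightarrow> d \<le> b \<longrightarrow> G d - G c = (LINT y:{c..d}|lborel. \<phi> y)"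
      have "\<exists>d>0. \<forall>y. norm (y - x) < d \<longrightarrow> norm (G y - G x - (y - x) *\<^sub>R \<phi> x) \<le> e * norm (y - x)"
        if e: "e > 0" for e
      proof -
        obtain d1 where d1: "d1 > 0"
          "\<And>h. 0 < h \<Longrightarrow> h < d1 \<Longrightarrow> norm ((LINT y:{-x..-x + h}|lborel. \<phi> (- y)) - h *\<^sub>R \<phi> x) \<le> e * h"
          using elim(1)[rule_format, OF e] unfolding minus_minus by blast
        obtain d2 where d2: "d2 > 0"
          "\<And>h. 0 < h \<Longrightarrow> h < d2 \<Longrightarrow> norm ((LINT y:{x..x + h}|lborel. \<phi> y) - h *\<^sub>R \<phi> x) \<le> e * h"
          using elim(2)[rule_format, OF e] by blast
        define d where "d = min (min d1 d2) (min (x - a) (b - x))"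
        have "norm (G y - G x - (y - x) *\<^sub>R \<phi> x) \<le> e * norm (y - x)" if y: "norm (y - x) < d" for y
        proof (cases y x rule: linorder_cases)
          case less
          have "G x - G y = (LINT u:{-x..-y}|lborel. \<phi> (- u))"
            using G y less ab by (subst set_integral_Icc_uminus) (auto simp: d_def)
          then have "norm ((G x - G y) - (x - y) *\<^sub>R \<phi> x) \<le> e * (x - y)"
            using d1(2)[of "x - y"] less y by (simp add: d_def)
          moreover have "G y - G x - (y - x) *\<^sub>R \<phi> x = - ((G x - G y) - (x - y) *\<^sub>R \<phi> x)"
            by (simp add: scaleR_diff_left)
          ultimately show ?thesis using less by (simp only: norm_minus_cancel real_norm_def) (simp add: abs_minus_commute)
        next
          case greater
          have "G y - G x = (LINT u:{x..x + (y - x)}|lborel. \<phi> u)" using G y greater ab by (auto simp: d_def)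
          then show ?thesis using d2(2)[of "y - x"] greater y by (simp add: d_def)
        qed auto
        moreover have "d > 0" using d1 d2 ab by (simp add: d_def)
        ultimately show ?thesis by blast
      qed
      then show "(G has_vector_derivative \<phi> x) (at x)"
        unfolding has_vector_derivative_def has_derivative_at_alt
        by (auto intro: bounded_linear_scaleR_left)
    qed
  qed
qed

text \<open>From k - m g = m (h - g) + (m(x + \<i> y) - m(x)) g: the first term is small by
  convergence in mean, the second by the Lipschitz bound in y. The multiplier m will be z + \<i> to
  recover \<open>f\<close> and 1 + \<i> / z to obtain \<open>f / z\<close>.\<close>

lemma weighted_L1_convergence:
  fixes h :: "complex \<Rightarrow> complex" and g :: "real \<Rightarrow> complex"
  assumes ih: "\<And>y. y > 0 \<Longrightarrow> integrable lborel (\<lambda>x. h (Complex x y))" and ig: "integrable lborel g"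
    and lim: "((\<lambda>y. LINT x|lborel. norm (h (Complex x y) - g x)) \<longlongrightarrow> 0) (at_right 0)"
    and k: "\<And>x y. x \<in> {a..b} \<Longrightarrow> y > 0 \<Longrightarrow> k (Complex x y) = m (Complex x y) * h (Complex x y)"
    and mc: "continuous_on {a..b} (\<lambda>x. m (of_real x))"
    and m: "\<And>x y. x \<in> {a..b} \<Longrightarrow> 0 < y \<Longrightarrow> y < 1 \<Longrightarrow> norm (m (Complex x y)) \<le> A"
    and md: "\<And>x y. x \<in> {a..b} \<Longrightarrow> 0 < y \<Longrightarrow> y < 1 \<Longrightarrow> norm (m (Complex x y) - m (of_real x)) \<le> A * y"
  shows "set_integrable lborel {a..b} (\<lambda>x. m (of_real x) * g x)"
    and "((\<lambda>y. LINT x:{a..b}|lborel. norm (k (Complex x y) - m (of_real x) * g x)) \<longlongrightarrow> 0) (at_right 0)"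
proof -
  have [measurable]: "g \<in> borel_measurable borel" using ig by auto
  \<comment> \<open>If the interval is empty, the hypotheses say nothing about the sign of A, while
    the majorant on the whole line has to be nonnegative.\<close>
  define A' where "A' = max A 0"
  have [measurable]: "(\<lambda>x. indicator {a..b} x *\<^sub>R m (of_real x)) \<in> borel_measurable borel"
    using mc by (intro borel_measurable_continuous_on_indicator) auto
  have eq: "indicator {a..b} x *\<^sub>R (m (of_real x) * g x) = (indicator {a..b} x *\<^sub>R m (of_real x)) * g x" for x
    by simp
  obtain M where M: "M > 0" "\<And>x. x \<in> {a..b} \<Longrightarrow> norm (m (of_real x)) \<le> M"
    using compact_imp_bounded[OF compact_continuous_image[OF mc compact_Icc]]
    by (auto simp: bounded_pos)
  show "set_integrable lborel {a..b} (\<lambda>x. m (of_real x) * g x)"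
    unfolding set_integrable_def eq
  proof (rule Bochner_Integration.integrable_bound)
    show "integrable lborel (\<lambda>x. M * norm (g x))" using ig by simp
    show "AE x in lborel. norm ((indicator {a..b} x *\<^sub>R m (of_real x)) * g x) \<le> norm (M * norm (g x))"
      using M by (intro AE_I2) (auto simp: indicator_def norm_mult intro!: mult_right_mono)
  qed measurable
  let ?D = "\<lambda>y. LINT x|lborel. norm (h (Complex x y) - g x)"
  have le: "(LINT x:{a..b}|lborel. norm (k (Complex x y) - m (of_real x) * g x)) \<le> A' * ?D y + A' * y * (LINT x|lborel. norm (g x))"
    if y: "0 < y" "y < 1" for y
  proof -
    have "(LINT x:{a..b}|lborel. norm (k (Complex x y) - m (of_real x) * g x))
      \<le> (LINT x|lborel. A' * norm (h (Complex x y) - g x) + A' * y * norm (g x))"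
      unfolding set_lebesgue_integral_def
    proof (rule integral_mono')
      show "integrable lborel (\<lambda>x. A' * norm (h (Complex x y) - g x) + A' * y * norm (g x))"
        using ih[OF y(1)] ig by simp
      fix x
      show "0 \<le> A' * norm (h (Complex x y) - g x) + A' * y * norm (g x)"
        using y by (simp add: A'_def)
      show "indicat_real {a..b} x *\<^sub>R norm (k (Complex x y) - m (of_real x) * g x)
        \<le> A' * norm (h (Complex x y) - g x) + A' * y * norm (g x)"
      proof (cases "x \<in> {a..b}")
        case True
        have "k (Complex x y) - m (of_real x) * g x
            = m (Complex x y) * (h (Complex x y) - g x) + (m (Complex x y) - m (of_real x)) * g x"
          using k[OF True y(1)] by (simp add: algebra_simps)
        also have "norm \<dots> \<le> norm (m (Complex x y)) * norm (h (Complex x y) - g x)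
            + norm (m (Complex x y) - m (of_real x)) * norm (g x)"
          by (rule order_trans[OF norm_triangle_ineq]) (simp add: norm_mult)
        also have "\<dots> \<le> A' * norm (h (Complex x y) - g x) + A' * y * norm (g x)"
        proof (intro add_mono mult_right_mono)
          show "norm (m (Complex x y)) \<le> A'" using m[OF True y] by (simp add: A'_def)
          have "A * y \<le> A' * y" using y by (intro mult_right_mono) (auto simp: A'_def)
          then show "norm (m (Complex x y) - m (of_real x)) \<le> A' * y" using md[OF True y] by simp
        qed auto
        finally show ?thesis using True by simp
      qed (use y in \<open>simp add: A'_def\<close>)
    qed
    also have "\<dots> = A' * ?D y + A' * y * (LINT x|lborel. norm (g x))"
      using ih[OF y(1)] ig by simp
    finally show ?thesis .
  qed
  have "((\<lambda>y. A' * ?D y + A' * y * (LINT x|lborel. norm (g x))) \<longlongrightarrow> A' * 0 + A' * 0 * (LINT x|lborel. norm (g x))) (at_right 0)"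
    by (intro tendsto_intros lim)
  then have lim': "((\<lambda>y. A' * ?D y + A' * y * (LINT x|lborel. norm (g x))) \<longlongrightarrow> 0) (at_right 0)" by simp
  show "((\<lambda>y. LINT x:{a..b}|lborel. norm (k (Complex x y) - m (of_real x) * g x)) \<longlongrightarrow> 0) (at_right 0)"
  proof (rule tendsto_sandwich[OF _ _ tendsto_const lim'])
    show "\<forall>\<^sub>F y in at_right 0. 0 \<le> (LINT x:{a..b}|lborel. norm (k (Complex x y) - m (of_real x) * g x))"
      unfolding set_lebesgue_integral_def by (intro always_eventually allI integral_nonneg_AE AE_I2) simp
    show "\<forall>\<^sub>F y in at_right 0. (LINT x:{a..b}|lborel. norm (k (Complex x y) - m (of_real x) * g x))
        \<le> A' * ?D y + A' * y * (LINT x|lborel. norm (g x))"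
      unfolding eventually_at_right_field using le by (intro exI[of _ 1]) auto
  qed
qed

section \<open>Tools for the decay of \<open>f / z\<close>\<close>

lemma integrable_one_plus_abs_powr:
  assumes r: "r > 1"
  shows "integrable lborel (\<lambda>x::real. (1 + \<bar>x\<bar>) powr - r)"
proof -
  have lt: "(0::ereal) < \<infinity>" by simp
  let ?F = "\<lambda>x::real. - ((1 + x) powr (1 - r)) / (r - 1)"
  have d: "DERIV ?F x :> (1 + x) powr - r" if "0 < ereal x" "ereal x < \<infinity>" for x
  proof -
    have *: "((\<lambda>x. (1 + x) powr (1 - r)) has_real_derivative (1 - r) * (1 + x) powr (- r)) (at x)"
      using has_real_derivative_powr[of "1 + x" "1 - r"] DERIV_shift[of "\<lambda>z. z powr (1 - r)" _ x 1] that
      by (simp add: add.commute)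
    show ?thesis
      by (rule DERIV_cong[OF DERIV_cdivide[OF DERIV_minus[OF *]]]) (use r in \<open>simp add: field_simps\<close>)
  qed
  have c: "isCont (\<lambda>x. (1 + x) powr - r) x" if "0 < ereal x" "ereal x < \<infinity>" for x
    using that by (intro continuous_intros) auto
  have l: "((?F \<circ> real_of_ereal) \<longlongrightarrow> ?F 0) (at_right 0)"
    unfolding zero_ereal_def ereal_tendsto_simps using r by (auto intro!: tendsto_eq_intros)
  have "((\<lambda>x. (1 + x) powr (1 - r)) \<longlongrightarrow> 0) at_top"
    using r by (intro tendsto_neg_powr filterlim_tendsto_add_at_top[OF tendsto_const] filterlim_ident) auto
  then have "(?F \<longlongrightarrow> - 0 / (r - 1)) at_top"
    using r by (intro tendsto_intros) auto
  then have u: "((?F \<circ> real_of_ereal) \<longlongrightarrow> 0) (at_left \<infinity>)"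
    unfolding ereal_tendsto_simps by simp
  have "set_integrable lborel (einterval 0 \<infinity>) (\<lambda>x. (1 + x) powr - r)"
    by (rule interval_integral_FTC_nonneg(1)[OF lt d c _ l u]) auto
  then have pos: "integrable lborel (\<lambda>x. indicat_real {0<..} x * (1 + x) powr - r)"
    by (simp add: set_integrable_def zero_ereal_def)
  have neg: "integrable lborel (\<lambda>x. indicat_real {0<..} (- x) * (1 - x) powr - r)"
    using lborel_integrable_real_affine_iff[of "-1" "\<lambda>x. indicat_real {0<..} x * (1 + x) powr - r" 0] pos by simp
  \<comment> \<open>The last summand supplies the value 1 at 0, which both open half-lines
    omit.\<close>
  have "integrable lborel (\<lambda>x. indicat_real {0<..} x * (1 + x) powr - r + indicat_real {0<..} (- x) * (1 - x) powr - r + indicat_real {0} x)"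
    using pos neg by simp
  then show ?thesis
    by (rule Bochner_Integration.integrable_cong[THEN iffD1, OF refl, rotated]) (auto simp: indicator_def)
qed

text \<open>Young's inequality with a weight, by a case distinction: if b is at most \<mu> a^(p -
  1), the first term alone suffices; otherwise a is less than (b / \<mu>)^(1 / (p - 1)) and the
  second does.\<close>

lemma young_powr:
  fixes a b \<mu> p :: real
  assumes "a \<ge> 0" "b \<ge> 0" "\<mu> > 0" "p > 1"
  shows "a * b \<le> \<mu> * a powr p + \<mu> powr (- 1 / (p - 1)) * b powr (p / (p - 1))"
proof (cases "b \<le> \<mu> * a powr (p - 1)")
  case True
  have "a * b \<le> a * (\<mu> * a powr (p - 1))" using True assms by (intro mult_left_mono)
  also have "\<dots> = \<mu> * a powr p"
    using assms by (cases "a = 0") (auto simp: powr_diff)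
  finally show ?thesis using assms by (smt (verit) mult_nonneg_nonneg powr_ge_zero)
next
  case False
  have b: "b > 0" using False assms by (smt (verit) mult_nonneg_nonneg powr_ge_zero)
  have "a = (a powr (p - 1)) powr (1 / (p - 1))"
    using assms by (simp add: powr_powr)
  also have "\<dots> \<le> (b / \<mu>) powr (1 / (p - 1))"
    using False assms by (intro powr_mono2) (auto simp: field_simps)
  also have "\<dots> = \<mu> powr (- 1 / (p - 1)) * b powr (1 / (p - 1))"
    using assms b by (simp add: powr_divide powr_minus field_simps)
  finally have "a * b \<le> \<mu> powr (- 1 / (p - 1)) * b powr (1 / (p - 1)) * b"
    using b by (intro mult_right_mono) auto
  also have "\<dots> = \<mu> powr (- 1 / (p - 1)) * b powr (1 / (p - 1) + 1)"
    using b by (simp add: powr_add)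
  also have "1 / (p - 1) + 1 = p / (p - 1)" using assms by (simp add: field_simps)
  finally show ?thesis using assms by (smt (verit) mult_nonneg_nonneg powr_ge_zero)
qed

section \<open>Hardy spaces and the two operators\<close>

lemma hardy_space_integral_bound:
  assumes p: "p \<ge> 1" and f: "f \<in> hardy_space p"
  obtains B where "B \<ge> 0" "\<And>y. y > 0 \<Longrightarrow> (LINT x|lborel. norm (f (Complex x y)) powr p) \<le> B"
proof -
  obtain C where C: "\<And>y. y > 0 \<Longrightarrow> hardy_mean p f y \<le> C"
    using f by (auto simp: hardy_space_def bdd_above_def)
  have "(LINT x|lborel. norm (f (Complex x y)) powr p) \<le> \<bar>C\<bar> powr p" if "y > 0" for y
  proof -
    let ?I = "LINT x|lborel. norm (f (Complex x y)) powr p"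
    have I: "?I \<ge> 0" by (intro integral_nonneg_AE) simp
    have "?I = (?I powr (1 / p)) powr p" using p I by (simp add: powr_powr)
    also have "\<dots> \<le> \<bar>C\<bar> powr p"
      using C[OF that] p by (intro powr_mono2) (auto simp: hardy_mean_def)
    finally show ?thesis .
  qed
  then show ?thesis by (intro that[of "\<bar>C\<bar> powr p"]) auto
qed

text \<open>The height \<eta> of the denominator is independent of the height y of \<open>f\<close>,
  so one estimate covers two quotients: \<eta> = y + 1 gives f / (z + \<i>), and \<eta> = y gives f
  / z.\<close>

definition weighted_tail_bound :: "(complex \<Rightarrow> complex) \<Rightarrow> real \<Rightarrow> real \<Rightarrow> bool" where
  "weighted_tail_bound f R c \<longleftrightarrow> (\<forall>y>0. \<forall>\<eta>.
     set_integrable lborel {x. norm (Complex x \<eta>) \<ge> R} (\<lambda>x. f (Complex x y) / Complex x \<eta>) \<and>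
     (LINT x:{x. norm (Complex x \<eta>) \<ge> R}|lborel. norm (f (Complex x y) / Complex x \<eta>)) \<le> c)"

text \<open>For p = 1 the factor 1 / R comes out directly. For p > 1, Young's inequality separates
  |f|^p, with a weight that makes its integral at most \<tau>, from |z|^(-q) with the conjugate
  exponent q. Writing q = \<kappa> + r with r > 1, the part of exponent \<kappa> gives R^(-\<kappa>)
  and the part of exponent r is integrable. The constant C depends on \<tau>, but neither on R nor
  on the heights.\<close>

lemma hardy_space_weighted_tail:
  assumes p: "p \<ge> 1" and f: "f \<in> hardy_space p"
  obtains \<kappa> where "\<kappa> > 0"
    "\<And>\<tau>. \<tau> > 0 \<Longrightarrow> \<exists>C. \<forall>R\<ge>1. weighted_tail_bound f R (\<tau> + C * R powr - \<kappa>)"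
proof -
  obtain B where B: "B \<ge> 0" "\<And>y. y > 0 \<Longrightarrow> (LINT x|lborel. norm (f (Complex x y)) powr p) \<le> B"
    using hardy_space_integral_bound[OF p f] by blast
  have hol: "f holomorphic_on upper_half_plane"
    and int: "\<And>y. y > 0 \<Longrightarrow> integrable lborel (\<lambda>x. norm (f (Complex x y)) powr p)"
    using f by (auto simp: hardy_space_def)
  let ?S = "\<lambda>R \<eta>. {x. norm (Complex x \<eta>) \<ge> R}"
  have dominated: "set_integrable lborel (?S R \<eta>) (\<lambda>x. f (Complex x y) / Complex x \<eta>) \<and>
      (LINT x:?S R \<eta>|lborel. norm (f (Complex x y) / Complex x \<eta>)) \<le> (LINT x|lborel. \<psi> x)"
    if y: "y > 0" and \<psi>: "integrable lborel \<psi>" "\<And>x. 0 \<le> \<psi> x"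
      and le: "\<And>x. norm (Complex x \<eta>) \<ge> R \<Longrightarrow> norm (f (Complex x y) / Complex x \<eta>) \<le> \<psi> x" for y R \<eta> \<psi>
  proof
    have [measurable]: "(\<lambda>x. f (Complex x y)) \<in> borel_measurable borel"
      by (rule borel_measurable_continuous_onI[OF continuous_on_horizontal[OF hol y]])
    have [measurable]: "(\<lambda>x. Complex x \<eta>) \<in> borel_measurable borel"
      unfolding Complex_eq by measurable
    have m: "(\<lambda>x. indicat_real (?S R \<eta>) x *\<^sub>R (f (Complex x y) / Complex x \<eta>)) \<in> borel_measurable lborel"
      by measurable
    show i: "set_integrable lborel (?S R \<eta>) (\<lambda>x. f (Complex x y) / Complex x \<eta>)"
      unfolding set_integrable_def
      by (rule Bochner_Integration.integrable_bound[OF \<psi>(1) m])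
         (use le \<psi>(2) in \<open>auto simp: indicator_def abs_of_nonneg\<close>)
    show "(LINT x:?S R \<eta>|lborel. norm (f (Complex x y) / Complex x \<eta>)) \<le> (LINT x|lborel. \<psi> x)"
      unfolding set_lebesgue_integral_def
      by (rule integral_mono'[OF \<psi>(1)]) (use le \<psi>(2) in \<open>auto simp: indicator_def\<close>)
  qed
  show ?thesis
  proof (cases "p = 1")
    case True
    have *: "\<forall>R\<ge>1. weighted_tail_bound f R (\<tau> + B * R powr - 1)" if "\<tau> > 0" for \<tau>
      unfolding weighted_tail_bound_def
    proof (intro allI impI)
      fix R y \<eta> :: real assume R: "R \<ge> 1" and y: "y > 0"
      have iy: "integrable lborel (\<lambda>x. norm (f (Complex x y)) / R)" using int[OF y] True by simp
      have "norm (f (Complex x y) / Complex x \<eta>) \<le> norm (f (Complex x y)) / R" if "norm (Complex x \<eta>) \<ge> R" for x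
        using that R unfolding norm_divide by (intro divide_left_mono mult_pos_pos) auto
      note dom = dominated[OF y iy _ this]
      have "(LINT x|lborel. norm (f (Complex x y)) / R) \<le> \<tau> + B * R powr - 1"
        using B(2)[OF y] True R that by (simp add: powr_minus divide_inverse mult_right_mono add_increasing)
      then show "set_integrable lborel (?S R \<eta>) (\<lambda>x. f (Complex x y) / Complex x \<eta>) \<and>
        (LINT x:?S R \<eta>|lborel. norm (f (Complex x y) / Complex x \<eta>)) \<le> \<tau> + B * R powr - 1"
        using dom R by force
    qed
    show ?thesis
    proof (rule that[of 1])
      fix \<tau> :: real assume "\<tau> > 0"
      from *[OF this] show "\<exists>C. \<forall>R\<ge>1. weighted_tail_bound f R (\<tau> + C * R powr - 1)" by (rule exI)
    qed simp
  next
    case False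
    then have p1: "p > 1" using p by simp
    define q where "q = p / (p - 1)"
    define r where "r = (q + 1) / 2"
    define \<kappa> where "\<kappa> = (q - 1) / 2"
    have q: "q > 1" using p1 by (simp add: q_def)
    have r: "r > 1" and \<kappa>: "\<kappa> > 0" and q_eq: "q = \<kappa> + r" using q by (auto simp: r_def \<kappa>_def field_simps)
    let ?w = "\<lambda>x::real. (1 + \<bar>x\<bar>) powr - r"
    define I where "I = (LINT x|lborel. ?w x)"
    have iw: "integrable lborel ?w" by (rule integrable_one_plus_abs_powr[OF r])
    show ?thesis
    proof (rule that[OF \<kappa>])
      fix \<tau> :: real assume \<tau>: "\<tau> > 0"
      define \<mu> where "\<mu> = \<tau> / (B + 1)"
      have \<mu>: "\<mu> > 0" "\<mu> * B \<le> \<tau>" using \<tau> B(1) by (auto simp: \<mu>_def field_simps)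
      define K where "K = \<mu> powr (- 1 / (p - 1)) * 2 powr r"
      have K: "K \<ge> 0" by (simp add: K_def)
      have "set_integrable lborel (?S R \<eta>) (\<lambda>x. f (Complex x y) / Complex x \<eta>) \<and>
        (LINT x:?S R \<eta>|lborel. norm (f (Complex x y) / Complex x \<eta>)) \<le> \<tau> + (K * I) * R powr - \<kappa>"
        if R: "R \<ge> 1" and y: "y > 0" for R y \<eta>
      proof -
        define \<psi> where "\<psi> = (\<lambda>x. \<mu> * norm (f (Complex x y)) powr p + (K * R powr - \<kappa>) * ?w x)"
        have i\<psi>: "integrable lborel \<psi>" unfolding \<psi>_def using int[OF y] iw by simp
        have \<psi>0: "\<psi> x \<ge> 0" for x using \<mu> K by (simp add: \<psi>_def)
        have "norm (f (Complex x y) / Complex x \<eta>) \<le> \<psi> x" if S: "norm (Complex x \<eta>) \<ge> R" for x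
        proof -
          let ?n = "norm (Complex x \<eta>)"
          define b where "b = 1 / ?n"
          have n: "?n \<ge> 1" using S R by simp
          have nz: "Complex x \<eta> \<noteq> 0" using n by auto
          have b: "b > 0" using nz by (simp add: b_def)
          have "b \<le> 1 / R" using S R by (simp add: b_def frac_le)
          then have b1: "b powr \<kappa> \<le> R powr - \<kappa>"
          proof -
            have "(1 / R) powr \<kappa> = R powr - \<kappa>" using R by (simp only: powr_divide powr_one_eq_one powr_minus_divide)
            then show ?thesis using powr_mono2[of \<kappa> b "1 / R"] \<open>b \<le> 1 / R\<close> b \<kappa> by simp
          qed
          \<comment> \<open>The modulus is at least 1 and at least |x|; so the majorant does not
            depend on \<eta>.\<close>
          have "1 + \<bar>x\<bar> \<le> 2 * ?n" using n abs_Re_le_cmod[of "Complex x \<eta>"] by simp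
          then have "b \<le> 2 / (1 + \<bar>x\<bar>)" using nz by (simp add: b_def field_simps)
          then have b2: "b powr r \<le> 2 powr r * ?w x"
          proof -
            have "(2 / (1 + \<bar>x\<bar>)) powr r = 2 powr r * ?w x" by (simp add: powr_divide powr_minus_divide)
            then show ?thesis using powr_mono2[of r b "2 / (1 + \<bar>x\<bar>)"] \<open>b \<le> 2 / (1 + \<bar>x\<bar>)\<close> b r by simp
          qed
          have "b powr q \<le> R powr - \<kappa> * (2 powr r * ?w x)"
            unfolding q_eq powr_add using b1 b2 by (intro mult_mono) auto
          then have "\<mu> powr (- 1 / (p - 1)) * b powr q \<le> \<mu> powr (- 1 / (p - 1)) * (R powr - \<kappa> * (2 powr r * ?w x))"
            by (intro mult_left_mono) auto
          moreover have "norm (f (Complex x y)) * b \<le> \<mu> * norm (f (Complex x y)) powr p + \<mu> powr (- 1 / (p - 1)) * b powr q"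
            unfolding q_def using b \<mu> p1 by (intro young_powr) auto
          ultimately have "norm (f (Complex x y)) * b \<le> \<psi> x" by (simp add: \<psi>_def K_def mult_ac)
          then show ?thesis by (simp add: b_def norm_divide)
        qed
        note dom = dominated[OF y i\<psi> \<psi>0 this]
        have "(LINT x|lborel. \<psi> x) = \<mu> * (LINT x|lborel. norm (f (Complex x y)) powr p) + (K * R powr - \<kappa>) * I"
          unfolding \<psi>_def I_def using int[OF y] iw by simp
        also have "\<dots> \<le> \<mu> * B + (K * R powr - \<kappa>) * I"
          using B(2)[OF y] \<mu> by simp
        also have "\<dots> \<le> \<tau> + (K * I) * R powr - \<kappa>" using \<mu>(2) by (simp add: mult_ac)
        finally show ?thesis using dom by (meson order_trans)
      qed
      then have "\<forall>R\<ge>1. weighted_tail_bound f R (\<tau> + (K * I) * R powr - \<kappa>)"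
        unfolding weighted_tail_bound_def by blast
      then show "\<exists>C. \<forall>R\<ge>1. weighted_tail_bound f R (\<tau> + C * R powr - \<kappa>)" by blast
    qed
  qed
qed

section \<open>The boundary function of an element of the Hardy space\<close>

locale hardy_function =
  fixes p :: real and f :: "complex \<Rightarrow> complex"
  assumes p: "p \<ge> 1" and f: "f \<in> hardy_space p"
begin

lemma hol: "f holomorphic_on upper_half_plane"
  using f by (simp add: hardy_space_def)

definition h :: "complex \<Rightarrow> complex" where "h z = f z / (z + \<i>)"

text \<open>For \<eta> = y + 1 and R = 1 the tail is the whole line, because |x + \<i> (y + 1)|
  \<ge> 1.\<close>

lemma hardy_one_h: "\<exists>B. hardy_one h B"
proof -
  obtain \<kappa> where "\<And>\<tau>. \<tau> > 0 \<Longrightarrow> \<exists>C. \<forall>R\<ge>1. weighted_tail_bound f R (\<tau> + C * R powr - \<kappa>)"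
    using hardy_space_weighted_tail[OF p f] by blast
  from this[OF zero_less_one] obtain C where "\<forall>R\<ge>1. weighted_tail_bound f R (1 + C * R powr - \<kappa>)"
    by blast
  from this[rule_format, of 1] have "weighted_tail_bound f 1 (1 + C)" by simp
  then have C: "\<And>y \<eta>. y > 0 \<Longrightarrow>
      set_integrable lborel {x. norm (Complex x \<eta>) \<ge> 1} (\<lambda>x. f (Complex x y) / Complex x \<eta>) \<and>
      (LINT x:{x. norm (Complex x \<eta>) \<ge> 1}|lborel. norm (f (Complex x y) / Complex x \<eta>)) \<le> 1 + C"
    unfolding weighted_tail_bound_def by blast
  have "hardy_one h (1 + C)"
  proof
    show "h holomorphic_on upper_half_plane"
      unfolding h_def by (intro holomorphic_intros hol) (auto simp: complex_eq_iff)
    fix y :: real assume y: "y > 0"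
    have eq: "h (Complex x y) = f (Complex x y) / Complex x (y + 1)" for x
      by (simp add: h_def complex_eq_iff[of "Complex x y + \<i>"])
    have "1 \<le> norm (Complex x (y + 1))" for x
      using abs_Im_le_cmod[of "Complex x (y + 1)"] y by simp
    then have [simp]: "{x. 1 \<le> norm (Complex x (y + 1))} = UNIV" by auto
    show "integrable lborel (\<lambda>x. h (Complex x y))" "(LINT x|lborel. norm (h (Complex x y))) \<le> 1 + C"
      using C[OF y, of "y + 1"] unfolding eq by (simp_all add: set_integrable_def set_lebesgue_integral_def)
  qed
  then show ?thesis ..
qed

lemma integrable_h: "y > 0 \<Longrightarrow> integrable lborel (\<lambda>x. h (Complex x y))"
  using hardy_one_h hardy_one.int by blast

definition g :: "real \<Rightarrow> complex" where
  "g = (SOME g. integrable lborel g \<and> ((\<lambda>y. LINT x|lborel. norm (h (Complex x y) - g x)) \<longlongrightarrow> 0) (at_right 0))"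

lemma integrable_g: "integrable lborel g"
  and tendsto_g: "((\<lambda>y. LINT x|lborel. norm (h (Complex x y) - g x)) \<longlongrightarrow> 0) (at_right 0)"
proof -
  obtain B where "hardy_one h B" using hardy_one_h by blast
  then interpret hardy_one h B .
  have "\<exists>g. integrable lborel g \<and> ((\<lambda>y. LINT x|lborel. norm (h (Complex x y) - g x)) \<longlongrightarrow> 0) (at_right 0)"
    using L1_Cauchy_at_right_limit[OF integrable_h L1_Cauchy] by blast
  from someI_ex[OF this] show "integrable lborel g"
    "((\<lambda>y. LINT x|lborel. norm (h (Complex x y) - g x)) \<longlongrightarrow> 0) (at_right 0)"
    unfolding g_def by blast+
qed

text \<open>A Borel representative of the boundary function of \<open>f\<close>: multiplying by x +
  \<i> undoes the division that produced \<open>h\<close>.\<close>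

definition fb :: "real \<Rightarrow> complex" where "fb x = (of_real x + \<i>) * g x"

lemma fb_measurable [measurable]: "fb \<in> borel_measurable borel"
  using integrable_g unfolding fb_def by measurable

lemma f_L1_convergence:
  shows "set_integrable lborel {a..b} fb"
    and "((\<lambda>y. LINT x:{a..b}|lborel. norm (f (Complex x y) - fb x)) \<longlongrightarrow> 0) (at_right 0)"
proof -
  have *: "f (Complex x y) = (Complex x y + \<i>) * h (Complex x y)" if "y > 0" for x y
    using that by (auto simp: h_def complex_eq_iff)
  have n: "norm (Complex x y + \<i>) \<le> \<bar>a\<bar> + \<bar>b\<bar> + 2" if "x \<in> {a..b}" "0 < y" "y < 1" for x y
    using that cmod_le[of "Complex x y + \<i>"] by auto
  have d: "norm ((Complex x y + \<i>) - (of_real x + \<i>)) \<le> (\<bar>a\<bar> + \<bar>b\<bar> + 2) * y" if "0 < y" for x y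
  proof -
    have "norm ((Complex x y + \<i>) - (of_real x + \<i>)) = 1 * y"
      using that by (simp add: Complex_eq norm_mult)
    also have "\<dots> \<le> (\<bar>a\<bar> + \<bar>b\<bar> + 2) * y" using that by (intro mult_right_mono) auto
    finally show ?thesis .
  qed
  have c: "continuous_on {a..b} (\<lambda>x::real. of_real x + \<i>)" by (intro continuous_intros)
  show "set_integrable lborel {a..b} fb"
    "((\<lambda>y. LINT x:{a..b}|lborel. norm (f (Complex x y) - fb x)) \<longlongrightarrow> 0) (at_right 0)"
    unfolding fb_def
    using weighted_L1_convergence[OF integrable_h integrable_g tendsto_g * c n d] by blast+
qed

text \<open>The differentiation theorem wants an integrable function, whereas \<open>fb\<close> is
  so far known to be integrable only on bounded intervals; hence the truncation to [-n, n] and a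
  countable union of null sets. At a point of differentiability of the extended primitive the Fatou
  theorem gives the limit.\<close>

lemma AE_f_limit: "AE x in lborel. ((\<lambda>y. f (Complex x y)) \<longlongrightarrow> fb x) (at_right 0)"
proof -
  obtain F where F: "\<And>z. Im z > 0 \<Longrightarrow> (F has_field_derivative f z) (at z)"
    using upper_half_plane_primitive[OF hol] by blast
  have "AE x in lborel. \<forall>n::nat. \<bar>x\<bar> < n \<longrightarrow> ((\<lambda>y. f (Complex x y)) \<longlongrightarrow> fb x) (at_right 0)"
    unfolding AE_all_countable
  proof
    fix n :: nat
    show "AE x in lborel. \<bar>x\<bar> < n \<longrightarrow> ((\<lambda>y. f (Complex x y)) \<longlongrightarrow> fb x) (at_right 0)"
    proof (cases "n = 0")
      case False
      define \<phi> where "\<phi> = (\<lambda>x. indicat_real {-real n..real n} x *\<^sub>R fb x)"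
      have i\<phi>: "integrable lborel \<phi>"
        using f_L1_convergence(1)[of "- real n" "real n"] by (simp add: set_integrable_def \<phi>_def)
      have "- real n < real n" using False by simp
      then obtain Fb where Fb:
        "continuous_on {z. Im z \<ge> 0 \<and> Re z \<in> {-real n..real n}} (\<lambda>z. if Im z > 0 then F z else Fb (Re z))"
        "\<And>c d. -real n \<le> c \<Longrightarrow> c \<le> d \<Longrightarrow> d \<le> real n \<Longrightarrow> Fb d - Fb c = (LINT x:{c..d}|lborel. fb x)"
        using boundary_extension_of_primitive[OF hol F _ f_L1_convergence] by blast
      have \<phi>_fb: "(LINT x:{c..d}|lborel. fb x) = (LINT x:{c..d}|lborel. \<phi> x)" if "-real n \<le> c" "d \<le> real n" for c d
        unfolding set_lebesgue_integral_def \<phi>_def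
        by (rule Bochner_Integration.integral_cong) (use that in \<open>auto simp: indicator_def\<close>)
      show ?thesis
        using AE_indefinite_integral_derivative[OF i\<phi>]
      proof eventually_elim
        case (elim x)
        show ?case
        proof
          assume x: "\<bar>x\<bar> < n"
          then have b: "-real n < x" "x < real n" by auto
          have "(Fb has_vector_derivative \<phi> x) (at x)"
            using elim[rule_format, OF b, of Fb] Fb(2) \<phi>_fb by auto
          moreover have "\<phi> x = fb x" using b by (simp add: \<phi>_def)
          ultimately show "((\<lambda>y. f (Complex x y)) \<longlongrightarrow> fb x) (at_right 0)"
            using vertical_limit_of_derivative[OF hol F Fb(1) b] by simp
        qed
      qed
    qed auto
  qed
  then show ?thesis
  proof eventually_elim
    case (elim x)
    obtain n :: nat where "\<bar>x\<bar> < n" using reals_Archimedean2 by blast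
    then show ?case using elim by blast
  qed
qed

lemma AE_boundary_fun: "AE x in lborel. boundary_fun f x = fb x"
  using AE_f_limit by eventually_elim (simp add: boundary_fun_def tendsto_Lim)

lemma boundary_fun_lebesgue: "boundary_fun f \<in> borel_measurable lebesgue"
proof (rule borel_measurable_AE)
  show "fb \<in> borel_measurable lebesgue" by (intro measurable_completion) simp
  show "AE x in lebesgue. fb x = boundary_fun f x"
    unfolding AE_completion_iff using AE_boundary_fun by eventually_elim simp
qed

text \<open>Replaces the pointwise limit, which is controlled only up to a null set and so lives on
  the completed measure, by \<open>fb\<close> on the Borel sets. The divisor m is 1 for the Cesaro
  operator and the variable itself for the tail operator.\<close>

lemma set_integral_boundary_fun:
  assumes A[measurable]: "A \<in> sets borel" and m[measurable]: "m \<in> borel_measurable borel"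
  shows "(LINT u:A|lebesgue. boundary_fun f u / m u) = (LINT u:A|lborel. fb u / m u)"
proof -
  have [measurable]: "A \<in> sets lebesgue" "m \<in> borel_measurable lebesgue" "fb \<in> borel_measurable lebesgue"
    "boundary_fun f \<in> borel_measurable lebesgue"
    using A boundary_fun_lebesgue by (auto intro: measurable_completion)
  have "AE u in lebesgue. boundary_fun f u = fb u"
    unfolding AE_completion_iff by (rule AE_boundary_fun)
  then have "(LINT u:A|lebesgue. boundary_fun f u / m u) = (LINT u:A|lebesgue. fb u / m u)"
    unfolding set_lebesgue_integral_def
    by (intro integral_cong_AE borel_measurable_scaleR borel_measurable_divide borel_measurable_indicator) auto
  also have "\<dots> = (LINT u:A|lborel. fb u / m u)"
    unfolding set_lebesgue_integral_def by (intro integral_completion) measurable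
  finally show ?thesis .
qed

section \<open>The Cesaro operator at the boundary\<close>

lemma cesaro_real_eq:
  assumes "x \<noteq> 0"
  shows "cesaro_real (boundary_fun f) x =
    1 / of_real x * (if x > 0 then LINT u:{0..x}|lborel. fb u else - (LINT u:{x..0}|lborel. fb u))"
proof -
  have e: "(LINT u:{a<..<b}|lebesgue. boundary_fun f u) = (LINT u:{a..b}|lborel. fb u)" if "a \<le> b" for a b
    using set_integral_boundary_fun[of "{a<..<b}" "\<lambda>_. 1"] interval_integral_Icc[OF that, of fb] that
    by (simp add: interval_lebesgue_integral_def)
  show ?thesis
    using assms by (auto simp: cesaro_real_def interval_lebesgue_integral_def e zero_ereal_def)
qed

text \<open>A primitive F extends continuously to the real line, the origin included, so the
  improper integral from 0 to z is F z - Fb 0. Letting z tend to x replaces F z by Fb x, and Fb x -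
  Fb 0 is the oriented integral of \<open>fb\<close>.\<close>

lemma cesaro_boundary:
  assumes x: "x \<noteq> 0"
  shows "((\<lambda>y. cesaro_hardy f (Complex x y)) \<longlongrightarrow> cesaro_real (boundary_fun f) x) (at_right 0)"
proof -
  obtain F where F: "\<And>z. Im z > 0 \<Longrightarrow> (F has_field_derivative f z) (at z)"
    using upper_half_plane_primitive[OF hol] by blast
  \<comment> \<open>The strip has to contain the segment from 0 to x + \<i> y.\<close>
  define N where "N = \<bar>x\<bar> + 1"
  let ?S = "{z. Im z \<ge> 0 \<and> Re z \<in> {-N..N}}"
  have "-N < N" by (simp add: N_def)
  then obtain Fb where Fb:
    "continuous_on ?S (\<lambda>z. if Im z > 0 then F z else Fb (Re z))"
    "\<And>c d. -N \<le> c \<Longrightarrow> c \<le> d \<Longrightarrow> d \<le> N \<Longrightarrow> Fb d - Fb c = (LINT x:{c..d}|lborel. fb x)"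
    using boundary_extension_of_primitive[OF hol F _ f_L1_convergence] by blast
  have C: "cesaro_hardy f (Complex x y) = 1 / Complex x y * (F (Complex x y) - Fb 0)" if y: "y > 0" for y
  proof -
    let ?z = "Complex x y"
    have ci: "contour_integral (linepath (of_real t * ?z) ?z) f = F ?z - F (of_real t * ?z)" if "0 < t" for t
    proof (rule contour_integral_unique)
      have "closed_segment (of_real t * ?z) ?z \<subseteq> upper_half_plane"
        using that y by (intro closed_segment_subset convex_upper_half_plane) auto
      then show "(f has_contour_integral F ?z - F (of_real t * ?z)) (linepath (of_real t * ?z) ?z)"
        using contour_integral_primitive[of upper_half_plane F f "linepath (of_real t * ?z) ?z"] F
        by (auto intro: has_field_derivative_at_within)
    qed
    let ?H = "\<lambda>z. if Im z > 0 then F z else Fb (Re z)"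
    have "((\<lambda>t. ?H (of_real t * ?z)) \<longlongrightarrow> ?H 0) (at_right 0)"
    proof (rule continuous_on_tendsto_compose[OF Fb(1)])
      show "((\<lambda>t. of_real t * ?z) \<longlongrightarrow> 0) (at_right 0)" by (auto intro!: tendsto_eq_intros)
      show "(0::complex) \<in> ?S" by (simp add: N_def)
      have "of_real t * ?z \<in> ?S" if "0 < t" "t < 1" for t
      proof -
        have "\<bar>t * x\<bar> \<le> 1 * \<bar>x\<bar>" unfolding abs_mult using that by (intro mult_right_mono) auto
        then show ?thesis using y that by (auto simp: N_def)
      qed
      then show "\<forall>\<^sub>F t in at_right 0. of_real t * ?z \<in> ?S"
        unfolding eventually_at_right_field by (intro exI[of _ 1]) auto
    qed
    then have "((\<lambda>t. F ?z - ?H (of_real t * ?z)) \<longlongrightarrow> F ?z - Fb 0) (at_right 0)"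
      by (intro tendsto_diff tendsto_const) simp
    then have "((\<lambda>t. contour_integral (linepath (of_real t * ?z) ?z) f) \<longlongrightarrow> F ?z - Fb 0) (at_right 0)"
      by (rule Lim_transform_eventually) (use ci y in \<open>auto simp: eventually_at_filter\<close>)
    then show ?thesis unfolding cesaro_hardy_def by (simp add: tendsto_Lim)
  qed
  have lim: "((\<lambda>y. 1 / Complex x y * (F (Complex x y) - Fb 0)) \<longlongrightarrow> 1 / of_real x * (Fb x - Fb 0)) (at_right 0)"
  proof (intro tendsto_intros)
    show "((\<lambda>y. Complex x y) \<longlongrightarrow> of_real x) (at_right 0)"
      unfolding Complex_eq by (auto intro!: tendsto_eq_intros)
    show "((\<lambda>y. F (Complex x y)) \<longlongrightarrow> Fb x) (at_right 0)"
      by (rule boundary_limit_of_continuous_extension[OF Fb(1)]) (auto simp: N_def)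
  qed (use x in simp)
  have cr: "cesaro_real (boundary_fun f) x = 1 / of_real x * (Fb x - Fb 0)"
  proof (cases "x > 0")
    case True
    then show ?thesis using Fb(2)[of 0 x] by (simp add: cesaro_real_eq[OF x] N_def)
  next
    case False
    then have "Fb 0 - Fb x = (LINT u:{x..0}|lborel. fb u)" using Fb(2)[of x 0] by (simp add: N_def)
    then have "- (LINT u:{x..0}|lborel. fb u) = Fb x - Fb 0" by (metis minus_diff_eq)
    then show ?thesis using False by (simp only: cesaro_real_eq[OF x] if_False)
  qed
  show ?thesis
    unfolding cr by (rule Lim_transform_eventually[OF lim]) (simp add: eventually_at_filter C)
qed

section \<open>The tail operator at the boundary\<close>

lemma k_hol: "(\<lambda>z. f z / z) holomorphic_on upper_half_plane"
  by (intro holomorphic_intros hol) auto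

text \<open>With \<open>h\<close> as reference, f / z is the multiple (z + \<i>) / z = 1 + \<i> / z.
  Away from 0 this multiplier is bounded by 1 + 1 / c, and since its change from x to x + \<i> y has
  modulus y / (|x + \<i> y| |x|), it is Lipschitz in y with constant 1 / c^2.\<close>

lemma k_L1_convergence:
  assumes "0 \<notin> {a..b}"
  shows "set_integrable lborel {a..b} (\<lambda>x. fb x / of_real x)"
    and "((\<lambda>y. LINT x:{a..b}|lborel. norm (f (Complex x y) / Complex x y - fb x / of_real x)) \<longlongrightarrow> 0) (at_right 0)"
proof -
  obtain c where c: "c > 0" "\<And>x. x \<in> {a..b} \<Longrightarrow> c \<le> \<bar>x\<bar>"
  proof (cases "a > 0")
    case True then show ?thesis by (intro that[of a]) auto
  next
    case False then show ?thesis using assms by (intro that[of "if b < 0 then - b else 1"]) auto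
  qed
  let ?m = "\<lambda>z. 1 + \<i> / z"
  define A where "A = max (1 + 1 / c) (1 / (c * c))"
  have nz: "Complex x y \<noteq> 0" if "y > 0" for x y using that by (simp add: complex_eq_iff)
  have *: "f (Complex x y) / Complex x y = ?m (Complex x y) * h (Complex x y)" if "y > 0" for x y
  proof -
    have "Complex x y + \<i> \<noteq> 0" using that by (auto simp: complex_eq_iff)
    then show ?thesis using nz[OF that] by (simp add: h_def divide_simps)
  qed
  have cn: "c \<le> norm (Complex x y)" if "x \<in> {a..b}" for x y
    using c(2)[OF that] abs_Re_le_cmod[of "Complex x y"] by simp
  have n: "norm (?m (Complex x y)) \<le> A" if "x \<in> {a..b}" "0 < y" "y < 1" for x y
  proof -
    have "norm (?m (Complex x y)) \<le> 1 + 1 / norm (Complex x y)"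
      by (rule order_trans[OF norm_triangle_ineq]) (simp add: norm_divide)
    also have "\<dots> \<le> 1 + 1 / c" using cn[OF that(1), of y] c nz[OF that(2), of x] by (intro add_left_mono divide_left_mono mult_pos_pos) (auto intro: less_le_trans)
    finally show ?thesis by (simp add: A_def)
  qed
  have d: "norm (?m (Complex x y) - ?m (of_real x)) \<le> A * y" if "x \<in> {a..b}" "0 < y" "y < 1" for x y
  proof -
    have x: "x \<noteq> 0" using c(1) c(2)[OF that(1)] by auto
    have "?m (Complex x y) - ?m (of_real x) = of_real y / (Complex x y * of_real x)"
      using nz[OF that(2), of x] x by (simp add: divide_simps) (simp add: Complex_eq algebra_simps)
    then have "norm (?m (Complex x y) - ?m (of_real x)) = y / (norm (Complex x y) * \<bar>x\<bar>)"
      using that by (simp add: norm_divide norm_mult)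
    also have "\<dots> \<le> y / (c * c)"
      using cn[OF that(1), of y] c(1) c(2)[OF that(1)] that nz[OF that(2), of x]
      by (intro divide_left_mono mult_mono mult_pos_pos) (auto intro: less_le_trans)
    also have "\<dots> \<le> A * y" using that mult_right_mono[of "1 / (c * c)" A y] by (simp add: A_def)
    finally show ?thesis .
  qed
  have cont: "continuous_on {a..b} (\<lambda>x::real. ?m (of_real x))" using assms by (intro continuous_intros) auto
  have eq: "set_integrable lborel {a..b} (\<lambda>x. ?m (of_real x) * g x)"
    "((\<lambda>y. LINT x:{a..b}|lborel. norm (f (Complex x y) / Complex x y - ?m (of_real x) * g x)) \<longlongrightarrow> 0) (at_right 0)"
    using weighted_L1_convergence[of h g a b "\<lambda>z. f z / z" ?m A, OF integrable_h integrable_g tendsto_g * cont n d]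
    by blast+
  have fb: "?m (of_real x) * g x = fb x / of_real x" if "x \<in> {a..b}" for x
    using that assms by (auto simp: fb_def field_simps)
  show "set_integrable lborel {a..b} (\<lambda>x. fb x / of_real x)"
    using eq(1) set_integrable_cong[of lborel lborel "{a..b}" "{a..b}", OF refl refl fb] by (simp only:)
  show "((\<lambda>y. LINT x:{a..b}|lborel. norm (f (Complex x y) / Complex x y - fb x / of_real x)) \<longlongrightarrow> 0) (at_right 0)"
  proof (rule Lim_transform_eventually[OF eq(2)])
    have "(LINT x:{a..b}|lborel. norm (f (Complex x y) / Complex x y - ?m (of_real x) * g x))
        = (LINT x:{a..b}|lborel. norm (f (Complex x y) / Complex x y - fb x / of_real x))" for y
      using fb by (intro set_lebesgue_integral_cong) auto
    then show "\<forall>\<^sub>F y in at_right 0. (LINT x:{a..b}|lborel. norm (f (Complex x y) / Complex x y - ?m (of_real x) * g x))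
        = (LINT x:{a..b}|lborel. norm (f (Complex x y) / Complex x y - fb x / of_real x))"
      by (intro always_eventually allI)
  qed
qed

text \<open>The quotient |x + \<i>| / |x| is at most 1 + 1 / c, so \<open>g\<close> dominates up to
  a constant, on unbounded sets too; this makes the integrals of the tail operator converge at
  infinity.\<close>

lemma fb_over_integrable:
  assumes "A \<in> sets borel" "c > 0" "\<And>x. x \<in> A \<Longrightarrow> c \<le> \<bar>x\<bar>"
  shows "set_integrable lborel A (\<lambda>x. fb x / of_real x)"
  unfolding set_integrable_def
proof (rule Bochner_Integration.integrable_bound)
  show "integrable lborel (\<lambda>x. (1 + 1 / c) * norm (g x))" using integrable_g by simp
  show "(\<lambda>x. indicat_real A x *\<^sub>R (fb x / of_real x)) \<in> borel_measurable lborel" using assms(1) by measurable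
  show "AE x in lborel. norm (indicat_real A x *\<^sub>R (fb x / of_real x)) \<le> norm ((1 + 1 / c) * norm (g x))"
  proof (rule AE_I2)
    fix x
    show "norm (indicat_real A x *\<^sub>R (fb x / of_real x)) \<le> norm ((1 + 1 / c) * norm (g x))"
    proof (cases "x \<in> A")
      case True
      then have x: "c \<le> \<bar>x\<bar>" "x \<noteq> 0" using assms(2) assms(3)[OF True] by auto
      have "norm (of_real x + \<i>) \<le> \<bar>x\<bar> + 1" by (rule order_trans[OF norm_triangle_ineq]) simp
      then have "norm (of_real x + \<i>) / \<bar>x\<bar> \<le> (\<bar>x\<bar> + 1) / \<bar>x\<bar>" by (intro divide_right_mono) auto
      also have "\<dots> = 1 + 1 / \<bar>x\<bar>" using x by (simp add: field_simps)
      also have "\<dots> \<le> 1 + 1 / c" using x assms(2) by (intro add_left_mono divide_left_mono) auto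
      finally have "norm (of_real x + \<i>) / \<bar>x\<bar> * norm (g x) \<le> (1 + 1 / c) * norm (g x)"
        by (intro mult_right_mono) auto
      then show ?thesis using True assms(2) by (simp add: fb_def norm_mult norm_divide)
    qed (use assms(2) in simp)
  qed
qed

text \<open>Again by increments of a primitive. On segments of length at most 1 the inequality a
  \<le> a^p + 1 replaces Hoelder's inequality and bounds the integral of |f| by B + 1.\<close>

lemma norm_f_le:
  assumes e: "e > 0"
  obtains C where "\<And>z. Im z \<ge> e \<Longrightarrow> norm (f z) \<le> C"
proof -
  obtain B where B: "B \<ge> 0" "\<And>y. y > 0 \<Longrightarrow> (LINT x|lborel. norm (f (Complex x y)) powr p) \<le> B"
    using hardy_space_integral_bound[OF p f] by blast
  obtain F where F: "\<And>z. Im z > 0 \<Longrightarrow> (F has_field_derivative f z) (at z)"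
    using upper_half_plane_primitive[OF hol] by blast
  have "norm (f z) \<le> (B + 1) + 2 * (B + 1) / Im z" if z: "Im z > 0" for z
  proof (rule upper_half_plane_bound_by_increments[OF hol F _ z])
    fix z s assume z: "Im z > 0" and s: "0 \<le> (s::real)" "s \<le> 1"
    have int: "integrable lborel (\<lambda>x. norm (f (Complex x (Im z))) powr p)"
      using f z by (auto simp: hardy_space_def)
    have "norm (F (Complex (Re z + s) (Im z)) - F (Complex (Re z) (Im z)))
        \<le> (LINT x:{Re z..Re z + s}|lborel. norm (f (Complex x (Im z))))"
      using s z by (intro norm_horizontal_increment_le[OF hol F]) auto
    also have "\<dots> \<le> (LINT x|lborel. norm (f (Complex x (Im z))) powr p + indicat_real {Re z..Re z + s} x)"
      unfolding set_lebesgue_integral_def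
    proof (rule integral_mono')
      show "integrable lborel (\<lambda>x. norm (f (Complex x (Im z))) powr p + indicat_real {Re z..Re z + s} x)"
        using int s by simp
      have "a \<le> a powr p + 1" if "a \<ge> 0" for a
      proof (cases "a \<le> 1")
        case False then show ?thesis using powr_mono[of 1 p a] p by simp
      qed (use that in \<open>simp add: add_increasing\<close>)
      then show "indicat_real {Re z..Re z + s} x *\<^sub>R norm (f (Complex x (Im z)))
          \<le> norm (f (Complex x (Im z))) powr p + indicat_real {Re z..Re z + s} x" for x
        by (simp add: indicator_def)
    qed simp
    also have "\<dots> = (LINT x|lborel. norm (f (Complex x (Im z))) powr p) + s"
      using int s by simp
    also have "\<dots> \<le> B + 1" using B(2)[OF z] s by (intro add_mono)
    also have "Complex (Re z + s) (Im z) = z + of_real s" by (simp add: complex_eq_iff)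
    finally show "norm (F (z + of_real s) - F z) \<le> B + 1" by simp
  qed
  moreover have "(B + 1) + 2 * (B + 1) / Im z \<le> (B + 1) + 2 * (B + 1) / e" if "Im z \<ge> e" for z
    using that e B(1) by (intro add_left_mono divide_left_mono) auto
  ultimately have "norm (f z) \<le> (B + 1) + 2 * (B + 1) / e" if "Im z \<ge> e" for z
    using that e by (meson less_le_trans order_trans)
  then show ?thesis by (rule that)
qed

lemma tail_small:
  assumes \<delta>: "\<delta> > 0"
  obtains R where "R \<ge> 1"
    "\<And>y. y > 0 \<Longrightarrow> set_integrable lborel {x. norm (Complex x y) \<ge> R} (\<lambda>x. f (Complex x y) / Complex x y)"
    "\<And>y. y > 0 \<Longrightarrow> (LINT x:{x. norm (Complex x y) \<ge> R}|lborel. norm (f (Complex x y) / Complex x y)) \<le> \<delta>"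
proof -
  obtain \<kappa> where \<kappa>: "\<kappa> > 0" and "\<And>\<tau>. \<tau> > 0 \<Longrightarrow> \<exists>C. \<forall>R\<ge>1. weighted_tail_bound f R (\<tau> + C * R powr - \<kappa>)"
    using hardy_space_weighted_tail[OF p f] by blast
  from this(2)[OF half_gt_zero[OF \<delta>]] obtain C where
    C: "\<And>R. R \<ge> 1 \<Longrightarrow> weighted_tail_bound f R (\<delta> / 2 + C * R powr - \<kappa>)"
    by blast
  have "((\<lambda>R. C * R powr - \<kappa>) \<longlongrightarrow> C * 0) at_top"
    using \<kappa> by (intro tendsto_intros tendsto_neg_powr filterlim_ident) auto
  then have "\<forall>\<^sub>F R in at_top. C * R powr - \<kappa> < \<delta> / 2"
    using \<delta> by (intro order_tendstoD(2)) auto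
  then obtain R0 where R0: "\<And>R. R \<ge> R0 \<Longrightarrow> C * R powr - \<kappa> < \<delta> / 2"
    by (auto simp: eventually_at_top_linorder)
  define R where "R = max R0 1"
  have R: "R \<ge> 1" "C * R powr - \<kappa> < \<delta> / 2" using R0[of R] by (auto simp: R_def)
  show ?thesis
  proof (rule that[OF R(1)])
    fix y :: real assume y: "y > 0"
    note tb = C[OF R(1), unfolded weighted_tail_bound_def, rule_format, OF y, of y]
    show "set_integrable lborel {x. norm (Complex x y) \<ge> R} (\<lambda>x. f (Complex x y) / Complex x y)"
      using tb by blast
    show "(LINT x:{x. norm (Complex x y) \<ge> R}|lborel. norm (f (Complex x y) / Complex x y)) \<le> \<delta>"
      using tb R(2) by linarith
  qed
qed

text \<open>The points w and \<i> n are joined by three segments: horizontally away from the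
  imaginary axis to real part X or -X, vertically to height n, and horizontally back. Moving
  outwards keeps the first segment outside the disc of radius R, and height n \<ge> R does so for
  the last, hence both cost at most \<delta>. On the vertical one \<open>f\<close> is bounded and 1
  / |z| \<le> 1 / X, so a large X makes it cost at most \<delta>. X may depend on w and n, while R
  does not.\<close>

lemma primitive_limit_at_infinity:
  assumes K: "\<And>z. Im z > 0 \<Longrightarrow> (K has_field_derivative f z / z) (at z)"
  obtains L where "\<And>\<delta>. \<delta> > 0 \<Longrightarrow> \<exists>R. \<forall>w. Im w > 0 \<longrightarrow> norm w \<ge> R \<longrightarrow> norm (K w - L) \<le> \<delta>"
proof -
  have main: "\<exists>R\<ge>1. \<forall>w n. Im w > 0 \<longrightarrow> norm w \<ge> R \<longrightarrow> n \<ge> R \<longrightarrow> norm (K w - K (Complex 0 n)) \<le> 3 * \<delta>"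
    if \<delta>: "\<delta> > 0" for \<delta>
  proof -
    obtain R where R: "R \<ge> 1"
      "\<And>y. y > 0 \<Longrightarrow> set_integrable lborel {x. norm (Complex x y) \<ge> R} (\<lambda>x. f (Complex x y) / Complex x y)"
      "\<And>y. y > 0 \<Longrightarrow> (LINT x:{x. norm (Complex x y) \<ge> R}|lborel. norm (f (Complex x y) / Complex x y)) \<le> \<delta>"
      using tail_small[OF \<delta>] by blast
    have hor: "norm (K (Complex d y) - K (Complex c y)) \<le> \<delta>"
      if y: "y > 0" and cd: "c \<le> d" and far: "\<And>x. x \<in> {c..d} \<Longrightarrow> norm (Complex x y) \<ge> R" for c d y
    proof -
      have "norm (K (Complex d y) - K (Complex c y)) \<le> (LINT x:{c..d}|lborel. norm (f (Complex x y) / Complex x y))"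
        using k_hol K cd y by (rule norm_horizontal_increment_le)
      also have "\<dots> \<le> (LINT x:{x. norm (Complex x y) \<ge> R}|lborel. norm (f (Complex x y) / Complex x y))"
        unfolding set_lebesgue_integral_def
        by (rule integral_mono') (use R(2)[OF y, THEN set_integrable_norm] far in \<open>auto simp: set_integrable_def indicator_def\<close>)
      also have "\<dots> \<le> \<delta>" by (rule R(3)[OF y])
      finally show ?thesis .
    qed
    have ray: "norm (K (Complex (s * X) y) - K (Complex (s * a) y)) \<le> \<delta>"
      if "y > 0" "s = 1 \<or> s = -1" "0 \<le> a" "a \<le> X" "norm (Complex a y) \<ge> R" for s a X y
    proof -
      have far: "norm (Complex x y) \<ge> R" if "a \<le> \<bar>x\<bar>" for x
      proof -
        have "norm (Complex a y) \<le> norm (Complex x y)"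
          using power_mono[OF that \<open>0 \<le> a\<close>, of 2] by (simp add: cmod_def)
        then show ?thesis using \<open>norm (Complex a y) \<ge> R\<close> by simp
      qed
      show ?thesis using \<open>s = 1 \<or> s = -1\<close>
      proof
        assume "s = 1"
        then show ?thesis using hor[of y a X] far that by simp
      next
        assume "s = -1"
        then show ?thesis using hor[of y "-X" "-a"] far that by (simp add: norm_minus_commute)
      qed
    qed
    have "norm (K w - K (Complex 0 n)) \<le> 3 * \<delta>" if w: "Im w > 0" "norm w \<ge> R" and n: "n \<ge> R" for w n
    proof -
      define s :: real where "s = (if Re w \<ge> 0 then 1 else -1)"
      define a where "a = \<bar>Re w\<bar>"
      define \<eta> where "\<eta> = Im w"
      have s: "s = 1 \<or> s = -1" and w_eq: "w = Complex (s * a) \<eta>" and a: "a \<ge> 0" and \<eta>: "\<eta> > 0"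
        using w by (auto simp: s_def a_def \<eta>_def complex_eq_iff)
      have na: "norm (Complex a \<eta>) \<ge> R" using w(2) by (simp add: a_def \<eta>_def cmod_def)
      have npos: "n > 0" using n R(1) by simp
      \<comment> \<open>The lowest height on the vertical segment; \<open>f\<close> is bounded above
        this level.\<close>
      define m where "m = min \<eta> n"
      have m: "m > 0" using \<eta> npos by (simp add: m_def)
      obtain C where C: "\<And>z. Im z \<ge> m \<Longrightarrow> norm (f z) \<le> C" using norm_f_le[OF m] by blast
      have C0: "C \<ge> 0" using C[of "Complex 0 m"] norm_ge_zero[of "f (Complex 0 m)"] by (simp del: norm_ge_zero)
      \<comment> \<open>At least a, so that the first segment leads outwards, and large enough for
        the vertical increment, at most C |\<eta> - n| / X, to stay below \<delta>.\<close>
      define X where "X = max (max a 1) (C * \<bar>\<eta> - n\<bar> / \<delta>)"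
      have X: "X \<ge> a" "X \<ge> 1" "C * \<bar>\<eta> - n\<bar> \<le> X * \<delta>"
        using \<delta> by (auto simp: X_def pos_divide_le_eq[symmetric])
      have vert: "norm (K (Complex (s * X) \<eta>) - K (Complex (s * X) n)) \<le> \<delta>"
      proof -
        have "norm (K (Complex (s * X) \<eta>) - K (Complex (s * X) n)) \<le> C / X * norm (\<eta> - n)"
        proof (rule differentiable_bound[of "{m..}" "\<lambda>t. K (Complex (s * X) t)"
              "\<lambda>t u. u *\<^sub>R (\<i> * (f (Complex (s * X) t) / Complex (s * X) t))"])
          fix t assume t: "t \<in> {m..}"
          show "((\<lambda>t. K (Complex (s * X) t)) has_derivative
            (\<lambda>u. u *\<^sub>R (\<i> * (f (Complex (s * X) t) / Complex (s * X) t)))) (at t within {m..})"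
            using vector_derivative_vertical[OF K[of "Complex (s * X) t"]] t m
            by (simp add: has_vector_derivative_def)
          have "X \<le> norm (Complex (s * X) t)"
            using abs_Re_le_cmod[of "Complex (s * X) t"] s X by auto
          then have "norm (f (Complex (s * X) t)) / norm (Complex (s * X) t) \<le> C / X"
            using C[of "Complex (s * X) t"] t X C0 by (intro frac_le) auto
          then show "onorm (\<lambda>u. u *\<^sub>R (\<i> * (f (Complex (s * X) t) / Complex (s * X) t))) \<le> C / X"
            by (intro onorm_scaleR_left_le) (simp add: norm_mult norm_divide)
        qed (auto simp: m_def)
        also have "\<dots> \<le> \<delta>" using X by (simp add: field_simps)
        finally show ?thesis .
      qed
      have h1: "norm (K (Complex (s * X) \<eta>) - K w) \<le> \<delta>"
        unfolding w_eq using ray[OF \<eta> s a X(1) na] .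
      have "norm (Complex 0 n) \<ge> R" using n npos by (simp add: cmod_def)
      then have h2: "norm (K (Complex (s * X) n) - K (Complex 0 n)) \<le> \<delta>"
        using ray[OF npos s, of 0 X] X by simp
      show ?thesis
        using dist_triangle[of "K w" "K (Complex 0 n)" "K (Complex (s * X) \<eta>)"]
          dist_triangle[of "K (Complex (s * X) \<eta>)" "K (Complex 0 n)" "K (Complex (s * X) n)"] h1 h2 vert
        by (simp add: dist_norm norm_minus_commute)
    qed
    then show ?thesis using R(1) by blast
  qed
  have "Cauchy (\<lambda>n. K (Complex 0 (real n)))"
  proof (rule metric_CauchyI)
    fix e :: real assume e: "e > 0"
    obtain R where R: "R \<ge> 1" "\<And>w n. Im w > 0 \<Longrightarrow> norm w \<ge> R \<Longrightarrow> n \<ge> R \<Longrightarrow> norm (K w - K (Complex 0 n)) \<le> 3 * (e / 6)"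
      using main[of "e / 6"] e by auto
    obtain N :: nat where N: "R \<le> N" using real_arch_simple by blast
    have "dist (K (Complex 0 (real m))) (K (Complex 0 (real n))) < e" if "m \<ge> N" "n \<ge> N" for m n
    proof -
      have "real m \<ge> R" "real n \<ge> R" using that N by linarith+
      then show ?thesis using R(2)[of "Complex 0 (real m)" "real n"] R(1) e by (simp add: dist_norm cmod_def)
    qed
    then show "\<exists>M. \<forall>m\<ge>M. \<forall>n\<ge>M. dist (K (Complex 0 (real m))) (K (Complex 0 (real n))) < e" by blast
  qed
  then obtain L where L: "(\<lambda>n. K (Complex 0 (real n))) \<longlonglongrightarrow> L"
    using convergent_eq_Cauchy by (auto simp: convergent_def)
  show ?thesis
  proof (rule that[of L])
    fix \<delta> :: real assume \<delta>: "\<delta> > 0"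
    obtain R where R: "\<And>w n. Im w > 0 \<Longrightarrow> norm w \<ge> R \<Longrightarrow> n \<ge> R \<Longrightarrow> norm (K w - K (Complex 0 n)) \<le> 3 * (\<delta> / 3)"
      using main[of "\<delta> / 3"] \<delta> by auto
    have "norm (K w - L) \<le> \<delta>" if "Im w > 0" "norm w \<ge> R" for w
    proof (rule tendsto_upperbound)
      show "(\<lambda>n. norm (K w - K (Complex 0 (real n)))) \<longlonglongrightarrow> norm (K w - L)" by (intro tendsto_intros L)
      obtain N :: nat where "R \<le> N" using real_arch_simple by blast
      then show "\<forall>\<^sub>F n in sequentially. norm (K w - K (Complex 0 (real n))) \<le> \<delta>"
        unfolding eventually_sequentially using R[OF that] by (intro exI[of _ N]) auto
    qed simp
    then show "\<exists>R. \<forall>w. Im w > 0 \<longrightarrow> norm w \<ge> R \<longrightarrow> norm (K w - L) \<le> \<delta>" by blast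
  qed
qed

lemma tail_hardy_eq:
  assumes K: "\<And>z. Im z > 0 \<Longrightarrow> (K has_field_derivative f z / z) (at z)"
    and L: "\<And>\<delta>. \<delta> > 0 \<Longrightarrow> \<exists>R. \<forall>w. Im w > 0 \<longrightarrow> norm w \<ge> R \<longrightarrow> norm (K w - L) \<le> \<delta>"
    and z: "Im z > 0"
  shows "tail_hardy f z = L - K z"
proof -
  let ?F = "inf at_infinity (principal upper_half_plane)"
  have ev: "eventually P ?F \<longleftrightarrow> (\<exists>b. \<forall>w. b \<le> norm w \<longrightarrow> Im w > 0 \<longrightarrow> P w)" for P
    by (simp add: eventually_inf_principal eventually_at_infinity)
  have "?F \<noteq> bot"
  proof
    assume "?F = bot"
    then have "eventually (\<lambda>_. False) ?F" by simp
    then obtain b where "\<And>w. b \<le> norm w \<Longrightarrow> \<not> Im w > 0" unfolding ev by blast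
    moreover have "b \<le> norm (Complex 0 (\<bar>b\<bar> + 1))" by (simp add: cmod_def)
    ultimately have "\<not> Im (Complex 0 (\<bar>b\<bar> + 1)) > 0" by blast
    then show False by simp
  qed
  have ci: "contour_integral (linepath z w) (\<lambda>\<zeta>. f \<zeta> / \<zeta>) = K w - K z" if "Im w > 0" for w
  proof (rule contour_integral_unique)
    have "closed_segment z w \<subseteq> upper_half_plane"
      using that z by (intro closed_segment_subset convex_upper_half_plane) auto
    then show "((\<lambda>\<zeta>. f \<zeta> / \<zeta>) has_contour_integral K w - K z) (linepath z w)"
      using contour_integral_primitive[of upper_half_plane K "\<lambda>\<zeta>. f \<zeta> / \<zeta>" "linepath z w"] K
      by (auto intro: has_field_derivative_at_within)
  qed
  have "(K \<longlongrightarrow> L) ?F"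
  proof (rule tendstoI)
    fix e :: real assume "e > 0"
    then obtain R where "\<And>w. Im w > 0 \<Longrightarrow> norm w \<ge> R \<Longrightarrow> norm (K w - L) \<le> e / 2" using L[of "e / 2"] by auto
    then show "eventually (\<lambda>w. dist (K w) L < e) ?F"
      unfolding ev dist_norm using \<open>e > 0\<close> by (intro exI[of _ R]) force
  qed
  then have "((\<lambda>w. K w - K z) \<longlongrightarrow> L - K z) ?F" by (intro tendsto_intros)
  then have "((\<lambda>w. contour_integral (linepath z w) (\<lambda>\<zeta>. f \<zeta> / \<zeta>)) \<longlongrightarrow> L - K z) ?F"
    by (rule Lim_transform_eventually) (use ci in \<open>auto simp: ev\<close>)
  then show ?thesis unfolding tail_hardy_def using \<open>?F \<noteq> bot\<close> by (intro tendsto_Lim) auto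
qed

text \<open>The operator is L - K z with L the limit of K at infinity, and the boundary function Kb
  of K tends to this same L at both ends of the real line. Hence L - Kb x is the integral over [x,
  \<infinity>) for x > 0 and minus the integral over the left half-line for x < 0, which accounts
  for the sign in \<open>tail_real\<close>.\<close>

lemma tail_boundary:
  assumes x: "x \<noteq> 0"
  shows "((\<lambda>y. tail_hardy f (Complex x y)) \<longlongrightarrow> tail_real (boundary_fun f) x) (at_right 0)"
proof -
  obtain K where K: "\<And>z. Im z > 0 \<Longrightarrow> (K has_field_derivative f z / z) (at z)"
    using upper_half_plane_primitive[OF k_hol] by blast
  obtain L where L: "\<And>\<delta>. \<delta> > 0 \<Longrightarrow> \<exists>R. \<forall>w. Im w > 0 \<longrightarrow> norm w \<ge> R \<longrightarrow> norm (K w - L) \<le> \<delta>"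
    using primitive_limit_at_infinity[OF K] by blast
  \<comment> \<open>The extension theorem gives a separate function on each interval avoiding 0;
    defining Kb by the vertical limit makes them all restrictions of one function.\<close>
  define Kb where "Kb = (\<lambda>t. Lim (at_right 0) (\<lambda>y. K (Complex t y)))"
  let ?k = "\<lambda>x. fb x / of_real x"
  have ext: "((\<lambda>y. K (Complex c y)) \<longlongrightarrow> Kb c) (at_right 0) \<and> Kb d - Kb c = (LINT u:{c..d}|lborel. ?k u)"
    if cd: "c \<le> d" "0 \<notin> {c..d}" for c d
  proof -
    \<comment> \<open>The case c = d is wanted too, so the interval is enlarged to a nondegenerate
      one, away from 0.\<close>
    obtain a b where ab: "a < b" "{c..d} \<subseteq> {a..b}" "0 \<notin> {a..b}"
    proof (cases "c > 0")
      case True then show ?thesis using cd by (intro that[of c "d + 1"]) auto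
    next
      case False then show ?thesis using cd by (intro that[of "c - 1" d]) auto
    qed
    obtain K' where K':
      "continuous_on {z. Im z \<ge> 0 \<and> Re z \<in> {a..b}} (\<lambda>z. if Im z > 0 then K z else K' (Re z))"
      "\<And>c d. a \<le> c \<Longrightarrow> c \<le> d \<Longrightarrow> d \<le> b \<Longrightarrow> K' d - K' c = (LINT x:{c..d}|lborel. ?k x)"
      using boundary_extension_of_primitive[OF k_hol K ab(1) k_L1_convergence[OF ab(3)]] by blast
    have lim: "((\<lambda>y. K (Complex t y)) \<longlongrightarrow> K' t) (at_right 0)" if "t \<in> {a..b}" for t
      by (rule boundary_limit_of_continuous_extension[OF K'(1) that])
    have "Kb t = K' t" if "t \<in> {a..b}" for t
      unfolding Kb_def using lim[OF that] by (simp add: tendsto_Lim)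
    then show ?thesis using lim[of c] K'(2)[of c d] ab(2) cd(1) by auto
  qed
  have lim: "((\<lambda>y. K (Complex t y)) \<longlongrightarrow> Kb t) (at_right 0)" if "t \<noteq> 0" for t
    using ext[of t t] that by simp
  \<comment> \<open>The bound for K near infinity is uniform in the height, so it survives the
    passage to the real line.\<close>
  have far: "\<exists>R. \<forall>t. \<bar>t\<bar> \<ge> R \<longrightarrow> norm (Kb t - L) \<le> \<delta>" if \<delta>: "\<delta> > 0" for \<delta>
  proof -
    obtain R where R: "\<And>w. Im w > 0 \<Longrightarrow> norm w \<ge> R \<Longrightarrow> norm (K w - L) \<le> \<delta>" using L[OF \<delta>] by blast
    have "norm (Kb t - L) \<le> \<delta>" if t: "\<bar>t\<bar> \<ge> max R 1" for t
    proof (rule tendsto_upperbound)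
      show "((\<lambda>y. norm (K (Complex t y) - L)) \<longlongrightarrow> norm (Kb t - L)) (at_right 0)"
        using t by (intro tendsto_intros lim) auto
      have "norm (K (Complex t y) - L) \<le> \<delta>" if "y > 0" for y
        using R[of "Complex t y"] abs_Re_le_cmod[of "Complex t y"] t that by auto
      then show "\<forall>\<^sub>F y in at_right 0. norm (K (Complex t y) - L) \<le> \<delta>" by (simp add: eventually_at_filter)
    qed simp
    then show ?thesis by blast
  qed
  have top: "(Kb \<longlongrightarrow> L) at_top" and bot: "(Kb \<longlongrightarrow> L) at_bot"
  proof -
    have *: "\<exists>R. \<forall>t. \<bar>t\<bar> \<ge> R \<longrightarrow> dist (Kb t) L < e" if "e > 0" for e
      using far[of "e / 2"] that by (force simp: dist_norm)
    show "(Kb \<longlongrightarrow> L) at_top"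
    proof (rule tendstoI)
      fix e :: real assume "e > 0"
      then obtain R where "\<And>t. \<bar>t\<bar> \<ge> R \<Longrightarrow> dist (Kb t) L < e" using * by blast
      then show "\<forall>\<^sub>F t in at_top. dist (Kb t) L < e"
        unfolding eventually_at_top_linorder by (intro exI[of _ "\<bar>R\<bar>"]) auto
    qed
    show "(Kb \<longlongrightarrow> L) at_bot"
    proof (rule tendstoI)
      fix e :: real assume "e > 0"
      then obtain R where "\<And>t. \<bar>t\<bar> \<ge> R \<Longrightarrow> dist (Kb t) L < e" using * by blast
      then show "\<forall>\<^sub>F t in at_bot. dist (Kb t) L < e"
        unfolding eventually_at_bot_linorder by (intro exI[of _ "- \<bar>R\<bar>"]) auto
    qed
  qed
  have tr: "tail_real (boundary_fun f) x = L - Kb x"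
  proof (cases "x > 0")
    case True
    have "((\<lambda>b. LINT u:{x..b}|lborel. ?k u) \<longlongrightarrow> (LINT u:{x..}|lborel. ?k u)) at_top"
      by (rule tendsto_set_lebesgue_integral_at_top) (use True in \<open>auto intro!: fb_over_integrable[of _ x]\<close>)
    moreover have "((\<lambda>b. LINT u:{x..b}|lborel. ?k u) \<longlongrightarrow> L - Kb x) at_top"
    proof (rule Lim_transform_eventually)
      show "((\<lambda>b. Kb b - Kb x) \<longlongrightarrow> L - Kb x) at_top" by (intro tendsto_intros top)
      show "\<forall>\<^sub>F b in at_top. Kb b - Kb x = (LINT u:{x..b}|lborel. ?k u)"
        unfolding eventually_at_top_linorder using ext[of x] True by (intro exI[of _ x]) auto
    qed
    ultimately have "(LINT u:{x..}|lborel. ?k u) = L - Kb x"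
      by (rule tendsto_unique[OF trivial_limit_at_top_linorder])
    then show ?thesis using True set_integral_boundary_fun[of "{x..}" of_real] by (simp add: tail_real_def)
  next
    case False
    then have x0: "x < 0" using x by simp
    have "((\<lambda>a. LINT u:{a..x}|lborel. ?k u) \<longlongrightarrow> (LINT u:{..x}|lborel. ?k u)) at_bot"
      by (rule tendsto_set_lebesgue_integral_at_bot) (use x0 in \<open>auto intro!: fb_over_integrable[of _ "-x"]\<close>)
    moreover have "((\<lambda>a. LINT u:{a..x}|lborel. ?k u) \<longlongrightarrow> Kb x - L) at_bot"
    proof (rule Lim_transform_eventually)
      show "((\<lambda>a. Kb x - Kb a) \<longlongrightarrow> Kb x - L) at_bot" by (intro tendsto_intros bot)
      show "\<forall>\<^sub>F a in at_bot. Kb x - Kb a = (LINT u:{a..x}|lborel. ?k u)"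
        unfolding eventually_at_bot_linorder using ext[of _ x] x0 by (intro exI[of _ x]) auto
    qed
    ultimately have "(LINT u:{..x}|lborel. ?k u) = Kb x - L"
      by (rule tendsto_unique[OF trivial_limit_at_bot_linorder])
    then show ?thesis using x0 set_integral_boundary_fun[of "{..x}" of_real] by (simp add: tail_real_def)
  qed
  have "((\<lambda>y. L - K (Complex x y)) \<longlongrightarrow> L - Kb x) (at_right 0)" by (intro tendsto_intros lim[OF x])
  then show ?thesis unfolding tr
    by (rule Lim_transform_eventually) (auto simp: eventually_at_filter tail_hardy_eq[OF K L])
qed

end

lemma AE_boundary_conclusion:
  assumes "\<And>x. x \<noteq> 0 \<Longrightarrow> ((\<lambda>y. F (Complex x y)) \<longlongrightarrow> G x) (at_right 0)"
  shows "AE x in lborel. has_boundary_limit F x \<and> boundary_fun F x = G x"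
  using AE_lborel_singleton[of "0::real"]
proof eventually_elim
  case (elim x)
  then show ?case using assms[of x]
    by (auto simp: has_boundary_limit_def boundary_fun_def tendsto_Lim)
qed

theorem theorem4p1:
  shows "(\<forall>(p::real) f. 1 < p \<and> f \<in> hardy_space p \<longrightarrow>
            (AE x in lborel. has_boundary_limit (cesaro_hardy f) x \<and>
               boundary_fun (cesaro_hardy f) x = cesaro_real (boundary_fun f) x)) \<and>
         (\<forall>(p::real) f. 1 \<le> p \<and> f \<in> hardy_space p \<longrightarrow>
            (AE x in lborel. has_boundary_limit (tail_hardy f) x \<and>
               boundary_fun (tail_hardy f) x = tail_real (boundary_fun f) x))"
proof (intro conjI allI impI)
  fix p :: real and f assume "1 < p \<and> f \<in> hardy_space p"
  then interpret hardy_function p f by unfold_locales auto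
  show "AE x in lborel. has_boundary_limit (cesaro_hardy f) x \<and>
    boundary_fun (cesaro_hardy f) x = cesaro_real (boundary_fun f) x"
    by (rule AE_boundary_conclusion[OF cesaro_boundary])
next
  fix p :: real and f assume "1 \<le> p \<and> f \<in> hardy_space p"
  then interpret hardy_function p f by unfold_locales auto
  show "AE x in lborel. has_boundary_limit (tail_hardy f) x \<and>
    boundary_fun (tail_hardy f) x = tail_real (boundary_fun f) x"
    by (rule AE_boundary_conclusion[OF tail_boundary])
qed

end
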